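(* Let $0<\alpha<2$. Let $x,y\ge1$ with $|x-y|\ge1$. Then for $t\le|x-y|^2$, $$p^{(0,\infty)}_t(x,y)\le C\left(\frac{xy}{|x-y|^2}\wedge1\right)\left(g_t\big(c(x-y)\big)+t\,\nu\big(c(x-y)\big)\right),$$ where $c=1/(8\sqrt2)$ and $C$ is a constant (independent of $x,y,t$). Moreover, for every positive integer $d$ there is a constant $c(d,\alpha)$ such that for all such $x,y$, $$\int_1^\infty t^{-d/2+1/2}\,p^{(0,\infty)}_t(x,y)\,dt\le c(d,\alpha)\,\frac{xy}{|x-y|^d}.$$
   Context: $X_t$ is the one-dimensional relativistic $\alpha$-stable process with parameter $m=1$: the Lévy process on $\mathbb{R}$ with $E^0e^{i\xi X_t}=e^{t}e^{-t(\xi^2+1)^{\alpha/2}}$. $p^{(0,\infty)}_t(x,y)$ denotes the transition density of $X$ killed on exiting $(0,\infty)$. Here $g_t(z)=(4\pi t)^{-1/2}e^{-z^2/(4t)}$ and $\nu(z)=\frac{\alpha}{2\Gamma(1-\alpha/2)}\int_0^\infty e^{-u}g_u(z)u^{-1-\alpha/2}\,du$ is the density of the Lévy measure of $X$. *)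

theory Defs
  imports "HOL-Probability.Probability"
begin

definition gker :: "real \<Rightarrow> real \<Rightarrow> real" where
  "gker t z = (4 * pi * t) powr (-1/2) * exp (- (z^2) / (4 * t))"

text \<open>Levy density nu(z) of the relativistic alpha-stable process (m = 1).\<close>
definition levy_nu :: "real \<Rightarrow> real \<Rightarrow> real" where
  "levy_nu \<alpha> z = \<alpha> / (2 * Gamma (1 - \<alpha> / 2)) *
     (LBINT u:{0<..}. exp (- u) * gker u z * u powr (-1 - \<alpha> / 2))"

definition rel_stable_process :: "'a measure \<Rightarrow> real \<Rightarrow> (real \<Rightarrow> 'a \<Rightarrow> real) \<Rightarrow> bool" where
  "rel_stable_process M \<alpha> X \<longleftrightarrow>
     prob_space M \<and>
     (\<forall>t\<ge>0. X t \<in> borel_measurable M) \<and>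
     (\<forall>\<omega>\<in>space M. X 0 \<omega> = 0) \<and>
     (\<forall>\<omega>\<in>space M. \<forall>s\<ge>0. continuous (at_right s) (\<lambda>r. X r \<omega>)) \<and>
     (\<forall>\<omega>\<in>space M. \<forall>s>0. \<exists>l. ((\<lambda>r. X r \<omega>) \<longlongrightarrow> l) (at_left s)) \<and>
     (\<forall>(n::nat) (ts::nat \<Rightarrow> real). 0 \<le> ts 0 \<and> (\<forall>i<n. ts i \<le> ts (Suc i)) \<longrightarrow>
        prob_space.indep_vars M (\<lambda>_. borel) (\<lambda>i \<omega>. X (ts (Suc i)) \<omega> - X (ts i) \<omega>) {..<n}) \<and>
     (\<forall>s t. 0 \<le> s \<and> s \<le> t \<longrightarrow>
        distr M borel (\<lambda>\<omega>. X t \<omega> - X s \<omega>) = distr M borel (X (t - s))) \<and>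
     (\<forall>t\<ge>0. \<forall>\<xi>. char (distr M borel (X t)) \<xi> =
        complex_of_real (exp t * exp (- t * (\<xi>^2 + 1) powr (\<alpha> / 2))))"

text \<open>Event that the process started at x stays in (0,infinity) up to time t, i.e. t < tau_(0,infinity).\<close>
definition survive_event :: "'a measure \<Rightarrow> (real \<Rightarrow> 'a \<Rightarrow> real) \<Rightarrow> real \<Rightarrow> real \<Rightarrow> 'a set" where
  "survive_event M X x t = {\<omega>\<in>space M. \<forall>s\<in>{0..t}. x + X s \<omega> > 0}"

definition killed_density ::
  "'a measure \<Rightarrow> (real \<Rightarrow> 'a \<Rightarrow> real) \<Rightarrow> (real \<Rightarrow> real \<Rightarrow> real \<Rightarrow> real) \<Rightarrow> bool" where
  "killed_density M X p \<longleftrightarrow>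
     (\<forall>t>0. \<forall>x>0. survive_event M X x t \<in> sets M) \<and>
     (\<forall>t>0. \<forall>x>0. \<forall>y>0. p t x y \<ge> 0) \<and>
     (\<forall>t>0. \<forall>x>0. continuous_on {0<..} (p t x)) \<and>
     (\<forall>t>0. \<forall>x>0. \<forall>A\<in>sets borel. A \<subseteq> {0<..} \<longrightarrow>
        emeasure M {\<omega>\<in>survive_event M X x t. x + X t \<omega> \<in> A}
          = (\<integral>\<^sup>+ y\<in>A. ennreal (p t x y) \<partial>lborel))"

end

theory Submission
  imports Defs
begin

text \<open>Observed at integer times, the process is a symmetric random walk whose survival in the half-line
  dominates that of the process. Splitting a path at the time of its minimum gives
  \<open>(\<Sum>k\<le>n. a k * a (n - k)) = 1\<close> for the probability \<open>a n\<close> that the walk started at 0 stays positive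
  for \<open>n\<close> steps, so \<open>a n\<close> has order \<open>1 / sqrt n\<close>. Harris' inequality turns this into the bound
  \<open>C * x / sqrt n\<close> for a walk started at \<open>x \<ge> 1\<close>, with no control of overshoots: for \<open>m\<close> of
  order \<open>x\<^sup>2\<close>, one way to survive \<open>m + n\<close> steps from 0 is to survive \<open>m\<close> steps and be above \<open>x\<close> then, two
  positively correlated events, and to survive \<open>n\<close> further steps. The same restart argument bounds the probability of reaching
  \<open>x + r / 4\<close> before leaving by \<open>C * x / r\<close>, and the rest of the way to a target at distance \<open>r\<close> costs
  an independent Chernoff factor. Time reversal treats the other end point, and applying it together with
  the forward bound gives \<open>p t x y \<le> C * x * y * t powr (-3/2)\<close>.

  For the free law, \<open>exp (- t * (1 + s) powr \<beta>)\<close> is the limit of the powers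
  \<open>(1 - (t / m) * (n * (1 - exp (- (1 + s) / n))) powr \<beta>) ^ m\<close>, which are power series in \<open>exp (- 1 / n)\<close>
  with nonnegative coefficients. So \<open>X t\<close> is a limit of Gaussian mixtures, pointwise bounds for \<open>gker\<close>
  transfer to it, and the Laplace transform at \<open>s = - l\<^sup>2\<close> supplies the factor
  \<open>exp (l\<^sup>2 * t - l * z)\<close>.\<close>

section \<open>Subordination by approximation\<close>

text \<open>The killed density is accessible only through masses of intervals and continuity in the
  end point. All estimates are therefore made for \<open>target\<close> events of half-width
  \<delta>, linearly in \<delta>, and \<open>density_le\<close> turns them into pointwise bounds.
  One increment of length comparable to t is kept apart from the unit steps; its interval bound
  supplies \<delta> and the factor \<open>1 / sqrt t\<close>.

  The walk yields the prefactor \<open>m / sqrt t\<close> with m = min x y, whereas the claim has W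
  = min (x y / r^2) 1. As m r \<le> x y, one has min (m / r) 1 \<le> W and 1 \<le> r W. Passing to W
  thus costs a factor \<open>r / sqrt t\<close> in front of a Gaussian and a factor r in front of an
  exponential. Both are paid by proving decay rates strictly better than those in the theorem.

  Times below 2 leave little room for unit steps; there killing is ignored and exponential decay in
  r alone produces W. For t \<le> 1/2 a factor t must be gained as well; it comes from the smallness
  of \<open>gker u z\<close> for z \<ge> 1 and small u.\<close>

definition nonneg_power_series :: "(real \<Rightarrow> real) \<Rightarrow> bool" where
  "nonneg_power_series f \<longleftrightarrow>
     (\<exists>d. (\<forall>k. 0 \<le> d k) \<and> (\<forall>q. 0 \<le> q \<and> q < 1 \<longrightarrow> (\<lambda>k. d k * q ^ k) sums f q))"

lemma nonneg_power_series_mult: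
  assumes "nonneg_power_series f" "nonneg_power_series g"
  shows "nonneg_power_series (\<lambda>q. f q * g q)"
proof -
  obtain a where a: "\<And>k. 0 \<le> a k" "\<And>q. 0 \<le> q \<Longrightarrow> q < 1 \<Longrightarrow> (\<lambda>k. a k * q ^ k) sums f q"
    using assms(1) unfolding nonneg_power_series_def by blast
  obtain b where b: "\<And>k. 0 \<le> b k" "\<And>q. 0 \<le> q \<Longrightarrow> q < 1 \<Longrightarrow> (\<lambda>k. b k * q ^ k) sums g q"
    using assms(2) unfolding nonneg_power_series_def by blast
  have "(\<lambda>k. (\<Sum>i\<le>k. a i * b (k - i)) * q ^ k) sums (f q * g q)" if q: "0 \<le> q" "q < 1" for q
  proof -
    have "(\<lambda>k. \<Sum>i\<le>k. (a i * q ^ i) * (b (k - i) * q ^ (k - i))) sums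
          ((\<Sum>k. a k * q ^ k) * (\<Sum>k. b k * q ^ k))"
      using a b q sums_summable[OF a(2)[OF q]] sums_summable[OF b(2)[OF q]]
      by (intro Cauchy_product_sums) (auto simp: abs_mult)
    also have "(\<lambda>k. \<Sum>i\<le>k. (a i * q ^ i) * (b (k - i) * q ^ (k - i))) =
               (\<lambda>k. (\<Sum>i\<le>k. a i * b (k - i)) * q ^ k)"
    proof (intro ext)
      fix k
      have "(a i * q ^ i) * (b (k - i) * q ^ (k - i)) = a i * b (k - i) * q ^ k" if "i \<le> k" for i
        using that by (metis (no_types, lifting) le_add_diff_inverse mult.assoc mult.left_commute power_add)
      then show "(\<Sum>i\<le>k. (a i * q ^ i) * (b (k - i) * q ^ (k - i))) = (\<Sum>i\<le>k. a i * b (k - i)) * q ^ k"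
        unfolding sum_distrib_right by (intro sum.cong) auto
    qed
    finally show ?thesis
      using sums_unique[OF a(2)[OF q]] sums_unique[OF b(2)[OF q]] by simp
  qed
  moreover have "0 \<le> (\<Sum>i\<le>k. a i * b (k - i))" for k
    using a b by (intro sum_nonneg mult_nonneg_nonneg)
  ultimately show ?thesis unfolding nonneg_power_series_def
    by (intro exI[of _ "\<lambda>k. \<Sum>i\<le>k. a i * b (k - i)"]) auto
qed

lemma nonneg_power_series_one: "nonneg_power_series (\<lambda>_. 1)"
proof -
  have "(\<lambda>k. (if k = 0 then 1 else 0) * q ^ k) sums (1::real)" for q :: real
    using sums_single[of 0 "\<lambda>k. q ^ k"] by (simp add: if_distrib if_distribR cong: if_cong)
  then show ?thesis unfolding nonneg_power_series_def
    by (intro exI[of _ "\<lambda>k. if k = 0 then 1 else 0"]) auto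
qed

lemma nonneg_power_series_power:
  "nonneg_power_series f \<Longrightarrow> nonneg_power_series (\<lambda>q. f q ^ m)"
  by (induction m) (simp_all add: nonneg_power_series_one nonneg_power_series_mult)

text \<open>Consecutive alternating coefficients differ by the factor (k + 1 - \<beta>) / (k + 2),
  nonnegative for \<beta> < 1, and the first one is -\<beta>. This is the discrete counterpart of
  \<open>s powr \<beta>\<close> being a Bernstein function.\<close>

lemma gbinomial_alternating_nonpos:
  fixes \<beta> :: real
  assumes "0 < \<beta>" "\<beta> < 1"
  shows "(-1) ^ Suc k * (\<beta> gchoose Suc k) \<le> 0"
proof (induction k)
  case (Suc k)
  have "real (Suc (Suc k)) * (\<beta> gchoose Suc (Suc k)) = (\<beta> - real (Suc k)) * (\<beta> gchoose Suc k)"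
    using gbinomial_mult_1[of \<beta> "Suc k"] by (simp add: algebra_simps)
  then have "(\<beta> gchoose Suc (Suc k)) = (\<beta> - real (Suc k)) * (\<beta> gchoose Suc k) / real (Suc (Suc k))"
    by (metis nonzero_mult_div_cancel_left of_nat_neq_0)
  then have "(-1) ^ Suc (Suc k) * (\<beta> gchoose Suc (Suc k)) =
      ((real (Suc k) - \<beta>) / real (Suc (Suc k))) * ((-1) ^ Suc k * (\<beta> gchoose Suc k))"
    by (subst \<open>(\<beta> gchoose Suc (Suc k)) = _\<close>) (simp add: divide_inverse algebra_simps)
  moreover have "(real (Suc k) - \<beta>) / real (Suc (Suc k)) \<ge> 0" using assms by simp
  ultimately show ?case using Suc by (metis mult_nonneg_nonpos)
qed (use assms in simp)

text \<open>The condition b \<le> 1 keeps the constant coefficient 1 - b nonnegative; the others are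
  -b times the alternating binomial coefficients.\<close>

lemma nonneg_power_series_powr:
  fixes \<beta> b :: real
  assumes "0 < \<beta>" "\<beta> < 1" "0 \<le> b" "b \<le> 1"
  shows "nonneg_power_series (\<lambda>q. 1 - b * (1 - q) powr \<beta>)"
proof -
  define d where "d k = (if k = 0 then 1 else 0) - b * ((-1) ^ k * (\<beta> gchoose k))" for k
  have "0 \<le> d k" for k
    using gbinomial_alternating_nonpos[OF assms(1,2), of "k - 1"] assms
    by (cases k) (auto simp: d_def mult_nonneg_nonpos)
  moreover have "(\<lambda>k. d k * q ^ k) sums (1 - b * (1 - q) powr \<beta>)" if q: "0 \<le> q" "q < 1" for q
  proof -
    have "(\<lambda>k. (\<beta> gchoose k) * (- q) ^ k) sums (1 + - q) powr \<beta>"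
      by (rule gen_binomial_real) (use q in auto)
    moreover have "(\<lambda>k. (if k = 0 then 1 else 0) * q ^ k) sums (1::real)"
      using sums_single[of 0 "\<lambda>k. q ^ k"] by (simp add: if_distrib if_distribR cong: if_cong)
    ultimately have "(\<lambda>k. (if k = 0 then 1 else 0) * q ^ k - b * ((\<beta> gchoose k) * (- q) ^ k)) sums
        (1 - b * (1 + - q) powr \<beta>)"
      by (intro sums_diff sums_mult)
    moreover have "(- q) ^ k = (-1) ^ k * q ^ k" for k
      using power_mult_distrib[of "-1" q k] by simp
    ultimately show ?thesis by (simp add: d_def algebra_simps)
  qed
  ultimately show ?thesis unfolding nonneg_power_series_def by blast
qed

text \<open>At q = exp (- (1 + v) / (n + 1)) the approximating power is a power series in q, that
  is, a discrete measure on the times k / (n + 1). The tempering factor exp (- k / (n + 1)) and the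
  normalisation exp t are moved into the weights, so that \<open>\<phi> n v\<close> also makes sense
  for the negative v needed for exponential moments.\<close>

lemma laplace_mixture:
  fixes \<beta> t :: real
  assumes \<beta>: "0 < \<beta>" "\<beta> < 1" and t: "0 < t"
  obtains w :: "nat \<Rightarrow> nat \<Rightarrow> real" and \<phi> :: "nat \<Rightarrow> real \<Rightarrow> real" where
    "\<And>n k. 0 \<le> w n k"
    "\<And>n v. -1 < v \<Longrightarrow> (\<lambda>k. w n k * exp (- v * (real k / real (Suc n)))) sums \<phi> n v"
    "\<And>v. -1 < v \<Longrightarrow> (\<lambda>n. \<phi> n v) \<longlonglongrightarrow> exp (t - t * (1 + v) powr \<beta>)"
proof -
  define K where "K = nat \<lceil>t\<rceil>"
  have K: "t \<le> real K" "1 \<le> K" using t unfolding K_def by linarith+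
  \<comment> \<open>The exponent has to be at least \<open>t * real (Suc n) powr \<beta>\<close> to
    give \<open>b n \<le> 1\<close>; as \<beta> < 1, a multiple K \<ge> t of n + 1 is
    enough.\<close>
  define m where "m n = K * Suc n" for n
  have m_pos: "0 < real (m n)" for n
  proof -
    have "0 < m n" using K by (simp add: m_def)
    then show ?thesis by simp
  qed
  define b where "b n = t * real (Suc n) powr \<beta> / real (m n)" for n
  have b: "0 \<le> b n" "b n \<le> 1" for n
  proof -
    have "real (Suc n) powr \<beta> \<le> real (Suc n) powr 1"
      using \<beta> by (intro powr_mono) auto
    then have "t * real (Suc n) powr \<beta> \<le> real K * real (Suc n)"
      using K t by (intro mult_mono) auto
    then have "t * real (Suc n) powr \<beta> \<le> real (m n)" by (simp only: m_def of_nat_mult)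
    moreover have "0 < real (m n)" by (rule m_pos)
    ultimately show "b n \<le> 1" by (simp add: b_def)
    show "0 \<le> b n" using t by (simp add: b_def)
  qed
  define F where "F n q = (1 - b n * (1 - q) powr \<beta>) ^ m n" for n q
  have "\<forall>n. \<exists>d. (\<forall>k. 0 \<le> d k) \<and> (\<forall>q. 0 \<le> q \<and> q < 1 \<longrightarrow> (\<lambda>k. d k * q ^ k) sums F n q)"
    using nonneg_power_series_power[OF nonneg_power_series_powr[OF \<beta> b]]
    unfolding nonneg_power_series_def F_def by blast
  then obtain d where d: "\<And>n k. 0 \<le> d n k"
    "\<And>n q. 0 \<le> q \<Longrightarrow> q < 1 \<Longrightarrow> (\<lambda>k. d n k * q ^ k) sums F n q" by metis
  define w where "w n k = exp t * (d n k * exp (- (real k / real (Suc n))))" for n k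
  define \<phi> where "\<phi> n v = exp t * F n (exp (- (1 + v) / real (Suc n)))" for n v
  show ?thesis
  proof (rule that[of w \<phi>])
    show "0 \<le> w n k" for n k using d by (simp add: w_def)
    show "(\<lambda>k. w n k * exp (- v * (real k / real (Suc n)))) sums \<phi> n v" if "-1 < v" for n v
    proof -
      have "- (1 + v) / real (Suc n) < 0" using that by (intro divide_neg_pos) auto
      then have "exp (- (1 + v) / real (Suc n)) < 1" by simp
      then have "(\<lambda>k. exp t * (d n k * exp (- (1 + v) / real (Suc n)) ^ k)) sums \<phi> n v"
        unfolding \<phi>_def by (intro sums_mult d) auto
      moreover have "exp t * (d n k * exp (- (1 + v) / real (Suc n)) ^ k) =
          w n k * exp (- v * (real k / real (Suc n)))" for k
      proof -
        have "exp (- (1 + v) / real (Suc n)) ^ k = exp (real k * (- (1 + v) / real (Suc n)))"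
          by (simp only: exp_of_nat_mult)
        also have "real k * (- (1 + v) / real (Suc n)) = - (real k / real (Suc n)) + - v * (real k / real (Suc n))"
          by (simp add: divide_inverse algebra_simps del: of_nat_Suc)
        finally show ?thesis by (simp only: w_def exp_add mult.assoc)
      qed
      ultimately show ?thesis by simp
    qed
    show "(\<lambda>n. \<phi> n v) \<longlonglongrightarrow> exp (t - t * (1 + v) powr \<beta>)" if v: "-1 < v" for v
    proof -
      define y where "y = (\<lambda>n. (real (Suc n) * (1 - exp (- (1 + v) / real (Suc n)))) powr \<beta>)"
      define y' where "y' = (1 + v) powr \<beta>"
      have "(\<lambda>n. real (Suc n) * (1 - exp (- (1 + v) / real (Suc n)))) \<longlonglongrightarrow> 1 + v"
      proof -
        define z where "z = (\<lambda>n. - (1 + v) / real (Suc n))"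
        have z0: "z n \<noteq> 0" for n using v by (simp add: z_def)
        have "z \<longlonglongrightarrow> 0" unfolding z_def
          by (intro tendsto_divide_0[OF tendsto_const] filterlim_at_top_imp_at_infinity
              filterlim_compose[OF filterlim_real_sequentially filterlim_Suc])
        then have "(\<lambda>n. (exp (z n) - 1) / z n) \<longlonglongrightarrow> 1"
          using z0 by (intro filterlim_compose[OF lim_exp_minus_1]) (simp add: filterlim_at)
        then have "(\<lambda>n. (1 + v) * ((exp (z n) - 1) / z n)) \<longlonglongrightarrow> (1 + v) * 1"
          by (intro tendsto_intros)
        moreover have "(1 + v) * ((exp (z n) - 1) / z n) = real (Suc n) * (1 - exp (- (1 + v) / real (Suc n)))" for n
        proof -
          have e: "- (1 + v) / real (Suc n) = z n" by (simp add: z_def)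
          have "real (Suc n) = - (1 + v) / z n" using v by (simp add: z_def)
          moreover have "(1 + v) * ((exp (z n) - 1) / z n) = (- (1 + v) / z n) * (1 - exp (z n))"
            using z0[of n] by (simp add: field_simps)
          ultimately show ?thesis unfolding e by metis
        qed
        ultimately show ?thesis by simp
      qed
      then have ylim: "y \<longlonglongrightarrow> y'"
        unfolding y_def y'_def using v by (intro tendsto_powr tendsto_const) simp_all
      have pos: "0 \<le> 1 - exp (- (1 + v) / real (Suc n))" for n
      proof -
        have "- (1 + v) / real (Suc n) \<le> 0" using v by (intro divide_nonpos_pos) auto
        then show ?thesis by simp
      qed
      have ymul: "y n = real (Suc n) powr \<beta> * (1 - exp (- (1 + v) / real (Suc n))) powr \<beta>" for n
        using pos[of n] by (simp add: y_def powr_mult del: of_nat_Suc)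
      have Feq: "F n (exp (- (1 + v) / real (Suc n))) = (1 - t * y n / real (m n)) ^ m n" for n
        by (simp add: F_def b_def ymul mult.assoc del: of_nat_Suc)
      have mlim: "filterlim m at_top sequentially"
      proof (rule filterlim_at_top_mono[OF filterlim_Suc])
        show "\<forall>\<^sub>F n in sequentially. Suc n \<le> m n" using K mult_le_mono1[of 1 K] unfolding m_def
          by (intro always_eventually allI) (metis mult_1)
      qed
      have lim1: "(\<lambda>n. (1 + (- t * y') / real (m n)) ^ m n) \<longlonglongrightarrow> exp (- t * y')"
        using filterlim_compose[OF tendsto_exp_limit_sequentially[of "- t * y'"] mlim] by simp
      have yb: "\<bar>1 - t * y n / real (m n)\<bar> \<le> 1" for n
      proof -
        have "(1 - exp (- (1 + v) / real (Suc n))) powr \<beta> \<le> 1"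
          using pos[of n] \<beta> by (intro powr_le1) auto
        then have "b n * (1 - exp (- (1 + v) / real (Suc n))) powr \<beta> \<le> 1"
          using b[of n] by (intro mult_le_one) auto
        moreover have "b n * (1 - exp (- (1 + v) / real (Suc n))) powr \<beta> = t * y n / real (m n)"
          by (simp add: b_def ymul mult.assoc del: of_nat_Suc)
        moreover have "0 \<le> t * y n / real (m n)" using t by (simp add: y_def)
        ultimately show ?thesis by simp
      qed
      have mreal: "filterlim (\<lambda>n. real (m n)) at_top sequentially"
        by (rule filterlim_compose[OF filterlim_real_sequentially mlim])
      have "\<forall>\<^sub>F n in sequentially. real (m n) \<ge> t * y' + 1"
        using mreal unfolding filterlim_at_top by blast
      \<comment> \<open>For large n both bases have modulus at most 1, so replacing
        \<open>y n\<close> by its limit changes the \<open>m n\<close>-th power by at most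
        \<open>m n\<close> times the difference of the bases, and the factor \<open>m n\<close>
        cancels.\<close>
      then have ev: "\<forall>\<^sub>F n in sequentially. norm ((1 - t * y n / real (m n)) ^ m n - (1 + (- t * y') / real (m n)) ^ m n)
          \<le> t * \<bar>y n - y'\<bar>"
      proof eventually_elim
        case (elim n)
        have mp: "0 < real (m n)" by (rule m_pos)
        have "0 \<le> t * y' / real (m n)" using t by (simp add: y'_def)
        moreover have "t * y' / real (m n) \<le> 1" using elim mp by simp
        ultimately have "\<bar>1 + (- t * y') / real (m n)\<bar> \<le> 1" by simp
        then have "norm ((1 - t * y n / real (m n)) ^ m n - (1 + (- t * y') / real (m n)) ^ m n)
            \<le> real (m n) * norm ((1 - t * y n / real (m n)) - (1 + (- t * y') / real (m n)))"
          using yb by (intro norm_power_diff) auto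
        also have "(1 - t * y n / real (m n)) - (1 + (- t * y') / real (m n)) = - (t * (y n - y') / real (m n))"
          by (simp add: diff_divide_distrib right_diff_distrib)
        also have "real (m n) * norm (- (t * (y n - y') / real (m n))) = t * \<bar>y n - y'\<bar>"
          using mp t by (simp add: abs_mult)
        finally show ?case .
      qed
      have "(\<lambda>n. t * \<bar>y n - y'\<bar>) \<longlonglongrightarrow> t * \<bar>y' - y'\<bar>"
        by (intro tendsto_intros ylim)
      then have "(\<lambda>n. (1 - t * y n / real (m n)) ^ m n - (1 + (- t * y') / real (m n)) ^ m n) \<longlonglongrightarrow> 0"
        by (intro Lim_null_comparison[OF ev]) simp
      from tendsto_add[OF this lim1]
      have "(\<lambda>n. (1 - t * y n / real (m n)) ^ m n) \<longlonglongrightarrow> exp (- t * y')" by simp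
      then have "(\<lambda>n. exp t * (1 - t * y n / real (m n)) ^ m n) \<longlonglongrightarrow> exp t * exp (- t * y')"
        by (intro tendsto_intros)
      then show ?thesis
        unfolding \<phi>_def Feq y'_def by (simp add: exp_diff exp_minus divide_inverse)
    qed
  qed
qed

section \<open>Gaussian kernels, Fourier inversion and limits of Gaussian mixtures\<close>

lemma gker_nonneg: "0 \<le> gker u z"
  by (simp add: gker_def)

lemma gker_eq_normal_density:
  assumes "0 < u"
  shows "gker u (z - c) = normal_density c (sqrt (2 * u)) z"
proof -
  have m: "(-1/2 :: real) = - (1/2)" by simp
  have "(4 * pi * u) powr (-1/2) = 1 / sqrt (4 * pi * u)"
    unfolding m powr_minus using assms by (subst powr_half_sqrt) (simp_all add: inverse_eq_divide)
  moreover have "2 * pi * (sqrt (2 * u))\<^sup>2 = 4 * pi * u" "2 * (sqrt (2 * u))\<^sup>2 = 4 * u"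
    using assms by simp_all
  ultimately show ?thesis
    unfolding gker_def normal_density_def by metis
qed

lemma gker_measurable [measurable]: "(\<lambda>x. gker u (f x)) \<in> borel_measurable M"
  if [measurable]: "f \<in> borel_measurable M"
  unfolding gker_def by measurable

lemma gker_minus: "gker u (- z) = gker u z"
  by (simp add: gker_def)

text \<open>The standard normal characteristic function at \<open>\<theta> = z / c\<close>, with the
  integration variable rescaled by \<open>c = sqrt (2 * u)\<close>.\<close>

lemma gker_fourier:
  assumes u: "0 < u"
  shows "has_bochner_integral lborel (\<lambda>\<xi>. cos (\<xi> * z) * exp (- u * \<xi>\<^sup>2)) (2 * pi * gker u z)"
proof -
  define c where "c = sqrt (2 * u)"
  have c: "0 < c" "c\<^sup>2 = 2 * u" using u by (simp_all add: c_def)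
  have rd: "real_distribution std_normal_distribution" by (rule real_dist_normal_dist)
  interpret N: real_distribution std_normal_distribution by (rule rd)
  define \<theta> where "\<theta> = z / c"
  have i: "integrable std_normal_distribution (\<lambda>x. iexp (\<theta> * x))"
    by (rule N.integrable_iexp) auto
  have "(\<integral>x. Re (iexp (\<theta> * x)) \<partial>std_normal_distribution) = Re (char std_normal_distribution \<theta>)"
    unfolding char_def by (rule integral_Re[OF i])
  then have v: "(\<integral>x. cos (\<theta> * x) \<partial>std_normal_distribution) = exp (- \<theta>\<^sup>2 / 2)"
    by (simp add: char_std_normal_distribution Re_exp)
  have i2: "integrable std_normal_distribution (\<lambda>x. cos (\<theta> * x))"
    by (rule N.integrable_const_bound[where B=1]) auto
  have hb: "has_bochner_integral lborel (\<lambda>x. std_normal_density x * cos (\<theta> * x)) (exp (- \<theta>\<^sup>2 / 2))"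
    unfolding has_bochner_integral_iff
    using v i2 by (simp add: integral_density integrable_density)
  have "has_bochner_integral lborel (\<lambda>x. std_normal_density (0 + c * x) * cos (\<theta> * (0 + c * x)))
     (exp (- \<theta>\<^sup>2 / 2) /\<^sub>R \<bar>c\<bar>)"
    using hb c by (subst lborel_has_bochner_integral_real_affine_iff[where c=c and t=0, symmetric]) auto
  then have h1: "has_bochner_integral lborel (\<lambda>x. sqrt (2 * pi) * (std_normal_density (0 + c * x) * cos (\<theta> * (0 + c * x))))
     (sqrt (2 * pi) * (exp (- \<theta>\<^sup>2 / 2) /\<^sub>R \<bar>c\<bar>))"
    by (intro has_bochner_integral_mult_right)
  have h2: "sqrt (2 * pi) * (std_normal_density (0 + c * x) * cos (\<theta> * (0 + c * x))) = cos (x * z) * exp (- u * x\<^sup>2)" for x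
    using c by (simp add: std_normal_density_def \<theta>_def power_mult_distrib mult_ac)
  have h3: "sqrt (2 * pi) * (exp (- \<theta>\<^sup>2 / 2) /\<^sub>R \<bar>c\<bar>) = 2 * pi * gker u z"
  proof -
    define r where "r = sqrt (2 * pi)"
    have r: "0 < r" "r * r = 2 * pi" using pi_gt_zero by (simp_all add: r_def)
    have e: "z\<^sup>2 / (2 * c\<^sup>2) = \<theta>\<^sup>2 / 2" by (simp add: \<theta>_def power_divide)
    have "gker u z = normal_density 0 c z"
      using gker_eq_normal_density[OF u, of z 0] by (simp add: c_def)
    also have "\<dots> = 1 / (r * c) * exp (- \<theta>\<^sup>2 / 2)"
      unfolding normal_density_def real_sqrt_mult r_def using c(1) e by simp
    finally have "2 * pi * gker u z = (r * r) * (1 / (r * c) * exp (- \<theta>\<^sup>2 / 2))"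
      using r by simp
    also have "\<dots> = r * (exp (- \<theta>\<^sup>2 / 2) / c)" using r c by (simp add: field_simps)
    finally have "2 * pi * gker u z = r * (exp (- \<theta>\<^sup>2 / 2) / c)" .
    moreover have "exp (- \<theta>\<^sup>2 / 2) /\<^sub>R \<bar>c\<bar> = exp (- \<theta>\<^sup>2 / 2) / c"
      unfolding abs_of_pos[OF c(1)] real_scaleR_def divide_inverse by (rule mult.commute)
    ultimately show ?thesis by (simp only: r_def)
  qed
  show ?thesis using h1 unfolding h2 h3 .
qed

lemma gaussian_integrable: "0 < u \<Longrightarrow> integrable lborel (\<lambda>\<xi>::real. exp (- u * \<xi>\<^sup>2))"
  using gker_fourier[of u 0] by (auto simp: has_bochner_integral_iff)

text \<open>Fubini after writing the kernel as a Fourier integral; the sine part vanishes because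
  \<open>char \<nu>\<close> is real. Smoothing makes the inversion integral absolutely convergent
  for any law.\<close>

lemma gker_smoothing:
  assumes "real_distribution \<nu>" and ch: "\<And>\<xi>. char \<nu> \<xi> = complex_of_real (\<Phi> \<xi>)" and s: "0 < s"
  shows "(\<integral>x. gker s (x - z) \<partial>\<nu>) = (\<integral>\<xi>. cos (\<xi> * z) * exp (- s * \<xi>\<^sup>2) * \<Phi> \<xi> \<partial>lborel) / (2 * pi)"
proof -
  interpret real_distribution \<nu> by fact
  interpret P: pair_sigma_finite \<nu> lborel ..
  have [measurable_cong, simp]: "sets \<nu> = sets borel" by simp
  have ib: "integrable lborel (\<lambda>\<xi>. cos (\<xi> * (x - z)) * exp (- s * \<xi>\<^sup>2))" for x
    using gker_fourier[OF s] by (auto simp: has_bochner_integral_iff)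
  have int: "integrable (\<nu> \<Otimes>\<^sub>M lborel) (\<lambda>(x,\<xi>). cos (\<xi> * (x - z)) * exp (- s * \<xi>\<^sup>2))"
  proof (rule P.Fubini_integrable)
    show "integrable \<nu> (\<lambda>x. \<integral>\<xi>. norm (case (x, \<xi>) of (x, \<xi>) \<Rightarrow> cos (\<xi> * (x - z)) * exp (- s * \<xi>\<^sup>2)) \<partial>lborel)"
    proof (rule integrable_const_bound[where B="\<integral>\<xi>. exp (- s * \<xi>\<^sup>2) \<partial>lborel"])
      show "AE x in \<nu>. norm (\<integral>\<xi>. norm (case (x, \<xi>) of (x, \<xi>) \<Rightarrow> cos (\<xi> * (x - z)) * exp (- s * \<xi>\<^sup>2)) \<partial>lborel)
          \<le> (\<integral>\<xi>. exp (- s * \<xi>\<^sup>2) \<partial>lborel)"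
      proof (rule AE_I2)
        fix x
        have "(\<integral>\<xi>. norm (cos (\<xi> * (x - z)) * exp (- s * \<xi>\<^sup>2)) \<partial>lborel) \<le> (\<integral>\<xi>. exp (- s * \<xi>\<^sup>2) \<partial>lborel)"
          using ib gaussian_integrable[OF s]
          by (intro integral_mono integrable_norm) (auto simp: abs_mult mult_le_cancel_right1)
        then show "norm (\<integral>\<xi>. norm (case (x, \<xi>) of (x, \<xi>) \<Rightarrow> cos (\<xi> * (x - z)) * exp (- s * \<xi>\<^sup>2)) \<partial>lborel)
          \<le> (\<integral>\<xi>. exp (- s * \<xi>\<^sup>2) \<partial>lborel)" by simp
      qed
    qed measurable
  qed (use ib in \<open>auto\<close>)
  have "(\<integral>x. 2 * pi * gker s (x - z) \<partial>\<nu>) = (\<integral>x. (\<integral>\<xi>. cos (\<xi> * (x - z)) * exp (- s * \<xi>\<^sup>2) \<partial>lborel) \<partial>\<nu>)"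
    using gker_fourier[OF s] by (simp add: has_bochner_integral_iff)
  also have "\<dots> = (\<integral>\<xi>. (\<integral>x. cos (\<xi> * (x - z)) * exp (- s * \<xi>\<^sup>2) \<partial>\<nu>) \<partial>lborel)"
    by (rule P.Fubini_integral[OF int, symmetric])
  also have "(\<lambda>\<xi>. \<integral>x. cos (\<xi> * (x - z)) * exp (- s * \<xi>\<^sup>2) \<partial>\<nu>) = (\<lambda>\<xi>. cos (\<xi> * z) * exp (- s * \<xi>\<^sup>2) * \<Phi> \<xi>)"
  proof
    fix \<xi> :: real
    have i: "integrable \<nu> (\<lambda>x. iexp (\<xi> * x))" by (rule integrable_iexp) auto
    have "(\<integral>x. Re (iexp (\<xi> * x)) \<partial>\<nu>) = Re (char \<nu> \<xi>)"
      unfolding char_def by (rule integral_Re[OF i])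
    then have c: "(\<integral>x. cos (\<xi> * x) \<partial>\<nu>) = \<Phi> \<xi>" using ch by (simp add: Re_exp)
    have "(\<integral>x. Im (iexp (\<xi> * x)) \<partial>\<nu>) = Im (char \<nu> \<xi>)"
      unfolding char_def by (rule integral_Im[OF i])
    then have s: "(\<integral>x. sin (\<xi> * x) \<partial>\<nu>) = 0" using ch by (simp add: Im_exp)
    have ic: "integrable \<nu> (\<lambda>x. cos (\<xi> * x))" "integrable \<nu> (\<lambda>x. sin (\<xi> * x))"
      by (rule integrable_const_bound[where B=1]; simp)+
    have "(\<integral>x. cos (\<xi> * (x - z)) \<partial>\<nu>) = (\<integral>x. cos (\<xi> * x) * cos (\<xi> * z) + sin (\<xi> * x) * sin (\<xi> * z) \<partial>\<nu>)"
      by (simp add: right_diff_distrib cos_diff)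
    also have "\<dots> = \<Phi> \<xi> * cos (\<xi> * z)"
      using ic by (simp add: c s)
    finally show "(\<integral>x. cos (\<xi> * (x - z)) * exp (- s * \<xi>\<^sup>2) \<partial>\<nu>) = cos (\<xi> * z) * exp (- s * \<xi>\<^sup>2) * \<Phi> \<xi>"
      by (simp add: mult_ac)
  qed
  finally show ?thesis by (simp add: field_simps)
qed

text \<open>The tilt by l shifts the Laplace argument from \<xi>^2 to \<xi>^2 - l, which stays above
  -1 because l < 1. The extra time s > 0 supplies the Gaussian majorant for exchanging first the sum
  over k and then the limit in n with the \<xi>-integral.\<close>

lemma mixture_gker_limit:
  fixes w :: "nat \<Rightarrow> nat \<Rightarrow> real" and \<phi> :: "nat \<Rightarrow> real \<Rightarrow> real" and z :: real
  assumes w: "\<And>n k. 0 \<le> w n k"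
    and \<phi>: "\<And>n v. -1 < v \<Longrightarrow> (\<lambda>k. w n k * exp (- v * (real k / real (Suc n)))) sums \<phi> n v"
    and lim: "\<And>v. -1 < v \<Longrightarrow> (\<lambda>n. \<phi> n v) \<longlonglongrightarrow> \<psi> v"
    and [measurable]: "\<psi> \<in> borel_measurable borel"
    and s: "0 < s" and l: "l < 1"
  defines "f \<equiv> \<lambda>n k. w n k * (exp (l * (real k / real (Suc n))) * gker (s + real k / real (Suc n)) z)"
  shows "summable (f n)"
    and "(\<lambda>n. \<Sum>k. f n k) \<longlonglongrightarrow> (\<integral>\<xi>. cos (\<xi> * z) * exp (- s * \<xi>\<^sup>2) * \<psi> (\<xi>\<^sup>2 - l) \<partial>lborel) / (2 * pi)"
proof -
  define \<tau> where "\<tau> n k = real k / real (Suc n)" for n k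
  have \<tau>: "0 \<le> \<tau> n k" for n k by (simp add: \<tau>_def)
  define h where "h n k \<xi> = w n k * exp (l * \<tau> n k) * (cos (\<xi> * z) * exp (- (s + \<tau> n k) * \<xi>\<^sup>2))" for n k \<xi>
  have f_eq: "f n k = w n k * (exp (l * \<tau> n k) * gker (s + \<tau> n k) z)" for n k
    by (simp only: f_def \<tau>_def)
  have "has_bochner_integral lborel (h n k) (w n k * exp (l * \<tau> n k) * (2 * pi * gker (s + \<tau> n k) z))" for n k
    unfolding h_def using \<tau>[of n k] s
    by (intro has_bochner_integral_mult_right gker_fourier) simp
  then have hint: "integrable lborel (h n k)" "integral\<^sup>L lborel (h n k) = 2 * pi * f n k" for n k
    unfolding f_eq by (simp_all add: has_bochner_integral_iff mult_ac)
  have hnorm: "norm (h n k \<xi>) \<le> w n k * exp (l * \<tau> n k) * exp (- s * \<xi>\<^sup>2)" for n k \<xi>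
  proof -
    have "\<bar>cos (\<xi> * z)\<bar> * exp (- (s + \<tau> n k) * \<xi>\<^sup>2) \<le> 1 * exp (- s * \<xi>\<^sup>2)"
      using \<tau>[of n k] by (intro mult_mono) (auto simp: algebra_simps)
    then show ?thesis
      using w[of n k] by (auto simp: h_def abs_mult intro!: mult_left_mono)
  qed
  have sm: "summable (\<lambda>k. w n k * exp (l * \<tau> n k))" for n
    using sums_summable[OF \<phi>[of "-l" n]] l by (simp add: \<tau>_def del: of_nat_Suc)
  have sumh: "(\<lambda>k. h n k \<xi>) sums (cos (\<xi> * z) * exp (- s * \<xi>\<^sup>2) * \<phi> n (\<xi>\<^sup>2 - l))" for n \<xi>
  proof -
    have "-1 < \<xi>\<^sup>2 - l" using l zero_le_power2[of \<xi>] by linarith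
    from sums_mult[OF \<phi>[OF this], of "cos (\<xi> * z) * exp (- s * \<xi>\<^sup>2)" n]
    have "(\<lambda>k. cos (\<xi> * z) * exp (- s * \<xi>\<^sup>2) * (w n k * exp (- (\<xi>\<^sup>2 - l) * \<tau> n k))) sums
      (cos (\<xi> * z) * exp (- s * \<xi>\<^sup>2) * \<phi> n (\<xi>\<^sup>2 - l))"
      by (simp only: \<tau>_def)
    moreover have "cos (\<xi> * z) * exp (- s * \<xi>\<^sup>2) * (w n k * exp (- (\<xi>\<^sup>2 - l) * \<tau> n k)) = h n k \<xi>" for k
    proof -
      have "exp (- s * \<xi>\<^sup>2) * exp (- (\<xi>\<^sup>2 - l) * \<tau> n k) = exp (l * \<tau> n k) * exp (- (s + \<tau> n k) * \<xi>\<^sup>2)"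
        unfolding exp_add[symmetric] by (simp add: algebra_simps)
      then show ?thesis unfolding h_def by (metis mult.assoc mult.left_commute)
    qed
    ultimately show ?thesis by simp
  qed
  have snorm: "summable (\<lambda>k. norm (h n k \<xi>))" for n \<xi>
    by (rule summable_comparison_test'[OF summable_mult2[OF sm, of n "exp (- s * \<xi>\<^sup>2)"]])
       (use hnorm in auto)
  have sint: "summable (\<lambda>k. \<integral>\<xi>. norm (h n k \<xi>) \<partial>lborel)" for n
  proof (rule summable_comparison_test'[OF summable_mult2[OF sm, of n "\<integral>\<xi>. exp (- s * \<xi>\<^sup>2) \<partial>lborel"]])
    fix k
    have "(\<integral>\<xi>. norm (h n k \<xi>) \<partial>lborel) \<le> (\<integral>\<xi>. w n k * exp (l * \<tau> n k) * exp (- s * \<xi>\<^sup>2) \<partial>lborel)"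
      using hnorm gaussian_integrable[OF s] hint by (intro integral_mono integrable_norm) auto
    then show "norm (\<integral>\<xi>. norm (h n k \<xi>) \<partial>lborel) \<le> w n k * exp (l * \<tau> n k) * (\<integral>\<xi>. exp (- s * \<xi>\<^sup>2) \<partial>lborel)"
      by simp
  qed
  have S: "(\<lambda>k. 2 * pi * f n k) sums (\<integral>\<xi>. cos (\<xi> * z) * exp (- s * \<xi>\<^sup>2) * \<phi> n (\<xi>\<^sup>2 - l) \<partial>lborel)" for n
    using sums_integral[of lborel "h n"] hint snorm sint sums_unique[OF sumh] by simp
  have S2: "f n sums ((\<integral>\<xi>. cos (\<xi> * z) * exp (- s * \<xi>\<^sup>2) * \<phi> n (\<xi>\<^sup>2 - l) \<partial>lborel) / (2 * pi))" for n
    using sums_mult[OF S[of n], of "1 / (2 * pi)"] by simp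
  then show "summable (f n)" by (rule sums_summable)
  \<comment> \<open>\<open>\<phi> n\<close> is decreasing, so its values at -l, bounded in n by
    convergence, dominate those at \<xi>^2 - l uniformly in n and \<xi>.\<close>
  have "convergent (\<lambda>n. \<phi> n (- l))" using lim[of "-l"] l by (auto simp: convergent_def)
  then obtain B where B: "\<And>n. norm (\<phi> n (- l)) \<le> B"
    using convergent_imp_Bseq Bseq_def by metis
  have \<phi>b: "0 \<le> \<phi> n (\<xi>\<^sup>2 - l)" "\<phi> n (\<xi>\<^sup>2 - l) \<le> B" for n and \<xi> :: real
  proof -
    have v: "-1 < \<xi>\<^sup>2 - l" using l zero_le_power2[of \<xi>] by linarith
    show "0 \<le> \<phi> n (\<xi>\<^sup>2 - l)"
      using \<phi>[OF v] w by (intro sums_le[OF _ sums_zero \<phi>[OF v]]) auto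
    have "- (\<xi>\<^sup>2 - l) * \<tau> n k \<le> l * \<tau> n k" for k
      using mult_nonneg_nonneg[OF zero_le_power2[of \<xi>] \<tau>[of n k]] by (simp add: algebra_simps)
    then have "\<phi> n (\<xi>\<^sup>2 - l) \<le> \<phi> n (- l)"
      using l w by (intro sums_le[OF _ \<phi>[OF v] \<phi>[of "- l"]]) (auto intro!: mult_left_mono simp: \<tau>_def simp del: of_nat_Suc)
    then show "\<phi> n (\<xi>\<^sup>2 - l) \<le> B" using B[of n] by auto
  qed
  have meas: "(\<lambda>\<xi>. cos (\<xi> * z) * exp (- s * \<xi>\<^sup>2) * \<phi> n (\<xi>\<^sup>2 - l)) \<in> borel_measurable lborel" for n
  proof -
    have "(\<lambda>\<xi>. \<Sum>k. h n k \<xi>) \<in> borel_measurable lborel" unfolding h_def by measurable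
    then show ?thesis using sums_unique[OF sumh] by simp
  qed
  have "(\<lambda>n. \<integral>\<xi>. cos (\<xi> * z) * exp (- s * \<xi>\<^sup>2) * \<phi> n (\<xi>\<^sup>2 - l) \<partial>lborel) \<longlonglongrightarrow>
        (\<integral>\<xi>. cos (\<xi> * z) * exp (- s * \<xi>\<^sup>2) * \<psi> (\<xi>\<^sup>2 - l) \<partial>lborel)"
  proof (rule integral_dominated_convergence[where w="\<lambda>\<xi>. B * exp (- s * \<xi>\<^sup>2)"])
    show "integrable lborel (\<lambda>\<xi>. B * exp (- s * \<xi>\<^sup>2))"
      using gaussian_integrable[OF s] by simp
    show "AE \<xi> in lborel. (\<lambda>n. cos (\<xi> * z) * exp (- s * \<xi>\<^sup>2) * \<phi> n (\<xi>\<^sup>2 - l)) \<longlonglongrightarrow>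
        cos (\<xi> * z) * exp (- s * \<xi>\<^sup>2) * \<psi> (\<xi>\<^sup>2 - l)"
    proof (rule AE_I2)
      fix \<xi> :: real
      have "-1 < \<xi>\<^sup>2 - l" using l zero_le_power2[of \<xi>] by linarith
      then show "(\<lambda>n. cos (\<xi> * z) * exp (- s * \<xi>\<^sup>2) * \<phi> n (\<xi>\<^sup>2 - l)) \<longlonglongrightarrow>
        cos (\<xi> * z) * exp (- s * \<xi>\<^sup>2) * \<psi> (\<xi>\<^sup>2 - l)"
        by (intro tendsto_intros lim)
    qed
    fix n
    show "AE \<xi> in lborel. norm (cos (\<xi> * z) * exp (- s * \<xi>\<^sup>2) * \<phi> n (\<xi>\<^sup>2 - l)) \<le> B * exp (- s * \<xi>\<^sup>2)"
    proof (rule AE_I2)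
      fix \<xi> :: real
      have "(\<bar>cos (\<xi> * z)\<bar> * exp (- s * \<xi>\<^sup>2)) * \<phi> n (\<xi>\<^sup>2 - l) \<le> (1 * exp (- s * \<xi>\<^sup>2)) * B"
        using \<phi>b[of n \<xi>] by (intro mult_mono) auto
      then show "norm (cos (\<xi> * z) * exp (- s * \<xi>\<^sup>2) * \<phi> n (\<xi>\<^sup>2 - l)) \<le> B * exp (- s * \<xi>\<^sup>2)"
        using \<phi>b[of n \<xi>] by (simp add: abs_mult mult_ac)
    qed
  qed (use meas in auto)
  then have "(\<lambda>n. (\<integral>\<xi>. cos (\<xi> * z) * exp (- s * \<xi>\<^sup>2) * \<phi> n (\<xi>\<^sup>2 - l) \<partial>lborel) / (2 * pi)) \<longlonglongrightarrow>
        (\<integral>\<xi>. cos (\<xi> * z) * exp (- s * \<xi>\<^sup>2) * \<psi> (\<xi>\<^sup>2 - l) \<partial>lborel) / (2 * pi)"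
    by (intro tendsto_intros) auto
  then show "(\<lambda>n. \<Sum>k. f n k) \<longlonglongrightarrow> (\<integral>\<xi>. cos (\<xi> * z) * exp (- s * \<xi>\<^sup>2) * \<psi> (\<xi>\<^sup>2 - l) \<partial>lborel) / (2 * pi)"
    using sums_unique[OF S2] by simp
qed

section \<open>The free law\<close>

text \<open>Majorant of the characteristic function in the rescaled frequency
  \<open>sqrt (2 * t) * \<xi>\<close>. It is free of t, so undoing the scaling in the inversion
  integral produces the decay \<open>1 / sqrt t\<close>.\<close>

definition char_majorant :: "real \<Rightarrow> real \<Rightarrow> real" where
  "char_majorant \<beta> y = exp (- (((1 + y\<^sup>2) powr \<beta> - 1) / 4))"

lemma char_majorant_measurable [measurable]: "char_majorant \<beta> \<in> borel_measurable borel"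
  unfolding char_majorant_def[abs_def] by measurable

text \<open>For n \<ge> 1/\<beta> the n-th power of \<open>(1 + y\<^sup>2) powr \<beta>\<close> is
  at least 1 + y^2, and one term of the exponential series bounds that power by the exponential. The
  majorant is thus below a multiple of 1 / (1 + y^2).\<close>

lemma char_majorant_integrable:
  assumes "0 < \<beta>"
  shows "integrable lborel (char_majorant \<beta>)"
proof -
  obtain n :: nat where n: "1 / \<beta> \<le> real n" using real_arch_simple by blast
  define C :: real where "C = exp (1/4) * (4 ^ n * fact n)"
  have bound: "norm (char_majorant \<beta> y) \<le> norm (C * inverse (1 + y\<^sup>2))" for y
  proof -
    define x where "x = (1 + y\<^sup>2) powr \<beta>"
    have x: "1 \<le> x" using assms by (simp add: x_def ge_one_powr_ge_zero)
    have "1 + y\<^sup>2 = x powr (1 / \<beta>)"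
      using assms by (simp add: x_def powr_powr add_nonneg_eq_0_iff)
    also have "\<dots> \<le> x powr (real n)" using x n by (intro powr_mono) auto
    also have "\<dots> = x ^ n" using x by (simp add: powr_realpow)
    finally have 1: "1 + y\<^sup>2 \<le> x ^ n" .
    have "(\<Sum>k\<in>{n}. (x / 4) ^ k /\<^sub>R fact k) \<le> exp (x / 4)"
      unfolding exp_def by (intro sum_le_suminf summable_exp_generic) (use x in auto)
    then have "x ^ n \<le> exp (x / 4) * (4 ^ n * fact n)"
      by (simp add: power_divide field_simps)
    with 1 have "1 + y\<^sup>2 \<le> exp (x / 4) * (4 ^ n * fact n)" by linarith
    then have "exp (- (x / 4)) * (1 + y\<^sup>2) \<le> 4 ^ n * fact n"
      by (simp add: exp_minus field_simps)
    then have "exp (- (x / 4)) \<le> (4 ^ n * fact n) * inverse (1 + y\<^sup>2)"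
      by (simp add: pos_le_divide_eq add_pos_nonneg divide_inverse[symmetric])
    then have "exp (1/4) * exp (- (x / 4)) \<le> C * inverse (1 + y\<^sup>2)"
      by (simp add: C_def)
    moreover have "char_majorant \<beta> y = exp (1/4) * exp (- (x / 4))"
      by (simp add: char_majorant_def x_def[symmetric] exp_add[symmetric] diff_divide_distrib)
    moreover have "0 \<le> C" by (simp add: C_def)
    ultimately show ?thesis by simp
  qed
  have "einterval (-\<infinity>) \<infinity> = (UNIV :: real set)" by (auto simp: einterval_def)
  then have "integrable lborel (\<lambda>y::real. inverse (1 + y\<^sup>2))"
    using integrable_inverse_1_plus_square by (simp add: set_integrable_def)
  then have "integrable lborel (\<lambda>y::real. C * inverse (1 + y\<^sup>2))" by simp
  then show ?thesis by (rule Bochner_Integration.integrable_bound) (use bound in \<open>auto\<close>)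
qed

text \<open>Concavity of the power \<beta>, derived from convexity of its inverse power 1/\<beta>.
  It is applied with \<kappa> = 2 t, which is the origin of the restriction 1/2 \<le> t in the free
  bounds.\<close>

lemma powr_scale_concave:
  fixes \<beta> \<eta> \<kappa> :: real
  assumes "0 < \<beta>" "\<beta> \<le> 1" "0 \<le> \<eta>" "1 \<le> \<kappa>"
  shows "(1 + \<kappa> * \<eta>) powr \<beta> - 1 \<le> \<kappa> * ((1 + \<eta>) powr \<beta> - 1)"
proof -
  define B where "B = (1 + \<kappa> * \<eta>) powr \<beta>"
  have \<kappa>\<eta>: "0 \<le> \<kappa> * \<eta>" using assms by simp
  then have B: "0 < B" by (simp add: B_def)
  have "((1 - 1 / \<kappa>) *\<^sub>R 1 + (1 / \<kappa>) *\<^sub>R B) powr (1 / \<beta>) \<le> (1 - 1 / \<kappa>) * 1 powr (1 / \<beta>) + (1 / \<kappa>) * B powr (1 / \<beta>)"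
    using assms B by (intro convex_onD[OF powr_convex]) auto
  also have "B powr (1 / \<beta>) = 1 + \<kappa> * \<eta>"
    using assms \<kappa>\<eta> by (simp add: B_def powr_powr)
  also have "(1 - 1 / \<kappa>) * 1 powr (1 / \<beta>) + (1 / \<kappa>) * (1 + \<kappa> * \<eta>) = 1 + \<eta>"
    using assms by (simp add: field_simps)
  finally have "((1 - 1 / \<kappa>) + B / \<kappa>) powr (1 / \<beta>) \<le> 1 + \<eta>"
    by simp
  then have "(((1 - 1 / \<kappa>) + B / \<kappa>) powr (1 / \<beta>)) powr \<beta> \<le> (1 + \<eta>) powr \<beta>"
    using assms by (intro powr_mono2) auto
  moreover have "0 \<le> 1 - 1 / \<kappa>" using assms by simp
  then have "0 \<le> (1 - 1 / \<kappa>) + B / \<kappa>" using B assms by (intro add_nonneg_nonneg) auto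
  ultimately have "(1 - 1 / \<kappa>) + B / \<kappa> \<le> (1 + \<eta>) powr \<beta>"
    using assms by (simp add: powr_powr)
  then have "\<kappa> * ((1 - 1 / \<kappa>) + B / \<kappa>) \<le> \<kappa> * (1 + \<eta>) powr \<beta>"
    using assms by (intro mult_left_mono) auto
  moreover have "\<kappa> * ((1 - 1 / \<kappa>) + B / \<kappa>) = \<kappa> - 1 + B"
    using assms by (simp add: field_simps)
  ultimately show ?thesis by (simp add: B_def right_diff_distrib)
qed

text \<open>Completing the square in z - 2 u l. On the right z enters only through a factor free of
  u, so the estimate can be summed over a Gaussian mixture.\<close>

lemma gker_exp_bound:
  assumes "0 < u"
  shows "gker u z \<le> exp (l\<^sup>2 * u - l * z) * gker u 0"
proof -
  have "0 \<le> (z - 2 * u * l)\<^sup>2 / (4 * u)" using assms by simp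
  also have "\<dots> = z\<^sup>2 / (4 * u) + (l\<^sup>2 * u - l * z)"
    using assms by (simp add: power2_eq_square field_simps)
  finally have "exp (- (z\<^sup>2) / (4 * u)) \<le> exp (l\<^sup>2 * u - l * z)" by simp
  from mult_left_mono[OF this, of "(4 * pi * u) powr (-1/2)"] show ?thesis
    unfolding gker_def by (simp add: mult_ac)
qed

text \<open>Half of the Gaussian exponent gives exp (u/2 - z/2). The other half, at least 1 / (8 u),
  beats u^(-1/2) and leaves 128 u, which is at most 512 (exp (u/4) - 1). The result is a difference
  of exponentials in u, so its mixture is a difference of two Laplace transforms, of order
  t.\<close>

lemma gker_small_time_bound:
  assumes u: "0 < u" and z: "1 \<le> z"
  shows "gker u z \<le> 512 * exp (- z / 2) * (exp (3 * u / 4) - exp (u / 2))"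
proof -
  have "0 \<le> (z - 2 * u)\<^sup>2 / (8 * u)" using u by simp
  also have "\<dots> = z\<^sup>2 / (8 * u) + (u / 2 - z / 2)"
    using u by (simp add: power2_eq_square field_simps)
  finally have 1: "exp (- (z\<^sup>2 / (8 * u))) \<le> exp (u / 2 - z / 2)" by simp
  have "1 / (8 * u) \<le> z\<^sup>2 / (8 * u)"
    using u z one_le_power[of z 2] by (intro divide_right_mono) auto
  then have 2: "exp (- (z\<^sup>2 / (8 * u))) \<le> exp (- (1 / (8 * u)))" by simp
  have m: "(-1/2 :: real) = - (1/2)" by simp
  have "(4 * pi * u) powr (-1/2) \<le> u powr (-1/2)"
    using u pi_gt3 by (intro powr_mono2') auto
  moreover have "u powr (-1/2) * exp (- (1 / (8 * u))) \<le> 128 * u"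
  proof -
    define y where "y = 1 / u"
    have y: "0 < y" "u = 1 / y" using u by (simp_all add: y_def)
    have "y powr (3/2) \<le> 1 + y\<^sup>2"
    proof (cases "y \<le> 1")
      case True
      then have "y powr (3/2) \<le> 1" using y by (intro powr_le1) auto
      then show ?thesis using zero_le_power2[of y] by linarith
    next
      case False
      then have "y powr (3/2) \<le> y powr 2" by (intro powr_mono) auto
      then show ?thesis using y by simp
    qed
    also have "1 + y\<^sup>2 \<le> 128 * exp (y / 8)"
    proof -
      have "1 + (y / 8) + (y / 8)\<^sup>2 / 2 \<le> exp (y / 8)"
        using exp_lower_Taylor_quadratic[of "y/8"] y by simp
      then show ?thesis using y by (simp add: power_divide field_simps)
    qed
    finally have "y powr (3/2) * exp (- (y / 8)) \<le> 128"
      by (simp add: exp_minus field_simps)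
    moreover have "y powr (3/2) = y * y powr (1/2)"
      using y powr_add[of y 1 "1/2"] by simp
    moreover have "u powr (-1/2) = y powr (1/2)"
      using y unfolding m powr_minus by (simp add: powr_divide)
    ultimately have "y powr (1/2) * exp (- (y / 8)) \<le> 128 * (1 / y)"
      using y by (simp add: pos_le_divide_eq mult_ac)
    moreover have "1 / (8 * u) = y / 8" by (simp add: y_def)
    ultimately show ?thesis
      using \<open>u powr (-1/2) = y powr (1/2)\<close> y(2) by metis
  qed
  ultimately have 3: "(4 * pi * u) powr (-1/2) * exp (- (1 / (8 * u))) \<le> 128 * u"
    by (meson exp_ge_zero mult_right_mono order_trans)
  have "gker u z = (4 * pi * u) powr (-1/2) * exp (- (z\<^sup>2 / (8 * u))) * exp (- (z\<^sup>2 / (8 * u)))"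
    using u by (simp add: gker_def exp_add[symmetric] mult.assoc)
  also have "\<dots> \<le> (4 * pi * u) powr (-1/2) * exp (- (1 / (8 * u))) * exp (u / 2 - z / 2)"
    using 1 2 by (intro mult_mono mult_nonneg_nonneg) auto
  also have "\<dots> \<le> (128 * u) * exp (u / 2 - z / 2)"
    using 3 by (intro mult_right_mono) auto
  also have "\<dots> \<le> (512 * (exp (u / 4) - 1)) * exp (u / 2 - z / 2)"
  proof -
    have "128 * u \<le> 512 * (exp (u / 4) - 1)"
      using mult_left_mono[OF exp_ge_add_one_self[of "u/4"], of 512] by simp
    then show ?thesis by (intro mult_right_mono) auto
  qed
  also have "\<dots> = 512 * exp (- z / 2) * (exp (u / 4) * exp (u / 2) - exp (u / 2))"
  proof -
    have e: "exp (u / 2 - z / 2) = exp (- z / 2) * exp (u / 2)"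
      by (simp add: exp_add[symmetric])
    show ?thesis unfolding e by (simp add: algebra_simps)
  qed
  also have "exp (u / 4) * exp (u / 2) = exp (3 * u / 4)"
    by (simp add: exp_add[symmetric])
  finally show ?thesis .
qed

lemma gker_exp_nn_integral:
  assumes u: "0 < u"
  shows "(\<integral>\<^sup>+ z. ennreal (exp (l * z) * gker u (z - c)) \<partial>lborel) = ennreal (exp (l\<^sup>2 * u + l * c))"
proof -
  have e: "exp (l * z) * gker u (z - c) = exp (l\<^sup>2 * u + l * c) * normal_density (c + 2 * l * u) (sqrt (2 * u)) z" for z
  proof -
    have "l * z + - ((z - c)\<^sup>2) / (4 * u) = (l\<^sup>2 * u + l * c) + - ((z - (c + 2 * l * u))\<^sup>2) / (4 * u)"
      using u by (simp add: power2_eq_square field_simps)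
    then have "exp (l * z) * exp (- ((z - c)\<^sup>2) / (4 * u)) = exp (l\<^sup>2 * u + l * c) * exp (- ((z - (c + 2 * l * u))\<^sup>2) / (4 * u))"
      by (simp only: exp_add[symmetric])
    then show ?thesis
      unfolding gker_eq_normal_density[OF u, symmetric] gker_def by (metis mult.left_commute)
  qed
  interpret N: prob_space "density lborel (normal_density (c + 2 * l * u) (sqrt (2 * u)))"
    using u by (intro prob_space_normal_density) simp
  have "(\<integral>\<^sup>+ z. ennreal (normal_density (c + 2 * l * u) (sqrt (2 * u)) z) \<partial>lborel) = 1"
    using N.emeasure_space_1 by (simp add: emeasure_density)
  then show ?thesis
    unfolding e by (simp add: ennreal_mult nn_integral_cmult)
qed

section \<open>Interval, moment and tail bounds for the law at one fixed time\<close>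

locale relativistic_law = real_distribution \<nu> for \<nu> :: "real measure" +
  fixes \<beta> t :: real
  assumes \<beta>: "0 < \<beta>" "\<beta> < 1" and t_pos: "0 < t"
    and char_eq: "\<And>\<xi>. char \<nu> \<xi> = complex_of_real (exp t * exp (- t * (\<xi>\<^sup>2 + 1) powr \<beta>))"
begin

text \<open>Laplace transform of the tempered stable subordinator at time t; the characteristic
  function of \<nu> at \<xi> is \<open>\<psi> (\<xi>\<^sup>2)\<close>.\<close>

definition \<psi> :: "real \<Rightarrow> real" where "\<psi> v = exp (t - t * (1 + v) powr \<beta>)"

lemma \<psi>_measurable [measurable]: "\<psi> \<in> borel_measurable borel"
  unfolding \<psi>_def[abs_def] by measurable

text \<open>Density at z of \<nu> convolved with the centred Gaussian of variance 2 s. It replaces a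
  density of \<nu>, which is never constructed.\<close>

definition smooth :: "real \<Rightarrow> real \<Rightarrow> real" where "smooth s z = (\<integral>x. gker s (x - z) \<partial>\<nu>)"

lemma \<psi>_le: "0 \<le> l \<Longrightarrow> l < 1 \<Longrightarrow> \<psi> (- l) \<le> exp (t * l)"
proof -
  assume l: "0 \<le> l" "l < 1"
  have "(1 - l) powr 1 \<le> (1 - l) powr \<beta>" using l \<beta> by (intro powr_mono') auto
  then have "t * (1 - l) \<le> t * (1 - l) powr \<beta>" using l t_pos by (intro mult_left_mono) auto
  then show ?thesis by (simp add: \<psi>_def algebra_simps)
qed

lemma mixture:
  obtains w :: "nat \<Rightarrow> nat \<Rightarrow> real" and \<phi> :: "nat \<Rightarrow> real \<Rightarrow> real" where
    "\<And>n k. 0 \<le> w n k"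
    "\<And>n v. -1 < v \<Longrightarrow> (\<lambda>k. w n k * exp (- v * (real k / real (Suc n)))) sums \<phi> n v"
    "\<And>v. -1 < v \<Longrightarrow> (\<lambda>n. \<phi> n v) \<longlonglongrightarrow> \<psi> v"
    "\<And>n s z. 0 < s \<Longrightarrow> summable (\<lambda>k. w n k * gker (s + real k / real (Suc n)) z)"
    "\<And>s z. 0 < s \<Longrightarrow> (\<lambda>n. \<Sum>k. w n k * gker (s + real k / real (Suc n)) z) \<longlonglongrightarrow> smooth s z"
proof -
  obtain w \<phi> where w: "\<And>n k. 0 \<le> w n k"
    and \<phi>: "\<And>n v. -1 < v \<Longrightarrow> (\<lambda>k. w n k * exp (- v * (real k / real (Suc n)))) sums \<phi> n v"
    and lim: "\<And>v. -1 < v \<Longrightarrow> (\<lambda>n. \<phi> n v) \<longlonglongrightarrow> \<psi> v"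
    using laplace_mixture[OF \<beta> t_pos, folded \<psi>_def] by blast
  have ch: "char \<nu> \<xi> = complex_of_real (\<psi> (\<xi>\<^sup>2))" for \<xi>
    by (simp add: char_eq \<psi>_def exp_diff exp_minus divide_inverse add.commute)
  note L = mixture_gker_limit[OF w \<phi> lim \<psi>_measurable, where l=0, simplified]
  show ?thesis
  proof (rule that[OF w \<phi> lim])
    fix s z :: real assume s: "0 < s"
    show "summable (\<lambda>k. w n k * gker (s + real k / real (Suc n)) z)" for n
      using L(1)[OF s] by simp
    have "smooth s z = (\<integral>\<xi>. cos (\<xi> * z) * exp (- s * \<xi>\<^sup>2) * \<psi> (\<xi>\<^sup>2) \<partial>lborel) / (2 * pi)"
      unfolding smooth_def by (rule gker_smoothing[OF _ ch s]) unfold_locales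
    then show "(\<lambda>n. \<Sum>k. w n k * gker (s + real k / real (Suc n)) z) \<longlonglongrightarrow> smooth s z"
      using L(2)[OF s, of z] by simp
  qed auto
qed

end

text \<open>The factor \<open>exp (1/4) * sqrt (4 * pi)\<close> compares an interval with a Gaussian
  bump; the rest is the inversion integral of \<open>char_majorant\<close> in the rescaled
  frequency, with its \<open>1 / sqrt t\<close> taken out.\<close>

definition dens_const :: "real \<Rightarrow> real" where
  "dens_const \<beta> = exp (1/4) * sqrt (4 * pi) * (integral\<^sup>L lborel (char_majorant \<beta>) / sqrt 2) / (2 * pi)"

lemma dens_const_nonneg: "0 \<le> dens_const \<beta>"
proof -
  have "0 \<le> integral\<^sup>L lborel (char_majorant \<beta>)"
    by (intro integral_nonneg_AE) (simp add: char_majorant_def)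
  then show ?thesis unfolding dens_const_def by simp
qed

context relativistic_law
begin

text \<open>Since 1 + \<eta> - l \<ge> (1 - l) (1 + \<eta>) and (1 - l)^\<beta> \<ge> 1 - l, the
  shift costs only exp (t l) while, by l \<le> 1/2, half of t (A - 1) survives in the exponent.
  \<open>powr_scale_concave\<close> with \<kappa> = 2 t halves this once more, whence the 1/4 in
  \<open>char_majorant\<close>.\<close>

lemma \<psi>_shift_le:
  assumes t: "1/2 \<le> t" and l: "0 \<le> l" "l \<le> 1/2"
  shows "\<psi> (\<xi>\<^sup>2 - l) \<le> exp (t * l) * char_majorant \<beta> (sqrt (2 * t) * \<xi>)"
proof -
  define \<eta> where "\<eta> = \<xi>\<^sup>2"
  define A where "A = (1 + \<eta>) powr \<beta>"
  have \<eta>: "0 \<le> \<eta>" by (simp add: \<eta>_def)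
  have A: "1 \<le> A" using \<eta> \<beta> by (simp add: A_def ge_one_powr_ge_zero)
  have W: "1 - l \<le> (1 - l) powr \<beta>"
    using powr_mono'[of \<beta> 1 "1 - l"] l \<beta> by simp
  have "(1 - l) * (1 + \<eta>) \<le> 1 + (\<eta> - l)"
    using mult_nonneg_nonneg[OF l(1) \<eta>] by (simp add: algebra_simps)
  then have "((1 - l) * (1 + \<eta>)) powr \<beta> \<le> (1 + (\<eta> - l)) powr \<beta>"
    using l \<eta> \<beta> by (intro powr_mono2 mult_nonneg_nonneg) auto
  then have "(1 - l) powr \<beta> * A \<le> (1 + (\<eta> - l)) powr \<beta>"
    using l \<eta> by (simp add: powr_mult A_def)
  moreover have "(1 - l) * A \<le> (1 - l) powr \<beta> * A"
    using W A by (intro mult_right_mono) auto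
  moreover have "(1 - l) + (A - 1) / 2 \<le> (1 - l) * A"
  proof -
    have "(1/2) * (A - 1) \<le> (1 - l) * (A - 1)" using l A by (intro mult_right_mono) auto
    then show ?thesis by (simp add: algebra_simps)
  qed
  ultimately have "(1 - l) + (A - 1) / 2 \<le> (1 + (\<eta> - l)) powr \<beta>" by linarith
  then have "t * ((1 - l) + (A - 1) / 2) \<le> t * (1 + (\<eta> - l)) powr \<beta>"
    using t_pos by (intro mult_left_mono) auto
  then have "t - t * l + t * (A - 1) / 2 \<le> t * (1 + (\<eta> - l)) powr \<beta>"
    by (simp add: distrib_left right_diff_distrib)
  moreover have "(1 + (2 * t) * \<eta>) powr \<beta> - 1 \<le> (2 * t) * (A - 1)"
    unfolding A_def using t \<beta> \<eta> by (intro powr_scale_concave) auto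
  ultimately have "t - t * (1 + (\<eta> - l)) powr \<beta> \<le> t * l + - (((1 + (2 * t) * \<eta>) powr \<beta> - 1) / 4)"
  proof -
    have "a - x \<le> b + - (y / 4)" if "a - b + p / 2 \<le> x" "y \<le> 2 * p" for a b p x y :: real
      using that by (simp add: field_simps)
    then show "t - t * l + t * (A - 1) / 2 \<le> t * (1 + (\<eta> - l)) powr \<beta> \<Longrightarrow>
      (1 + (2 * t) * \<eta>) powr \<beta> - 1 \<le> (2 * t) * (A - 1) \<Longrightarrow> ?thesis"
      unfolding mult.assoc by blast
  qed
  moreover have "(sqrt (2 * t) * \<xi>)\<^sup>2 = (2 * t) * \<eta>"
    using t_pos by (simp add: power_mult_distrib \<eta>_def)
  ultimately show ?thesis
    unfolding \<psi>_def char_majorant_def \<eta>_def[symmetric] exp_add[symmetric]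
    by (simp only: exp_le_cancel_iff)
qed

lemma \<psi>_nonneg: "0 \<le> \<psi> v" by (simp add: \<psi>_def)

text \<open>\<open>gker_exp_bound\<close> is summed over the mixture: the value at z is traded for
  the tilted mixture at 0, whose limit is the inversion integral of \<psi> shifted by l^2.\<close>

lemma smooth_le:
  assumes t: "1/2 \<le> t" and l: "0 \<le> l" "l\<^sup>2 \<le> 1/2" and s: "0 < s"
  shows "smooth s z \<le> exp (l\<^sup>2 * s - l * z) * (exp (t * l\<^sup>2) * (integral\<^sup>L lborel (char_majorant \<beta>) / sqrt (2 * t)) / (2 * pi))"
proof -
  obtain w \<phi> where w: "\<And>n k. 0 \<le> w n k"
    and \<phi>: "\<And>n v. -1 < v \<Longrightarrow> (\<lambda>k. w n k * exp (- v * (real k / real (Suc n)))) sums \<phi> n v"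
    and lim: "\<And>v. -1 < v \<Longrightarrow> (\<lambda>n. \<phi> n v) \<longlonglongrightarrow> \<psi> v"
    and sm: "\<And>n s z. 0 < s \<Longrightarrow> summable (\<lambda>k. w n k * gker (s + real k / real (Suc n)) z)"
    and sl: "\<And>s z. 0 < s \<Longrightarrow> (\<lambda>n. \<Sum>k. w n k * gker (s + real k / real (Suc n)) z) \<longlonglongrightarrow> smooth s z"
    using mixture by blast
  have l1: "l\<^sup>2 < 1" using l by simp
  note L = mixture_gker_limit[OF w \<phi> lim \<psi>_measurable s l1, where z=0]
  define f where "f n k = w n k * (exp (l\<^sup>2 * (real k / real (Suc n))) * gker (s + real k / real (Suc n)) 0)" for n k
  have fs: "summable (f n)" for n using L(1)[of n] unfolding f_def .
  have fl: "(\<lambda>n. \<Sum>k. f n k) \<longlonglongrightarrow> (\<integral>\<xi>. exp (- s * \<xi>\<^sup>2) * \<psi> (\<xi>\<^sup>2 - l\<^sup>2) \<partial>lborel) / (2 * pi)"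
    using L(2) unfolding f_def by simp
  have le: "(\<Sum>k. w n k * gker (s + real k / real (Suc n)) z) \<le> exp (l\<^sup>2 * s - l * z) * (\<Sum>k. f n k)" for n
  proof -
    have "w n k * gker (s + real k / real (Suc n)) z \<le> exp (l\<^sup>2 * s - l * z) * f n k" for k
    proof -
      have "gker (s + real k / real (Suc n)) z \<le> exp (l\<^sup>2 * (s + real k / real (Suc n)) - l * z) * gker (s + real k / real (Suc n)) 0"
        using s by (intro gker_exp_bound add_pos_nonneg) auto
      also have "exp (l\<^sup>2 * (s + real k / real (Suc n)) - l * z) = exp (l\<^sup>2 * s - l * z) * exp (l\<^sup>2 * (real k / real (Suc n)))"
        unfolding exp_add[symmetric] by (simp add: algebra_simps)
      finally have "w n k * gker (s + real k / real (Suc n)) z \<le> w n k * (exp (l\<^sup>2 * s - l * z) * exp (l\<^sup>2 * (real k / real (Suc n))) * gker (s + real k / real (Suc n)) 0)"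
        using w by (intro mult_left_mono) auto
      then show ?thesis unfolding f_def by (simp only: mult.left_commute mult.assoc)
    qed
    then have "(\<Sum>k. w n k * gker (s + real k / real (Suc n)) z) \<le> (\<Sum>k. exp (l\<^sup>2 * s - l * z) * f n k)"
      using fs sm[OF s] by (intro suminf_le summable_mult) auto
    then show ?thesis using suminf_mult[OF fs] by simp
  qed
  have "smooth s z \<le> exp (l\<^sup>2 * s - l * z) * ((\<integral>\<xi>. exp (- s * \<xi>\<^sup>2) * \<psi> (\<xi>\<^sup>2 - l\<^sup>2) \<partial>lborel) / (2 * pi))"
    by (rule LIMSEQ_le[OF sl[OF s] tendsto_mult[OF tendsto_const fl]]) (use le in auto)
  also have "\<dots> \<le> exp (l\<^sup>2 * s - l * z) * ((exp (t * l\<^sup>2) * (integral\<^sup>L lborel (char_majorant \<beta>) / sqrt (2 * t))) / (2 * pi))"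
  proof (intro mult_left_mono divide_right_mono)
    define c where "c = sqrt (2 * t)"
    have c: "0 < c" using t_pos by (simp add: c_def)
    have ci: "integrable lborel (\<lambda>\<xi>. char_majorant \<beta> (0 + c * \<xi>))"
      using char_majorant_integrable[OF \<beta>(1)] c by (intro lborel_integrable_real_affine) auto
    have pw: "exp (- s * \<xi>\<^sup>2) * \<psi> (\<xi>\<^sup>2 - l\<^sup>2) \<le> exp (t * l\<^sup>2) * char_majorant \<beta> (0 + c * \<xi>)" for \<xi>
    proof -
      have "exp (- s * \<xi>\<^sup>2) * \<psi> (\<xi>\<^sup>2 - l\<^sup>2) \<le> 1 * \<psi> (\<xi>\<^sup>2 - l\<^sup>2)"
        using s \<psi>_nonneg by (intro mult_right_mono) auto
      also have "\<dots> \<le> exp (t * l\<^sup>2) * char_majorant \<beta> (0 + c * \<xi>)"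
        using \<psi>_shift_le[OF t zero_le_power2 l(2)] by (simp add: c_def)
      finally show ?thesis .
    qed
    have "(\<integral>\<xi>. exp (- s * \<xi>\<^sup>2) * \<psi> (\<xi>\<^sup>2 - l\<^sup>2) \<partial>lborel) \<le> (\<integral>\<xi>. exp (t * l\<^sup>2) * char_majorant \<beta> (0 + c * \<xi>) \<partial>lborel)"
    proof (rule integral_mono[OF _ _ pw])
      show i: "integrable lborel (\<lambda>\<xi>. exp (t * l\<^sup>2) * char_majorant \<beta> (0 + c * \<xi>))" using ci by simp
      show "integrable lborel (\<lambda>\<xi>. exp (- s * \<xi>\<^sup>2) * \<psi> (\<xi>\<^sup>2 - l\<^sup>2))"
      proof (rule Bochner_Integration.integrable_bound[OF i], measurable, rule AE_I2)
        fix \<xi> :: real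
        have "norm (exp (- s * \<xi>\<^sup>2) * \<psi> (\<xi>\<^sup>2 - l\<^sup>2)) = exp (- s * \<xi>\<^sup>2) * \<psi> (\<xi>\<^sup>2 - l\<^sup>2)"
          using \<psi>_nonneg by simp
        then show "norm (exp (- s * \<xi>\<^sup>2) * \<psi> (\<xi>\<^sup>2 - l\<^sup>2)) \<le> norm (exp (t * l\<^sup>2) * char_majorant \<beta> (0 + c * \<xi>))"
          using pw[of \<xi>] by (simp add: char_majorant_def)
      qed
    qed
    also have "\<dots> = exp (t * l\<^sup>2) * (\<integral>\<xi>. char_majorant \<beta> (0 + c * \<xi>) \<partial>lborel)" by simp
    also have "(\<integral>\<xi>. char_majorant \<beta> (0 + c * \<xi>) \<partial>lborel) = integral\<^sup>L lborel (char_majorant \<beta>) / c"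
      using lborel_integral_real_affine[of c "char_majorant \<beta>" 0] c
      by (simp add: nonzero_eq_divide_eq mult.commute)
    finally show "(\<integral>\<xi>. exp (- s * \<xi>\<^sup>2) * \<psi> (\<xi>\<^sup>2 - l\<^sup>2) \<partial>lborel) \<le> exp (t * l\<^sup>2) * (integral\<^sup>L lborel (char_majorant \<beta>) / sqrt (2 * t))"
      by (simp add: c_def)
  qed auto
  finally show ?thesis by simp
qed

lemma gker_integrable: "0 < s \<Longrightarrow> integrable \<nu> (\<lambda>x. gker s (x - z))"
proof (rule integrable_const_bound[where B="(4 * pi * s) powr (-1/2)"])
  show "AE x in \<nu>. norm (gker s (x - z)) \<le> (4 * pi * s) powr (-1/2)" if "0 < s"
    using that by (intro AE_I2) (auto simp: gker_def mult_le_cancel_left1)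
qed measurable

text \<open>Within distance \<delta> of z the kernel \<open>gker (\<delta>\<^sup>2)\<close> is at
  least \<open>exp (- 1/4) / (sqrt (4 * pi) * \<delta>)\<close>, so a multiple of it dominates the
  indicator of the interval.\<close>

lemma interval_le_smooth:
  assumes d: "0 < \<delta>"
  shows "measure \<nu> {z - \<delta><..<z + \<delta>} \<le> \<delta> * (exp (1/4) * sqrt (4 * pi)) * smooth (\<delta>\<^sup>2) z"
proof -
  have "measure \<nu> {z - \<delta><..<z + \<delta>} = (\<integral>x. indicator {z - \<delta><..<z + \<delta>} x \<partial>\<nu>)"
    by simp
  also have "\<dots> \<le> (\<integral>x. \<delta> * (exp (1/4) * sqrt (4 * pi)) * gker (\<delta>\<^sup>2) (x - z) \<partial>\<nu>)"
  proof (rule integral_mono)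
    show "integrable \<nu> (\<lambda>x. \<delta> * (exp (1/4) * sqrt (4 * pi)) * gker (\<delta>\<^sup>2) (x - z))"
      using gker_integrable[of "\<delta>\<^sup>2"] d by simp
    show "integrable \<nu> (indicat_real {z - \<delta><..<z + \<delta>})"
      by (intro integrable_const_bound[where B=1]) auto
    fix x
    show "indicat_real {z - \<delta><..<z + \<delta>} x \<le> \<delta> * (exp (1/4) * sqrt (4 * pi)) * gker (\<delta>\<^sup>2) (x - z)"
    proof (cases "x \<in> {z - \<delta><..<z + \<delta>}")
      case True
      then have "\<bar>x - z\<bar> \<le> \<delta>" by auto
      then have "(x - z)\<^sup>2 \<le> \<delta>\<^sup>2" using d by (metis abs_le_square_iff abs_of_pos)
      then have "(x - z)\<^sup>2 / (4 * \<delta>\<^sup>2) \<le> 1/4" using d by (simp add: field_simps)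
      then have e: "exp (- (1/4)) \<le> exp (- ((x - z)\<^sup>2) / (4 * \<delta>\<^sup>2))" by simp
      have m: "(-1/2 :: real) = - (1/2)" by simp
      have "(4 * pi * \<delta>\<^sup>2) powr (-1/2) = 1 / (sqrt (4 * pi) * \<delta>)"
        unfolding m powr_minus using d
        by (subst powr_half_sqrt) (simp_all add: inverse_eq_divide real_sqrt_mult)
      then have "\<delta> * sqrt (4 * pi) * (4 * pi * \<delta>\<^sup>2) powr (-1/2) = 1" using d by simp
      then have "\<delta> * (exp (1/4) * sqrt (4 * pi)) * gker (\<delta>\<^sup>2) (x - z) = exp (1/4) * exp (- ((x - z)\<^sup>2) / (4 * \<delta>\<^sup>2))"
      proof -
        assume 1: "\<delta> * sqrt (4 * pi) * (4 * pi * \<delta>\<^sup>2) powr (-1/2) = 1"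
        have comm: "\<delta> * (E * q) * (P * e) = (\<delta> * q * P) * (E * e)" for E q P e :: real
          by (simp only: mult_ac)
        show ?thesis unfolding gker_def comm 1 by (simp only: mult_1)
      qed
      also have "exp (1/4) * exp (- ((x - z)\<^sup>2) / (4 * \<delta>\<^sup>2)) \<ge> exp (1/4) * exp (- (1/4))"
        using e by (intro mult_left_mono) auto
      finally show ?thesis using True by (simp add: exp_add[symmetric])
    qed (use d gker_nonneg in auto)
  qed
  also have "\<dots> = \<delta> * (exp (1/4) * sqrt (4 * pi)) * smooth (\<delta>\<^sup>2) z"
    by (simp add: smooth_def)
  finally show ?thesis .
qed

lemma interval_bound:
  assumes t: "1/2 \<le> t" and l: "0 \<le> l" "l\<^sup>2 \<le> 1/2" and d: "0 < \<delta>"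
  shows "measure \<nu> {z - \<delta><..<z + \<delta>} \<le> \<delta> * (dens_const \<beta> / sqrt t * exp (l\<^sup>2 * (\<delta>\<^sup>2 + t) - l * z))"
proof -
  have "measure \<nu> {z - \<delta><..<z + \<delta>} \<le> \<delta> * (exp (1/4) * sqrt (4 * pi)) *
    (exp (l\<^sup>2 * \<delta>\<^sup>2 - l * z) * (exp (t * l\<^sup>2) * (integral\<^sup>L lborel (char_majorant \<beta>) / sqrt (2 * t)) / (2 * pi)))"
    using d by (intro order_trans[OF interval_le_smooth[OF d]] mult_left_mono smooth_le t l) auto
  also have "\<dots> = \<delta> * (dens_const \<beta> / sqrt t * (exp (l\<^sup>2 * \<delta>\<^sup>2 - l * z) * exp (t * l\<^sup>2)))"
    unfolding dens_const_def by (simp add: real_sqrt_mult mult_ac)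
  also have "exp (l\<^sup>2 * \<delta>\<^sup>2 - l * z) * exp (t * l\<^sup>2) = exp (l\<^sup>2 * (\<delta>\<^sup>2 + t) - l * z)"
    unfolding exp_add[symmetric] by (simp add: algebra_simps)
  finally show ?thesis .
qed

text \<open>The mixture of \<open>gker_small_time_bound\<close> tends to a multiple of \<open>exp (3
  * s / 4) * \<psi> (- (3/4)) - exp (s / 2) * \<psi> (- (1/2))\<close>. The first term is 1 + O(t)
  from above and the second is at least 1, so the difference is at most 8 t; 4096 is 8 times
  512.\<close>

lemma smooth_small_time_le:
  assumes t: "t \<le> 1" and s: "0 < s" "s \<le> t" and z: "1 \<le> z"
  shows "smooth s z \<le> 4096 * t * exp (- z / 2)"
proof -
  obtain w \<phi> where w: "\<And>n k. 0 \<le> w n k"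
    and \<phi>: "\<And>n v. -1 < v \<Longrightarrow> (\<lambda>k. w n k * exp (- v * (real k / real (Suc n)))) sums \<phi> n v"
    and lim: "\<And>v. -1 < v \<Longrightarrow> (\<lambda>n. \<phi> n v) \<longlonglongrightarrow> \<psi> v"
    and sm: "\<And>n s z. 0 < s \<Longrightarrow> summable (\<lambda>k. w n k * gker (s + real k / real (Suc n)) z)"
    and sl: "\<And>s z. 0 < s \<Longrightarrow> (\<lambda>n. \<Sum>k. w n k * gker (s + real k / real (Suc n)) z) \<longlonglongrightarrow> smooth s z"
    using mixture by blast
  define R where "R n = exp (3 * s / 4) * \<phi> n (- (3/4)) - exp (s / 2) * \<phi> n (- (1/2))" for n
  have le: "(\<Sum>k. w n k * gker (s + real k / real (Suc n)) z) \<le> 512 * exp (- z / 2) * R n" for n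
  proof -
    define \<tau> where "\<tau> k = real k / real (Suc n)" for k
    have \<tau>: "0 \<le> \<tau> k" for k by (simp add: \<tau>_def)
    have "(\<lambda>k. exp (3 * s / 4) * (w n k * exp (- (- (3/4)) * \<tau> k)) - exp (s / 2) * (w n k * exp (- (- (1/2)) * \<tau> k))) sums R n"
      unfolding R_def \<tau>_def by (intro sums_diff sums_mult \<phi>) auto
    then have "(\<lambda>k. 512 * exp (- z / 2) * (exp (3 * s / 4) * (w n k * exp (- (- (3/4)) * \<tau> k)) - exp (s / 2) * (w n k * exp (- (- (1/2)) * \<tau> k)))) sums (512 * exp (- z / 2) * R n)"
      by (rule sums_mult)
    note S0 = this
    have eq: "512 * exp (- z / 2) * (exp (3 * s / 4) * (w n k * exp (- (- (3/4)) * \<tau> k)) - exp (s / 2) * (w n k * exp (- (- (1/2)) * \<tau> k)))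
       = w n k * (512 * exp (- z / 2) * (exp (3 * (s + \<tau> k) / 4) - exp ((s + \<tau> k) / 2)))" for k
    proof -
      have "exp (3 * (s + \<tau> k) / 4) = exp (3 * s / 4) * exp (- (- (3/4)) * \<tau> k)"
        "exp ((s + \<tau> k) / 2) = exp (s / 2) * exp (- (- (1/2)) * \<tau> k)"
        unfolding exp_add[symmetric] by (simp_all add: field_simps)
      then show ?thesis by (simp only: right_diff_distrib mult_ac)
    qed
    have S: "(\<lambda>k. w n k * (512 * exp (- z / 2) * (exp (3 * (s + \<tau> k) / 4) - exp ((s + \<tau> k) / 2)))) sums (512 * exp (- z / 2) * R n)"
      using S0 unfolding eq .
    have "w n k * gker (s + \<tau> k) z \<le> w n k * (512 * exp (- z / 2) * (exp (3 * (s + \<tau> k) / 4) - exp ((s + \<tau> k) / 2)))" for k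
      using w z s \<tau>[of k] by (intro mult_left_mono gker_small_time_bound) auto
    then show ?thesis
      using sums_unique[OF S] suminf_le[OF _ sm[OF s(1), of n z] sums_summable[OF S]]
      unfolding \<tau>_def by simp
  qed
  have "R \<longlonglongrightarrow> exp (3 * s / 4) * \<psi> (- (3/4)) - exp (s / 2) * \<psi> (- (1/2))"
    unfolding R_def[abs_def] by (intro tendsto_intros lim) auto
  then have "smooth s z \<le> 512 * exp (- z / 2) * (exp (3 * s / 4) * \<psi> (- (3/4)) - exp (s / 2) * \<psi> (- (1/2)))"
    by (intro LIMSEQ_le[OF sl[OF s(1)] tendsto_mult[OF tendsto_const]]) (use le in auto)
  also have "exp (3 * s / 4) * \<psi> (- (3/4)) - exp (s / 2) * \<psi> (- (1/2)) \<le> 8 * t"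
  proof -
    have "exp (3 * s / 4) * \<psi> (- (3/4)) \<le> exp (3 * t / 4) * exp (t * (3/4))"
      using s t_pos by (intro mult_mono \<psi>_le) (auto simp: \<psi>_nonneg)
    also have "\<dots> = exp (3 * t / 2)" unfolding exp_add[symmetric] by (simp add: field_simps)
    finally have 1: "exp (3 * s / 4) * \<psi> (- (3/4)) \<le> exp (3 * t / 2)" .
    have "(1 / 2) powr \<beta> \<le> (1::real)" using \<beta> by (intro powr_le1) auto
    then have "1 \<le> \<psi> (- (1/2))" using t_pos by (simp add: \<psi>_def)
    then have 2: "1 \<le> exp (s / 2) * \<psi> (- (1/2))" using s
      by (metis exp_ge_zero less_eq_real_def mult_mono mult_1 one_le_exp_iff zero_le_one zero_less_divide_iff zero_less_numeral)
    have "exp (3 * t / 2) * (1 - 3 * t / 2) \<le> exp (3 * t / 2) * exp (- (3 * t / 2))"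
      using exp_ge_add_one_self[of "- (3 * t / 2)"] by (intro mult_left_mono) auto
    then have 3: "exp (3 * t / 2) - 1 \<le> exp (3 * t / 2) * (3 * t / 2)"
      by (simp add: exp_add[symmetric] algebra_simps)
    \<comment> \<open>exp (3/2) \<le> 16/3, and 16/3 times 3/2 is the constant 8.\<close>
    have "exp (3 * t / 2) \<le> exp (1 + 1/2)" using t by simp
    also have "\<dots> = exp 1 * exp (1/2 :: real)" by (rule exp_add)
    also have "\<dots> \<le> 3 * 16/9"
    proof -
      have e1: "exp 1 \<le> (3::real)" by (rule exp_le)
      have "(exp (1/2))\<^sup>2 \<le> (16/9 :: real)\<^sup>2"
        using e1 by (simp add: power2_eq_square exp_add[symmetric])
      then have "exp (1/2) \<le> (16/9 :: real)" by (rule power2_le_imp_le) simp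
      with e1 have "exp 1 * exp (1/2) \<le> 3 * (16/9 :: real)" by (intro mult_mono) auto
      then show ?thesis by simp
    qed
    finally have "exp (3 * t / 2) * (3 * t / 2) \<le> (3 * 16/9) * (3 * t / 2)"
      using t_pos by (intro mult_right_mono) auto
    with 1 2 3 show ?thesis by simp
  qed
  finally show ?thesis by (simp add: mult_ac)
qed

lemma interval_small_time_bound:
  assumes t: "t \<le> 1" and d: "0 < \<delta>" "\<delta>\<^sup>2 \<le> t" and z: "1 \<le> z"
  shows "measure \<nu> {z - \<delta><..<z + \<delta>} \<le> \<delta> * (exp (1/4) * sqrt (4 * pi) * 4096 * t * exp (- z / 2))"
proof -
  have "measure \<nu> {z - \<delta><..<z + \<delta>} \<le> \<delta> * (exp (1/4) * sqrt (4 * pi)) * (4096 * t * exp (- z / 2))"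
    using d by (intro order_trans[OF interval_le_smooth[OF d(1)]] mult_left_mono smooth_small_time_le t z) auto
  then show ?thesis by (simp add: mult_ac)
qed

text \<open>Computed for the law smoothed with s = 1. Fatou along the mixtures bounds its
  exponential moment by exp (l^2) \<psi>(-l^2), while Fubini shows that it equals exp (l^2) times
  the moment of \<nu>; the common factor cancels.\<close>

lemma exp_moment:
  assumes l: "l\<^sup>2 < 1"
  shows "(\<integral>\<^sup>+ x. ennreal (exp (l * x)) \<partial>\<nu>) \<le> ennreal (exp (t * l\<^sup>2))"
proof -
  obtain w \<phi> where w: "\<And>n k. 0 \<le> w n k"
    and \<phi>: "\<And>n v. -1 < v \<Longrightarrow> (\<lambda>k. w n k * exp (- v * (real k / real (Suc n)))) sums \<phi> n v"
    and lim: "\<And>v. -1 < v \<Longrightarrow> (\<lambda>n. \<phi> n v) \<longlonglongrightarrow> \<psi> v"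
    and sm: "\<And>n s z. 0 < s \<Longrightarrow> summable (\<lambda>k. w n k * gker (s + real k / real (Suc n)) z)"
    and sl: "\<And>s z. 0 < s \<Longrightarrow> (\<lambda>n. \<Sum>k. w n k * gker (s + real k / real (Suc n)) z) \<longlonglongrightarrow> smooth s z"
    using mixture by blast
  define F where "F n z = (\<Sum>k. w n k * gker (1 + real k / real (Suc n)) z)" for n z
  have [measurable]: "F n \<in> borel_measurable borel" for n unfolding F_def by measurable
  have n1: "(\<integral>\<^sup>+ z. ennreal (exp (l * z) * F n z) \<partial>lborel) = ennreal (exp (l\<^sup>2) * \<phi> n (- l\<^sup>2))" for n
  proof -
    define \<tau> where "\<tau> k = real k / real (Suc n)" for k
    have \<tau>: "0 \<le> \<tau> k" for k by (simp add: \<tau>_def)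
    have "(\<integral>\<^sup>+ z. ennreal (exp (l * z) * F n z) \<partial>lborel) = (\<integral>\<^sup>+ z. (\<Sum>k. ennreal (exp (l * z) * (w n k * gker (1 + \<tau> k) z))) \<partial>lborel)"
    proof (rule nn_integral_cong)
      fix z
      have s1: "summable (\<lambda>k. w n k * gker (1 + \<tau> k) z)" using sm[of 1 n z] unfolding \<tau>_def by simp
      have "exp (l * z) * F n z = (\<Sum>k. exp (l * z) * (w n k * gker (1 + \<tau> k) z))"
        unfolding F_def using suminf_mult[OF s1] by (simp add: \<tau>_def)
      then show "ennreal (exp (l * z) * F n z) = (\<Sum>k. ennreal (exp (l * z) * (w n k * gker (1 + \<tau> k) z)))"
        using s1 w gker_nonneg by (subst suminf_ennreal2) (auto intro!: summable_mult)
    qed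
    also have "\<dots> = (\<Sum>k. \<integral>\<^sup>+ z. ennreal (exp (l * z) * (w n k * gker (1 + \<tau> k) z)) \<partial>lborel)"
      by (intro nn_integral_suminf) measurable
    also have "\<dots> = (\<Sum>k. ennreal (exp (l\<^sup>2) * (w n k * exp (- (- l\<^sup>2) * \<tau> k))))"
    proof (rule arg_cong[where f=suminf], rule ext)
      fix k
      have "(\<integral>\<^sup>+ z. ennreal (exp (l * z) * (w n k * gker (1 + \<tau> k) z)) \<partial>lborel) =
        (\<integral>\<^sup>+ z. ennreal (w n k) * ennreal (exp (l * z) * gker (1 + \<tau> k) (z - 0)) \<partial>lborel)"
        using w gker_nonneg by (intro nn_integral_cong) (simp add: ennreal_mult[symmetric] mult_ac)
      also have "\<dots> = ennreal (w n k) * ennreal (exp (l\<^sup>2 * (1 + \<tau> k) + l * 0))"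
        using \<tau>[of k] gker_exp_nn_integral[of "1 + \<tau> k" l 0]
        by (subst nn_integral_cmult) (auto simp add: add_pos_nonneg)
      also have "\<dots> = ennreal (exp (l\<^sup>2) * (w n k * exp (- (- l\<^sup>2) * \<tau> k)))"
      proof -
        have "exp (l\<^sup>2 * (1 + \<tau> k) + l * 0) = exp (l\<^sup>2) * exp (- (- l\<^sup>2) * \<tau> k)"
          unfolding exp_add[symmetric] by (simp add: distrib_left)
        then show ?thesis
          using ennreal_mult[OF w[of n k], of "exp (l\<^sup>2 * (1 + \<tau> k) + l * 0)"] by (simp add: mult.left_commute)
      qed
      finally show "(\<integral>\<^sup>+ z. ennreal (exp (l * z) * (w n k * gker (1 + \<tau> k) z)) \<partial>lborel) = ennreal (exp (l\<^sup>2) * (w n k * exp (- (- l\<^sup>2) * \<tau> k)))" .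
    qed
    also have "\<dots> = ennreal (exp (l\<^sup>2) * \<phi> n (- l\<^sup>2))"
    proof -
      have S: "(\<lambda>k. exp (l\<^sup>2) * (w n k * exp (- (- l\<^sup>2) * \<tau> k))) sums (exp (l\<^sup>2) * \<phi> n (- l\<^sup>2))"
        unfolding \<tau>_def using l by (intro sums_mult \<phi>) auto
      show ?thesis using w sums_unique[OF S] sums_summable[OF S] by (subst suminf_ennreal2) auto
    qed
    finally show ?thesis .
  qed
  have "(\<integral>\<^sup>+ z. ennreal (exp (l * z) * smooth 1 z) \<partial>lborel) = (\<integral>\<^sup>+ z. liminf (\<lambda>n. ennreal (exp (l * z) * F n z)) \<partial>lborel)"
  proof (rule nn_integral_cong)
    fix z
    have "(\<lambda>n. ennreal (exp (l * z) * F n z)) \<longlonglongrightarrow> ennreal (exp (l * z) * smooth 1 z)"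
      unfolding F_def by (intro tendsto_ennrealI tendsto_intros sl) simp
    then show "ennreal (exp (l * z) * smooth 1 z) = liminf (\<lambda>n. ennreal (exp (l * z) * F n z))"
      by (simp add: lim_imp_Liminf)
  qed
  also have "\<dots> \<le> liminf (\<lambda>n. \<integral>\<^sup>+ z. ennreal (exp (l * z) * F n z) \<partial>lborel)"
    by (rule nn_integral_liminf) measurable
  also have "\<dots> = ennreal (exp (l\<^sup>2) * \<psi> (- l\<^sup>2))"
  proof -
    have "(\<lambda>n. ennreal (exp (l\<^sup>2) * \<phi> n (- l\<^sup>2))) \<longlonglongrightarrow> ennreal (exp (l\<^sup>2) * \<psi> (- l\<^sup>2))"
      using l by (intro tendsto_ennrealI tendsto_intros lim) auto
    then show ?thesis unfolding n1 by (simp add: lim_imp_Liminf)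
  qed
  also have "\<dots> \<le> ennreal (exp (l\<^sup>2) * exp (t * l\<^sup>2))"
    using l by (intro ennreal_leI mult_left_mono \<psi>_le) auto
  finally have up: "(\<integral>\<^sup>+ z. ennreal (exp (l * z) * smooth 1 z) \<partial>lborel) \<le> ennreal (exp (l\<^sup>2)) * ennreal (exp (t * l\<^sup>2))"
    by (simp add: ennreal_mult)
  have "(\<integral>\<^sup>+ z. ennreal (exp (l * z) * smooth 1 z) \<partial>lborel) = (\<integral>\<^sup>+ z. (\<integral>\<^sup>+ x. ennreal (exp (l * z) * gker 1 (x - z)) \<partial>\<nu>) \<partial>lborel)"
  proof (rule nn_integral_cong)
    fix z
    have "(\<integral>\<^sup>+ x. ennreal (exp (l * z) * gker 1 (x - z)) \<partial>\<nu>) = ennreal (\<integral>x. exp (l * z) * gker 1 (x - z) \<partial>\<nu>)"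
      using gker_integrable[of 1 z] gker_nonneg by (intro nn_integral_eq_integral) auto
    then show "ennreal (exp (l * z) * smooth 1 z) = (\<integral>\<^sup>+ x. ennreal (exp (l * z) * gker 1 (x - z)) \<partial>\<nu>)"
      by (simp add: smooth_def)
  qed
  also have "\<dots> = (\<integral>\<^sup>+ x. (\<integral>\<^sup>+ z. ennreal (exp (l * z) * gker 1 (x - z)) \<partial>lborel) \<partial>\<nu>)"
  proof -
    interpret P: pair_sigma_finite \<nu> lborel ..
    show ?thesis by (rule P.Fubini') measurable
  qed
  also have "\<dots> = (\<integral>\<^sup>+ x. ennreal (exp (l\<^sup>2)) * ennreal (exp (l * x)) \<partial>\<nu>)"
  proof (rule nn_integral_cong)
    fix x
    have "gker 1 (x - z) = gker 1 (z - x)" for z using gker_minus[of 1 "z - x"] by simp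
    then show "(\<integral>\<^sup>+ z. ennreal (exp (l * z) * gker 1 (x - z)) \<partial>lborel) = ennreal (exp (l\<^sup>2)) * ennreal (exp (l * x))"
      using gker_exp_nn_integral[of 1 l x] by (simp add: exp_add ennreal_mult)
  qed
  also have "\<dots> = ennreal (exp (l\<^sup>2)) * (\<integral>\<^sup>+ x. ennreal (exp (l * x)) \<partial>\<nu>)"
    by (rule nn_integral_cmult) measurable
  finally have "ennreal (exp (l\<^sup>2)) * (\<integral>\<^sup>+ x. ennreal (exp (l * x)) \<partial>\<nu>) \<le> ennreal (exp (l\<^sup>2)) * ennreal (exp (t * l\<^sup>2))"
    using up by simp
  then show ?thesis
    by (subst (asm) ennreal_mult_le_mult_iff) auto
qed

lemma tail_bound:
  assumes l: "0 \<le> l" "l < 1"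
  shows "measure \<nu> {\<rho>..} \<le> exp (t * l\<^sup>2 - l * \<rho>)"
proof -
  have l2: "l\<^sup>2 < 1" using l by (simp add: power_less_one_iff)
  have "ennreal (exp (l * \<rho>)) * emeasure \<nu> {\<rho>..} = (\<integral>\<^sup>+ x. ennreal (exp (l * \<rho>)) * indicator {\<rho>..} x \<partial>\<nu>)"
    by (simp add: nn_integral_cmult_indicator)
  also have "\<dots> \<le> (\<integral>\<^sup>+ x. ennreal (exp (l * x)) \<partial>\<nu>)"
    using l by (intro nn_integral_mono) (auto simp: indicator_def mult_left_mono intro!: ennreal_leI)
  also have "\<dots> \<le> ennreal (exp (t * l\<^sup>2))" by (rule exp_moment[OF l2])
  finally have "ennreal (exp (l * \<rho>) * measure \<nu> {\<rho>..}) \<le> ennreal (exp (t * l\<^sup>2))"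
    by (simp add: ennreal_mult emeasure_eq_measure)
  then have "exp (l * \<rho>) * measure \<nu> {\<rho>..} \<le> exp (t * l\<^sup>2)" by simp
  then show ?thesis by (simp add: exp_diff field_simps)
qed

end

section \<open>Symmetric random walks in the half-line\<close>

definition unit_fun :: "(real \<Rightarrow> real) \<Rightarrow> bool" where
  "unit_fun f \<longleftrightarrow> f \<in> borel_measurable borel \<and> (\<forall>x. 0 \<le> f x \<and> f x \<le> 1)"

lemma unit_funD:
  assumes "unit_fun f"
  shows "f \<in> borel_measurable borel" "0 \<le> f x" "f x \<le> 1"
  using assms by (auto simp: unit_fun_def)

lemma unit_fun_one: "unit_fun (\<lambda>_. 1)"
  by (simp add: unit_fun_def)

lemma unit_fun_indicator: "A \<in> sets borel \<Longrightarrow> unit_fun (indicator A)"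
  by (auto simp: unit_fun_def indicator_def)

text \<open>Transition operator of the walk killed on landing outside D. Only the landing point is
  tested, so a walk in the open half-line may start at 0.\<close>

definition step :: "real measure \<Rightarrow> real set \<Rightarrow> (real \<Rightarrow> real) \<Rightarrow> real \<Rightarrow> real" where
  "step \<mu> D f x = (\<integral>y. indicator D (x + y) * f (x + y) \<partial>\<mu>)"

locale symmetric_walk = real_distribution \<mu> for \<mu> :: "real measure" +
  assumes symmetric: "distr \<mu> borel uminus = \<mu>"
begin

lemma prob_UNIV [simp]: "prob UNIV = 1"
  using prob_space by simp

lemma unit_fun_integrable:
  assumes "unit_fun f"
  shows "integrable \<mu> (\<lambda>y. f (x + y))"
  using unit_funD[OF assms]
  by (intro integrable_const_bound[where B=1]) auto

lemma unit_fun_mult: "unit_fun f \<Longrightarrow> unit_fun g \<Longrightarrow> unit_fun (\<lambda>x. f x * g x)"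
  by (auto simp: unit_fun_def intro: mult_le_one)

lemma step_integrable:
  assumes "unit_fun f" "D \<in> sets borel"
  shows "integrable \<mu> (\<lambda>y. indicator D (x + y) * f (x + y))"
  using unit_fun_integrable[OF unit_fun_mult[OF unit_fun_indicator[OF assms(2)] assms(1)]] .

lemma unit_fun_step:
  assumes f: "unit_fun f" and D[measurable]: "D \<in> sets borel"
  shows "unit_fun (step \<mu> D f)"
proof -
  have [measurable]: "f \<in> borel_measurable borel" using unit_funD[OF f] by simp
  have [measurable_cong]: "sets \<mu> = sets borel" by simp
  have "(\<lambda>x. \<integral>y. indicator D (x + y) * f (x + y) \<partial>\<mu>) \<in> borel_measurable borel"
    by (rule borel_measurable_lebesgue_integral) measurable
  moreover have "0 \<le> (\<integral>y. indicator D (x + y) * f (x + y) \<partial>\<mu>)" for x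
    using unit_funD[OF f] by (intro integral_nonneg_AE) auto
  moreover have "(\<integral>y. indicator D (x + y) * f (x + y) \<partial>\<mu>) \<le> (\<integral>y. 1 \<partial>\<mu>)" for x
    using unit_funD[OF f] step_integrable[OF f D]
    by (intro integral_mono) (auto intro!: mult_le_one simp: indicator_def)
  ultimately show ?thesis by (simp add: unit_fun_def step_def[abs_def] prob_space)
qed

lemma unit_fun_steps:
  "unit_fun f \<Longrightarrow> D \<in> sets borel \<Longrightarrow> unit_fun ((step \<mu> D ^^ n) f)"
  by (induction n) (auto intro: unit_fun_step)

lemma step_mono:
  assumes "unit_fun f" "unit_fun g" "D \<in> sets borel" "E \<in> sets borel" "D \<subseteq> E"
    and "\<And>y. y \<in> D \<Longrightarrow> f y \<le> g y"
  shows "step \<mu> D f x \<le> step \<mu> E g x"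
  unfolding step_def
  using assms step_integrable[OF assms(1,3)] step_integrable[OF assms(2,4)] unit_funD[OF assms(2)]
  by (intro integral_mono) (auto simp: indicator_def)

lemma steps_mono:
  assumes "unit_fun f" "unit_fun g" "D \<in> sets borel" "E \<in> sets borel" "D \<subseteq> E"
    and "\<And>y. f y \<le> g y"
  shows "(step \<mu> D ^^ n) f x \<le> (step \<mu> E ^^ n) g x"
  by (induction n arbitrary: x) (auto intro!: step_mono unit_fun_steps assms)

lemma step_incr:
  assumes f: "unit_fun f" "mono f" and D: "D \<in> sets borel" and up: "\<And>x y. x \<in> D \<Longrightarrow> x \<le> y \<Longrightarrow> y \<in> D"
  shows "mono (step \<mu> D f)"
proof (rule monoI)
  fix x y :: real assume "x \<le> y"
  then show "step \<mu> D f x \<le> step \<mu> D f y"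
    unfolding step_def
    using step_integrable[OF f(1) D] unit_funD[OF f(1)] monoD[OF f(2)] up
    by (intro integral_mono) (auto simp: indicator_def)
qed

lemma steps_incr:
  assumes f: "unit_fun f" "mono f" and D: "D \<in> sets borel" and up: "\<And>x y. x \<in> D \<Longrightarrow> x \<le> y \<Longrightarrow> y \<in> D"
  shows "mono ((step \<mu> D ^^ n) f)"
  by (induction n) (auto intro!: step_incr[OF _ _ D up] unit_fun_steps f D)

lemma step_UNIV: "step \<mu> UNIV f x = (\<integral>y. f (x + y) \<partial>\<mu>)"
  by (simp add: step_def)

lemma steps_Suc: "(step \<mu> D ^^ Suc n) f x = (\<integral>y. indicator D (x + y) * (step \<mu> D ^^ n) f (x + y) \<partial>\<mu>)"
  unfolding funpow.simps o_apply by (rule step_def)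

lemma steps_UNIV_Suc: "(step \<mu> UNIV ^^ Suc n) f x = (\<integral>y. (step \<mu> UNIV ^^ n) f (x + y) \<partial>\<mu>)"
  unfolding funpow.simps o_apply by (rule step_UNIV)

lemma steps_add: "(step \<mu> D ^^ (m + n)) f x = (step \<mu> D ^^ m) ((step \<mu> D ^^ n) f) x"
  by (simp add: funpow_add)

text \<open>Chebyshev's argument: (f y - f x) (g y - g x) is nonnegative, since both factors have
  the same sign, and is integrated over two independent copies.\<close>

lemma integral_association:
  assumes f: "unit_fun f" "mono f" and g: "unit_fun g" "mono g"
  shows "(\<integral>y. f y \<partial>\<mu>) * (\<integral>y. g y \<partial>\<mu>) \<le> (\<integral>y. f y * g y \<partial>\<mu>)"
proof -
  have [measurable]: "f \<in> borel_measurable borel" "g \<in> borel_measurable borel"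
    using f g by (auto simp: unit_fun_def)
  have i: "integrable \<mu> f" "integrable \<mu> g" "integrable \<mu> (\<lambda>y. f y * g y)"
    using unit_fun_integrable[OF f(1), of 0] unit_fun_integrable[OF g(1), of 0]
      unit_fun_integrable[OF unit_fun_mult[OF f(1) g(1)], of 0] by auto
  define F where "F = (\<integral>y. f y \<partial>\<mu>)"
  define G where "G = (\<integral>y. g y \<partial>\<mu>)"
  define H where "H = (\<integral>y. f y * g y \<partial>\<mu>)"
  have "0 \<le> H - f x * G - F * g x + f x * g x" for x
  proof -
    have "0 \<le> (\<integral>y. (f y - f x) * (g y - g x) \<partial>\<mu>)"
    proof (intro integral_nonneg_AE AE_I2)
      fix y
      show "0 \<le> (f y - f x) * (g y - g x)"
        using monoD[OF f(2), of x y] monoD[OF f(2), of y x] monoD[OF g(2), of x y] monoD[OF g(2), of y x]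
        by (cases "x \<le> y") (auto intro: mult_nonneg_nonneg mult_nonpos_nonpos)
    qed
    also have "(\<integral>y. (f y - f x) * (g y - g x) \<partial>\<mu>) = (\<integral>y. f y * g y - f x * g y - f y * g x + f x * g x \<partial>\<mu>)"
      by (intro Bochner_Integration.integral_cong) (auto simp: algebra_simps)
    also have "\<dots> = H - f x * G - F * g x + f x * g x"
      using i by (simp add: F_def G_def H_def prob_space)
    finally show ?thesis .
  qed
  then have "0 \<le> (\<integral>x. H - f x * G - F * g x + f x * g x \<partial>\<mu>)"
    by (intro integral_nonneg_AE) auto
  also have "\<dots> = H - F * G - F * G + H"
    using i by (simp add: F_def G_def H_def prob_space)
  finally show ?thesis by (simp add: F_def G_def H_def)
qed

text \<open>Harris' inequality, by induction from Chebyshev's association inequality for one step.\<close>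
lemma steps_association:
  assumes f: "unit_fun f" "mono f" and D: "D \<in> sets borel" and up: "\<And>x y. x \<in> D \<Longrightarrow> x \<le> y \<Longrightarrow> y \<in> D"
  shows "(step \<mu> D ^^ n) (\<lambda>_. 1) x * (step \<mu> UNIV ^^ n) f x \<le> (step \<mu> D ^^ n) f x"
proof (induction n arbitrary: x)
  case (Suc n)
  define a where "a = (step \<mu> D ^^ n) (\<lambda>_. 1)"
  define b where "b = (step \<mu> UNIV ^^ n) f"
  have a: "unit_fun a" "mono a" unfolding a_def
    by (rule unit_fun_steps[OF unit_fun_one D], rule steps_incr[OF unit_fun_one _ D up]) (auto simp: mono_def)
  have b: "unit_fun b" "mono b" unfolding b_def
    by (rule unit_fun_steps[OF f(1)], simp, rule steps_incr[OF f]) auto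
  have q: "unit_fun ((step \<mu> D ^^ n) f)" by (intro unit_fun_steps f D)
  have ab: "unit_fun (\<lambda>y. indicator D (x + y) * a (x + y))" "mono (\<lambda>y. indicator D (x + y) * a (x + y))"
  proof -
    have [measurable]: "a \<in> borel_measurable borel" "D \<in> sets borel" using a D by (auto simp: unit_fun_def)
    show "unit_fun (\<lambda>y. indicator D (x + y) * a (x + y))"
      using unit_funD[OF a(1)] unfolding unit_fun_def by (auto simp: indicator_def)
    show "mono (\<lambda>y. indicator D (x + y) * a (x + y))"
    proof (rule monoI)
      fix y z :: real assume yz: "y \<le> z"
      then have "a (x + y) \<le> a (x + z)" using monoD[OF a(2)] by simp
      moreover have "x + y \<in> D \<Longrightarrow> x + z \<in> D" using up yz by (metis add_left_mono)
      ultimately show "indicator D (x + y) * a (x + y) \<le> indicator D (x + z) * a (x + z)"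
        using unit_funD(2)[OF a(1)] by (auto simp: indicator_def)
    qed
  qed
  have bx: "unit_fun (\<lambda>y. b (x + y))" "mono (\<lambda>y. b (x + y))"
  proof -
    have [measurable]: "b \<in> borel_measurable borel" using b by (auto simp: unit_fun_def)
    show "unit_fun (\<lambda>y. b (x + y))" using unit_funD[OF b(1)] unfolding unit_fun_def by auto
    show "mono (\<lambda>y. b (x + y))" using monoD[OF b(2)] by (auto intro!: monoI)
  qed
  have "(step \<mu> D ^^ Suc n) (\<lambda>_. 1) x * (step \<mu> UNIV ^^ Suc n) f x =
     (\<integral>y. indicator D (x + y) * a (x + y) \<partial>\<mu>) * (\<integral>y. b (x + y) \<partial>\<mu>)"
    by (simp only: a_def b_def steps_UNIV_Suc steps_Suc[where D=D])
  also have "\<dots> \<le> (\<integral>y. (indicator D (x + y) * a (x + y)) * b (x + y) \<partial>\<mu>)"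
    by (rule integral_association[OF ab bx])
  also have "\<dots> \<le> (\<integral>y. indicator D (x + y) * (step \<mu> D ^^ n) f (x + y) \<partial>\<mu>)"
  proof (rule integral_mono)
    show "integrable \<mu> (\<lambda>y. (indicator D (x + y) * a (x + y)) * b (x + y))"
      using unit_fun_integrable[OF unit_fun_mult[OF ab(1) bx(1)], of 0] by simp
    show "integrable \<mu> (\<lambda>y. indicator D (x + y) * (step \<mu> D ^^ n) f (x + y))"
      by (rule step_integrable[OF q D])
    show "(indicator D (x + y) * a (x + y)) * b (x + y) \<le> indicator D (x + y) * (step \<mu> D ^^ n) f (x + y)" for y
      using Suc.IH[of "x + y"] by (auto simp: indicator_def a_def b_def)
  qed
  finally show ?case by (simp only: steps_Suc[where D=D])
qed (use unit_funD[OF f(1)] in simp)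

section \<open>Survival, maximal inequality and hitting of a level\<close>

definition survival :: "nat \<Rightarrow> real \<Rightarrow> real" where
  "survival n = (step \<mu> {0<..} ^^ n) (\<lambda>_. 1)"

lemma unit_fun_survival: "unit_fun (survival n)"
  unfolding survival_def by (intro unit_fun_steps unit_fun_one) auto

lemma survival_incr: "x \<le> y \<Longrightarrow> survival n x \<le> survival n y"
  unfolding survival_def
  by (rule monoD[OF steps_incr]) (auto simp: unit_fun_one mono_def)

lemma survival_Suc: "survival (Suc n) x = step \<mu> {0<..} (survival n) x"
  by (simp add: survival_def)

lemma survival_antimono: "m \<le> n \<Longrightarrow> survival n x \<le> survival m x"
proof (induction n arbitrary: m x)
  case (Suc n)
  show ?case
  proof (cases m)
    case 0
    then show ?thesis using unit_funD(3)[OF unit_fun_survival, of "Suc n" x] by (simp add: survival_def)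
  next
    case (Suc k)
    then show ?thesis
      using Suc.IH[of k] Suc.prems
      by (auto simp: survival_Suc intro!: step_mono unit_fun_survival)
  qed
qed simp

lemma survival_restart:
  "survival n x * (survival m 0 * (step \<mu> UNIV ^^ m) (indicator {x<..}) 0) \<le> survival (m + n) 0"
proof -
  have "survival m 0 * (step \<mu> UNIV ^^ m) (indicator {x<..}) 0 \<le> (step \<mu> {0<..} ^^ m) (indicator {x<..}) 0"
    unfolding survival_def
    by (intro steps_association unit_fun_indicator) (auto simp: mono_def indicator_def)
  then have "survival n x * (survival m 0 * (step \<mu> UNIV ^^ m) (indicator {x<..}) 0) \<le>
      survival n x * (step \<mu> {0<..} ^^ m) (indicator {x<..}) 0"
    using unit_funD[OF unit_fun_survival] by (intro mult_left_mono) auto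
  also have "\<dots> \<le> (step \<mu> {0<..} ^^ m) (survival n) 0"
  proof -
    \<comment> \<open>A constant passes through the positive operator. Used with c =
      \<open>survival n x\<close>, g the indicator of the points above x and h =
      \<open>survival n\<close>, where c g \<le> h is monotonicity in the starting point.\<close>
    have c: "c * (step \<mu> {0<..} ^^ m) g z \<le> (step \<mu> {0<..} ^^ m) h z"
      if g: "unit_fun g" and h: "unit_fun h" and c: "0 \<le> c" and le: "\<And>y. c * g y \<le> h y" for c g h z
    proof (induction m arbitrary: z)
      case (Suc m)
      have qg: "unit_fun ((step \<mu> {0<..} ^^ m) g)" and qh: "unit_fun ((step \<mu> {0<..} ^^ m) h)"
        by (auto intro!: unit_fun_steps g h)
      have "c * (step \<mu> {0<..} ^^ Suc m) g z =
         (\<integral>y. c * (indicator {0<..} (z + y) * (step \<mu> {0<..} ^^ m) g (z + y)) \<partial>\<mu>)"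
        unfolding steps_Suc by simp
      also have "\<dots> \<le> (step \<mu> {0<..} ^^ Suc m) h z"
        unfolding steps_Suc
        using Suc.IH
        by (intro integral_mono integrable_mult_right step_integrable[OF qg] step_integrable[OF qh])
           (auto simp: indicator_def)
      finally show ?case .
    qed (use le in simp)
    show ?thesis
      using survival_incr[of x] unit_funD[OF unit_fun_survival]
      by (intro c unit_fun_indicator unit_fun_survival) (auto simp: indicator_def)
  qed
  also have "\<dots> = survival (m + n) 0" by (simp add: survival_def steps_add)
  finally show ?thesis .
qed

lemma steps_reflect:
  assumes "unit_fun f"
  shows "(step \<mu> UNIV ^^ n) (\<lambda>x. f (- x)) x = (step \<mu> UNIV ^^ n) f (- x)"
proof (induction n arbitrary: x)
  case (Suc n)
  have g: "unit_fun ((step \<mu> UNIV ^^ n) f)" by (intro unit_fun_steps assms) simp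
  have [measurable]: "(step \<mu> UNIV ^^ n) f \<in> borel_measurable borel" using unit_funD(1)[OF g] .
  have "(step \<mu> UNIV ^^ Suc n) (\<lambda>x. f (- x)) x = (\<integral>y. (step \<mu> UNIV ^^ n) f (- x + - y) \<partial>\<mu>)"
    unfolding steps_UNIV_Suc Suc.IH by simp
  also have "\<dots> = (\<integral>y. (step \<mu> UNIV ^^ n) f (- x + y) \<partial>distr \<mu> borel uminus)"
    by (subst integral_distr) auto
  also have "\<dots> = (step \<mu> UNIV ^^ Suc n) f (- x)"
    unfolding symmetric steps_UNIV_Suc ..
  finally show ?case .
qed simp

lemma steps_UNIV_one: "(step \<mu> UNIV ^^ n) (\<lambda>_. 1) x = 1"
proof (induction n arbitrary: x)
  case (Suc n)
  then show ?case unfolding steps_UNIV_Suc by simp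
qed simp

lemma steps_UNIV_add:
  assumes "unit_fun f" "unit_fun g" "unit_fun (\<lambda>x. f x + g x)"
  shows "(step \<mu> UNIV ^^ n) (\<lambda>x. f x + g x) x = (step \<mu> UNIV ^^ n) f x + (step \<mu> UNIV ^^ n) g x"
proof (induction n arbitrary: x)
  case (Suc n)
  have "unit_fun ((step \<mu> UNIV ^^ n) f)" "unit_fun ((step \<mu> UNIV ^^ n) g)"
    by (auto intro!: unit_fun_steps assms)
  then show ?case
    unfolding steps_UNIV_Suc Suc.IH by (simp add: unit_fun_integrable)
qed simp

text \<open>By symmetry a walk from 0 ends at or below 0 with probability at least 1/2, and starting
  lower only helps.\<close>

lemma steps_halfline_ge: "z \<le> 0 \<Longrightarrow> 1/2 \<le> (step \<mu> UNIV ^^ n) (indicator {..0}) z"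
proof -
  assume z: "z \<le> 0"
  let ?p = "\<lambda>A. (step \<mu> UNIV ^^ n) (indicator A) 0"
  have refl: "(step \<mu> UNIV ^^ n) (indicator {..0}) w = (step \<mu> UNIV ^^ n) (indicator {0..}) (- w)" for w
  proof -
    have "(\<lambda>x::real. indicator {0..} (- x)) = (indicator {..0} :: real \<Rightarrow> real)"
      by (auto simp: indicator_def)
    then show ?thesis
      using steps_reflect[of "indicator {0..}" n w] by (simp add: unit_fun_indicator)
  qed
  have "1 = ?p {0..} + ?p {..<0}"
  proof -
    have e: "(\<lambda>x::real. indicator {0..} x + indicator {..<0} x) = (\<lambda>_. 1 :: real)"
      by (auto simp: indicator_def)
    show ?thesis
      using steps_UNIV_add[of "indicator {0..}" "indicator {..<0}" n 0] steps_UNIV_one[of n 0]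
      unfolding e by (simp add: unit_fun_indicator unit_fun_one)
  qed
  also have "?p {..<0} \<le> ?p {..0}"
    by (intro steps_mono unit_fun_indicator) (auto simp: indicator_def)
  also have "?p {..0} = ?p {0..}" using refl[of 0] by simp
  finally have "1/2 \<le> ?p {0..}" by simp
  also have "?p {0..} \<le> (step \<mu> UNIV ^^ n) (indicator {0..}) (- z)"
    using z by (intro monoD[OF steps_incr] unit_fun_indicator) (auto simp: mono_def indicator_def)
  finally show ?thesis by (simp add: refl)
qed

text \<open>Levy's maximal inequality.\<close>
lemma survival_levy_bound:
  "0 < z \<Longrightarrow> 1 - survival m z \<le> 2 * (step \<mu> UNIV ^^ m) (indicator {..0}) z"
proof (induction m arbitrary: z)
  case (Suc m)
  define p where "p = (step \<mu> UNIV ^^ m) (indicator {..0})"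
  have p: "unit_fun p" unfolding p_def by (intro unit_fun_steps unit_fun_indicator) auto
  have s: "unit_fun (survival m)" by (rule unit_fun_survival)
  have "1 - survival (Suc m) z = (\<integral>y. 1 - indicator {0<..} (z + y) * survival m (z + y) \<partial>\<mu>)"
    using step_integrable[OF s, of "{0<..}" z] by (simp add: survival_Suc step_def prob_space)
  also have "\<dots> \<le> (\<integral>y. 2 * p (z + y) \<partial>\<mu>)"
  proof (rule integral_mono)
    show "integrable \<mu> (\<lambda>y. 1 - indicator {0<..} (z + y) * survival m (z + y))"
      using step_integrable[OF s, of "{0<..}" z] by simp
    show "integrable \<mu> (\<lambda>y. 2 * p (z + y))" using unit_fun_integrable[OF p] by simp
    \<comment> \<open>If the first step leaves the half-line the left side is 1, and from there the
      walk ends at or below 0 with probability at least 1/2; this is the source of the factor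
      2.\<close>
    show "1 - indicator {0<..} (z + y) * survival m (z + y) \<le> 2 * p (z + y)" for y
      using Suc.IH[of "z + y", folded p_def] steps_halfline_ge[of "z + y" m, folded p_def]
      by (cases "0 < z + y") auto
  qed
  finally show ?case unfolding steps_UNIV_Suc p_def by simp
qed (simp add: survival_def)

text \<open>Probability of reaching the level L within n steps before leaving the open half-line.
  The level is absorbing and time 0 counts, so the value is 1 at every start \<ge> L.\<close>

fun hit :: "real \<Rightarrow> nat \<Rightarrow> real \<Rightarrow> real" where
  "hit L 0 z = indicator {L..} z"
| "hit L (Suc n) z = (if L \<le> z then 1 else step \<mu> {0<..} (hit L n) z)"

lemma unit_fun_hit: "unit_fun (hit L n)"
proof (induction n)
  case 0
  then show ?case using unit_fun_indicator[of "{L..}"] by (simp add: fun_eq_iff[symmetric] unit_fun_def)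
next
  case (Suc n)
  have "unit_fun (step \<mu> {0<..} (hit L n))" by (intro unit_fun_step Suc) simp
  then show ?case by (auto simp: unit_fun_def)
qed

lemma hit_eq_1: "L \<le> z \<Longrightarrow> hit L n z = 1"
  by (cases n) auto

text \<open>If the level is reached before step j, at most m steps remain and they are survived from
  a point \<ge> L; if it is reached later, the first j steps have been survived anyway. The horizon
  n is independent of j and m, so the resulting hitting bound is uniform in n.\<close>

lemma hit_le_survival: "j \<le> m \<Longrightarrow> survival m L * hit L n z \<le> survival j z"
proof (induction n arbitrary: j z)
  case 0
  show ?case
  proof (cases "L \<le> z")
    case True
    then have "survival m L \<le> survival j z"
      using survival_antimono[OF 0] survival_incr order_trans by blast
    then show ?thesis using True by simp
  qed (use unit_funD[OF unit_fun_survival] in auto)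
next
  case (Suc n)
  show ?case
  proof (cases "L \<le> z")
    case True
    then have "survival m L \<le> survival j z"
      using survival_antimono[OF Suc.prems] survival_incr order_trans by blast
    then show ?thesis using True by simp
  next
    case False
    show ?thesis
    proof (cases j)
      case 0
      then show ?thesis
        using unit_funD(2,3)[OF unit_fun_survival, of m L] unit_funD(2,3)[OF unit_fun_hit, of L "Suc n" z]
        by (auto simp: survival_def intro!: mult_le_one)
    next
      case (Suc i)
      have "survival m L * step \<mu> {0<..} (hit L n) z = (\<integral>y. survival m L * (indicator {0<..} (z + y) * hit L n (z + y)) \<partial>\<mu>)"
        by (simp add: step_def)
      also have "\<dots> \<le> step \<mu> {0<..} (survival i) z"
        unfolding step_def
        using Suc.IH[of i] Suc Suc.prems
        by (intro integral_mono integrable_mult_right step_integrable unit_fun_hit unit_fun_survival)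
           (auto simp: indicator_def)
      finally show ?thesis using False Suc by (simp add: survival_Suc)
    qed
  qed
qed

lemma steps_shift: "(step \<mu> UNIV ^^ n) (indicator {a..}) z = (step \<mu> UNIV ^^ n) (indicator {a - z..}) 0"
proof -
  have "(step \<mu> UNIV ^^ n) f (z + x) = (step \<mu> UNIV ^^ n) (\<lambda>x. f (z + x)) x" for f x
  proof (induction n arbitrary: x)
    case (Suc n)
    show ?case unfolding steps_UNIV_Suc Suc.IH[symmetric] by (simp add: add.assoc)
  qed simp
  from this[of "indicator {a..}" 0] show ?thesis
    by (simp add: indicator_def[abs_def] le_diff_eq add.commute diff_le_eq)
qed

text \<open>Before climbing to L + b + c a surviving walk has to enter [L, L + b], unless some
  increment exceeds b.\<close>
lemma steps_climb_bound:
  assumes T: "\<And>k. k \<le> n \<Longrightarrow> (step \<mu> UNIV ^^ k) (indicator {c..}) 0 \<le> T"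
    and z: "z < L" and bc: "0 \<le> b" "0 \<le> c"
  shows "(step \<mu> {0<..} ^^ n) (indicator {L + b + c..}) z \<le> T * hit L n z + real n * measure \<mu> {b..}"
  using T z
proof (induction n arbitrary: z)
  case 0
  then show ?case using bc by (auto simp: indicator_def)
next
  case (Suc n)
  define q where "q = (step \<mu> {0<..} ^^ n) (indicator {L + b + c..})"
  define e where "e = measure \<mu> {b..}"
  have q: "unit_fun q" unfolding q_def by (intro unit_fun_steps unit_fun_indicator) auto
  have T0: "0 \<le> T"
    using order_trans[OF indicator_pos_le[of "{c..}" 0] Suc.prems(1)[of 0, simplified funpow.simps id_apply]] by simp
  have "(step \<mu> {0<..} ^^ Suc n) (indicator {L + b + c..}) z = (\<integral>y. indicator {0<..} (z + y) * q (z + y) \<partial>\<mu>)"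
    unfolding steps_Suc q_def ..
  also have "\<dots> \<le> (\<integral>y. T * (indicator {0<..} (z + y) * hit L n (z + y)) + real n * e + indicator {b..} y \<partial>\<mu>)"
  proof (rule integral_mono)
    show "integrable \<mu> (\<lambda>y. indicator {0<..} (z + y) * q (z + y))" by (rule step_integrable[OF q]) simp
    show "integrable \<mu> (\<lambda>y. T * (indicator {0<..} (z + y) * hit L n (z + y)) + real n * e + indicator {b..} y)"
      using step_integrable[OF unit_fun_hit, of "{0<..}" z] unit_fun_integrable[OF unit_fun_indicator[of "{b..}"], of 0]
      by simp
    fix y
    have ne: "0 \<le> real n * e" by (simp add: e_def)
    show "indicator {0<..} (z + y) * q (z + y) \<le> T * (indicator {0<..} (z + y) * hit L n (z + y)) + real n * e + indicator {b..} y"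
    proof (cases "0 < z + y")
      case True
      \<comment> \<open>Below L the induction hypothesis applies. In the entrance strip
        \<open>hit\<close> is 1 and the remaining climb of at least c costs T, with killing dropped.
        Beyond the strip the increment exceeds b because z < L.\<close>
      consider "z + y < L" | "L \<le> z + y" "z + y \<le> L + b" | "L + b < z + y" by linarith
      then show ?thesis
      proof cases
        case 1
        then have "q (z + y) \<le> T * hit L n (z + y) + real n * e"
          unfolding q_def e_def using Suc.IH[of "z + y"] Suc.prems by simp
        then show ?thesis using True by (auto simp: indicator_def)
      next
        case 2
        have "q (z + y) \<le> (step \<mu> UNIV ^^ n) (indicator {L + b + c..}) (z + y)"
          unfolding q_def by (intro steps_mono unit_fun_indicator) auto
        also have "\<dots> = (step \<mu> UNIV ^^ n) (indicator {L + b + c - (z + y)..}) 0"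
          by (rule steps_shift)
        also have "\<dots> \<le> (step \<mu> UNIV ^^ n) (indicator {c..}) 0"
          using 2 by (intro steps_mono unit_fun_indicator) (auto simp: indicator_def)
        also have "\<dots> \<le> T" using Suc.prems by simp
        finally show ?thesis using True ne 2 hit_eq_1[OF 2(1)] by (auto simp: indicator_def)
      next
        case 3
        then have "b \<le> y" using Suc.prems by simp
        moreover have "q (z + y) \<le> 1" using unit_funD[OF q] by simp
        moreover have "0 \<le> T * hit L n (z + y)" using T0 unit_funD[OF unit_fun_hit] by simp
        ultimately show ?thesis using True ne by (auto simp: indicator_def)
      qed
    qed (use ne in \<open>auto simp: indicator_def\<close>)
  qed
  also have "\<dots> = T * step \<mu> {0<..} (hit L n) z + real n * e + e"
    using step_integrable[OF unit_fun_hit, of "{0<..}" z] unit_fun_integrable[OF unit_fun_indicator[of "{b..}"], of 0]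
    by (simp add: step_def e_def prob_space)
  finally show ?case using Suc.prems by (simp add: e_def distrib_right)
qed

end

section \<open>The minimum of a walk\<close>

text \<open>The joint law of independent variables is a product, so by Fubini the second variable
  may be sampled separately.\<close>

lemma (in prob_space) indep_var_decoupling:
  fixes g :: "'c \<times> 'c \<Rightarrow> real"
  assumes ind: "indep_var N X N' Z" and g[measurable]: "g \<in> borel_measurable (N \<Otimes>\<^sub>M N')"
    and b: "\<And>p. 0 \<le> g p \<and> g p \<le> 1"
  shows "(\<integral>\<omega>. g (X \<omega>, Z \<omega>) \<partial>M) = (\<integral>\<omega>. (\<integral>\<omega>'. g (X \<omega>, Z \<omega>') \<partial>M) \<partial>M)"
proof -
  have [measurable]: "X \<in> measurable M N" "Z \<in> measurable M N'"
    using indep_var_rv1[OF ind] indep_var_rv2[OF ind] by auto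
  interpret Z: prob_space "distr M N' Z" by (rule prob_space_distr) simp
  interpret X: prob_space "distr M N X" by (rule prob_space_distr) simp
  interpret P: pair_prob_space "distr M N X" "distr M N' Z" ..
  have "(\<integral>\<omega>. g (X \<omega>, Z \<omega>) \<partial>M) = (\<integral>p. g p \<partial>distr M (N \<Otimes>\<^sub>M N') (\<lambda>\<omega>. (X \<omega>, Z \<omega>)))"
    by (subst integral_distr) auto
  also have "\<dots> = (\<integral>p. g p \<partial>(distr M N X \<Otimes>\<^sub>M distr M N' Z))"
    using indep_var_distribution_eq[of N X N' Z] ind by simp
  also have "\<dots> = (\<integral>x. (\<integral>z. g (x, z) \<partial>distr M N' Z) \<partial>distr M N X)"
  proof (rule P.integral_fst'[symmetric])
    show "integrable (distr M N X \<Otimes>\<^sub>M distr M N' Z) g"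
      by (rule P.integrable_const_bound[where B=1]) (use b in auto)
  qed
  also have "\<dots> = (\<integral>\<omega>. (\<integral>z. g (X \<omega>, z) \<partial>distr M N' Z) \<partial>M)"
    by (subst integral_distr) auto
  also have "\<dots> = (\<integral>\<omega>. (\<integral>\<omega>'. g (X \<omega>, Z \<omega>') \<partial>M) \<partial>M)"
  proof (rule Bochner_Integration.integral_cong[OF refl])
    fix \<omega> assume "\<omega> \<in> space M"
    then have [measurable]: "X \<omega> \<in> space N" using measurable_space[of X M N] by simp
    show "(\<integral>z. g (X \<omega>, z) \<partial>distr M N' Z) = (\<integral>\<omega>'. g (X \<omega>, Z \<omega>') \<partial>M)"
      by (subst integral_distr) auto
  qed
  finally show ?thesis .
qed

lemma (in prob_space) indep_vars_reindex:
  fixes X :: "'i \<Rightarrow> 'a \<Rightarrow> real"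
  assumes "indep_vars (\<lambda>_. borel) X I" "inj_on f J" "f ` J \<subseteq> I"
  shows "indep_vars (\<lambda>_. borel) (\<lambda>j. X (f j)) J"
proof -
  have "indep_vars (\<lambda>j. PiM {f j} (\<lambda>_. borel)) (\<lambda>j \<omega>. restrict (\<lambda>i. X i \<omega>) {f j}) J"
    using assms by (intro indep_vars_restrict[OF assms(1)]) (auto simp: disjoint_family_on_def inj_on_def)
  from indep_vars_compose2[OF this, of "\<lambda>j w. w (f j)" "\<lambda>_. borel"]
  show ?thesis by (simp add: measurable_component_singleton)
qed

lemma partial_sum_measurable:
  assumes "{..<k} \<subseteq> J"
  shows "(\<lambda>w. \<Sum>i<k. w i) \<in> borel_measurable (PiM J (\<lambda>_. borel :: real measure))"
  using assms by (intro borel_measurable_sum measurable_component_singleton) auto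

text \<open>The product starts at k = 1: as for \<open>step\<close>, the starting point is not
  tested. Products of indicators keep the path event multiplicative under expectation.\<close>

definition stay :: "real set \<Rightarrow> (nat \<Rightarrow> real) \<Rightarrow> real \<Rightarrow> nat \<Rightarrow> real" where
  "stay D w x n = (\<Prod>k=1..n. indicator D (x + (\<Sum>i<k. w i)))"

lemma stay_cong: "(\<And>i. i < n \<Longrightarrow> w i = v i) \<Longrightarrow> stay D w x n = stay D v x n"
  unfolding stay_def by (intro prod.cong) auto

lemma stay_Suc: "stay D w x (Suc n) = stay D w x n * indicator D (x + (\<Sum>i<n. w i) + w n)"
  by (simp add: stay_def add.assoc)

lemma stay_bounds: "0 \<le> stay D w x n" "stay D w x n \<le> 1"
  unfolding stay_def by (auto intro!: prod_nonneg prod_le_1)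

lemma stay_eq: "stay D w x n = of_bool (\<forall>k\<in>{1..n}. x + (\<Sum>i<k. w i) \<in> D)"
  by (induction n) (auto simp: stay_def atLeastAtMostSuc_conv)

lemma stay_measurable:
  assumes "D \<in> sets borel" "{..<n} \<subseteq> J"
  shows "(\<lambda>w. stay D w x n) \<in> borel_measurable (PiM J (\<lambda>_. borel :: real measure))"
  unfolding stay_def
proof (rule borel_measurable_prod)
  fix k assume "k \<in> {1..n}"
  then have [measurable]: "(\<lambda>w. \<Sum>i<k. w i) \<in> borel_measurable (PiM J (\<lambda>_. borel :: real measure))"
    using assms by (intro partial_sum_measurable) auto
  have [measurable]: "D \<in> sets borel" by fact
  show "(\<lambda>w. indicat_real D (x + (\<Sum>i<k. w i))) \<in> borel_measurable (PiM J (\<lambda>_. borel :: real measure))"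
    by measurable
qed

text \<open>The last increment is independent of the earlier ones and may have a law of its
  own.\<close>

lemma (in prob_space) stay_last_step:
  assumes ind: "indep_vars (\<lambda>_. borel) \<eta> {..<Suc n}" and D: "D \<in> sets borel" and G: "unit_fun G"
  shows "(\<integral>\<omega>. stay D (\<lambda>i. \<eta> i \<omega>) x n * G (x + (\<Sum>i<n. \<eta> i \<omega>) + \<eta> n \<omega>) \<partial>M) =
    (\<integral>\<omega>. stay D (\<lambda>i. \<eta> i \<omega>) x n * (\<integral>z. G (x + (\<Sum>i<n. \<eta> i \<omega>) + z) \<partial>distr M borel (\<eta> n)) \<partial>M)"
proof -
  have [measurable]: "G \<in> borel_measurable borel" using unit_funD[OF G] by simp
  have [measurable]: "D \<in> sets borel" by fact
  have [measurable]: "\<eta> n \<in> borel_measurable M"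
    using ind by (auto simp: indep_vars_def)
  define N where "N = PiM {..<n} (\<lambda>_. borel :: real measure)"
  define N' where "N' = PiM {n} (\<lambda>_. borel :: real measure)"
  define X where "X = (\<lambda>\<omega>. restrict (\<lambda>i. \<eta> i \<omega>) {..<n})"
  have iv: "indep_var N X N' (\<lambda>\<omega>. restrict (\<lambda>i. \<eta> i \<omega>) {n})"
    unfolding N_def N'_def X_def by (rule indep_var_restrict[OF ind]) auto
  define g :: "(nat \<Rightarrow> real) \<times> (nat \<Rightarrow> real) \<Rightarrow> real" where
    "g = (\<lambda>(w, z). stay D w x n * G (x + (\<Sum>i<n. w i) + z n))"
  have [measurable]: "(\<lambda>w. stay D w x n) \<in> borel_measurable N" "(\<lambda>w. \<Sum>i<n. w i) \<in> borel_measurable N"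
    unfolding N_def by (auto intro!: stay_measurable partial_sum_measurable D)
  have [measurable]: "(\<lambda>z. z n) \<in> borel_measurable N'"
    unfolding N'_def by (rule measurable_component_singleton) simp
  have gm: "g \<in> borel_measurable (N \<Otimes>\<^sub>M N')"
    unfolding g_def by measurable
  have gb: "0 \<le> g p \<and> g p \<le> 1" for p
    using stay_bounds[of D] unit_funD[OF G]
    by (cases p) (auto simp: g_def intro!: mult_le_one)
  have Xs: "(\<Sum>i<n. X \<omega> i) = (\<Sum>i<n. \<eta> i \<omega>)" "stay D (X \<omega>) x n = stay D (\<lambda>i. \<eta> i \<omega>) x n" for \<omega>
    by (auto simp: X_def intro!: stay_cong)
  have "(\<integral>\<omega>. stay D (\<lambda>i. \<eta> i \<omega>) x n * G (x + (\<Sum>i<n. \<eta> i \<omega>) + \<eta> n \<omega>) \<partial>M) =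
      (\<integral>\<omega>. g (X \<omega>, restrict (\<lambda>i. \<eta> i \<omega>) {n}) \<partial>M)"
    by (simp add: g_def Xs)
  also have "\<dots> = (\<integral>\<omega>. (\<integral>\<omega>'. g (X \<omega>, restrict (\<lambda>i. \<eta> i \<omega>') {n}) \<partial>M) \<partial>M)"
    by (rule indep_var_decoupling[OF iv gm gb])
  also have "\<dots> = (\<integral>\<omega>. stay D (\<lambda>i. \<eta> i \<omega>) x n * (\<integral>z. G (x + (\<Sum>i<n. \<eta> i \<omega>) + z) \<partial>distr M borel (\<eta> n)) \<partial>M)"
  proof (rule Bochner_Integration.integral_cong[OF refl])
    fix \<omega>
    define y where "y = x + (\<Sum>i<n. \<eta> i \<omega>)"
    have "(\<integral>\<omega>'. g (X \<omega>, restrict (\<lambda>i. \<eta> i \<omega>') {n}) \<partial>M) =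
       stay D (\<lambda>i. \<eta> i \<omega>) x n * (\<integral>\<omega>'. G (y + \<eta> n \<omega>') \<partial>M)"
      by (simp add: g_def Xs y_def)
    also have "(\<integral>\<omega>'. G (y + \<eta> n \<omega>') \<partial>M) = (\<integral>z. G (y + z) \<partial>distr M borel (\<eta> n))"
      by (subst integral_distr) auto
    finally show "(\<integral>\<omega>'. g (X \<omega>, restrict (\<lambda>i. \<eta> i \<omega>') {n}) \<partial>M) =
        stay D (\<lambda>i. \<eta> i \<omega>) x n * (\<integral>z. G (x + (\<Sum>i<n. \<eta> i \<omega>) + z) \<partial>distr M borel (\<eta> n))"
      unfolding y_def .
  qed
  finally show ?thesis .
qed

section \<open>Path expectations expressed by the step operator\<close>

context symmetric_walk
begin

text \<open>The last increment is integrated out first and absorbed into the terminal function, so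
  the induction must range over all f.\<close>

lemma walk_expectation:
  assumes M: "prob_space M" and ind: "prob_space.indep_vars M (\<lambda>_. borel) \<eta> {..<n}"
    and law: "\<And>i. i < n \<Longrightarrow> distr M borel (\<eta> i) = \<mu>"
    and f: "unit_fun f" and D: "D \<in> sets borel"
  shows "(\<integral>\<omega>. stay D (\<lambda>i. \<eta> i \<omega>) x n * f (x + (\<Sum>i<n. \<eta> i \<omega>)) \<partial>M) = (step \<mu> D ^^ n) f x"
proof -
  interpret M: prob_space M by fact
  show ?thesis using ind law f
  proof (induction n arbitrary: f)
    case 0
    then show ?case by (simp add: stay_def M.prob_space)
  next
    case (Suc n)
    define G where "G = (\<lambda>u. indicator D u * f u)"
    have G: "unit_fun G" unfolding G_def by (intro unit_fun_mult unit_fun_indicator D Suc.prems)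
    have "(\<integral>\<omega>. stay D (\<lambda>i. \<eta> i \<omega>) x (Suc n) * f (x + (\<Sum>i<Suc n. \<eta> i \<omega>)) \<partial>M) =
        (\<integral>\<omega>. stay D (\<lambda>i. \<eta> i \<omega>) x n * G (x + (\<Sum>i<n. \<eta> i \<omega>) + \<eta> n \<omega>) \<partial>M)"
      by (simp add: G_def stay_Suc add.assoc mult.assoc)
    also have "\<dots> = (\<integral>\<omega>. stay D (\<lambda>i. \<eta> i \<omega>) x n * step \<mu> D f (x + (\<Sum>i<n. \<eta> i \<omega>)) \<partial>M)"
      unfolding M.stay_last_step[OF Suc.prems(1) D G] Suc.prems(2)[OF lessI] by (simp add: G_def step_def)
    also have "\<dots> = (step \<mu> D ^^ n) (step \<mu> D f) x"
      using Suc.prems by (intro Suc.IH M.indep_vars_subset[OF Suc.prems(1)] unit_fun_step D) auto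
    also have "\<dots> = (step \<mu> D ^^ Suc n) f x"
      by (simp only: funpow_Suc_right o_apply)
    finally show ?case .
  qed
qed

text \<open>The final step is not killed and need not have law \<mu>; it will carry the part of the
  time interval that the unit steps leave over.\<close>

lemma walk_last_step_expectation:
  assumes M: "prob_space M" and ind: "prob_space.indep_vars M (\<lambda>_. borel) \<eta> {..<Suc n}"
    and law: "\<And>i. i < n \<Longrightarrow> distr M borel (\<eta> i) = \<mu>"
    and G: "unit_fun G" and D: "D \<in> sets borel"
  shows "(\<integral>\<omega>. stay D (\<lambda>i. \<eta> i \<omega>) x n * G (x + (\<Sum>i<n. \<eta> i \<omega>) + \<eta> n \<omega>) \<partial>M) =
    (step \<mu> D ^^ n) (\<lambda>w. \<integral>z. G (w + z) \<partial>distr M borel (\<eta> n)) x"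
    and "unit_fun (\<lambda>w. \<integral>z. G (w + z) \<partial>distr M borel (\<eta> n))"
proof -
  interpret M: prob_space M by fact
  have [measurable]: "G \<in> borel_measurable borel" using unit_funD[OF G] by simp
  have [measurable]: "\<eta> n \<in> borel_measurable M"
    using ind by (auto simp: M.indep_vars_def)
  interpret Z: prob_space "distr M borel (\<eta> n)" by (rule M.prob_space_distr) simp
  have "(\<lambda>w. \<integral>z. G (w + z) \<partial>distr M borel (\<eta> n)) \<in> borel_measurable borel"
    by (rule Z.borel_measurable_lebesgue_integral) measurable
  moreover have "0 \<le> (\<integral>z. G (w + z) \<partial>distr M borel (\<eta> n))" for w
    using unit_funD[OF G] by (intro integral_nonneg_AE) auto
  moreover have "(\<integral>z. G (w + z) \<partial>distr M borel (\<eta> n)) \<le> (\<integral>z. 1 \<partial>distr M borel (\<eta> n))" for w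
    using unit_funD[OF G] by (intro integral_mono Z.integrable_const_bound[where B=1]) auto
  ultimately show F: "unit_fun (\<lambda>w. \<integral>z. G (w + z) \<partial>distr M borel (\<eta> n))"
    using Z.prob_space by (simp add: unit_fun_def)
  show "(\<integral>\<omega>. stay D (\<lambda>i. \<eta> i \<omega>) x n * G (x + (\<Sum>i<n. \<eta> i \<omega>) + \<eta> n \<omega>) \<partial>M) =
    (step \<mu> D ^^ n) (\<lambda>w. \<integral>z. G (w + z) \<partial>distr M borel (\<eta> n)) x"
    unfolding M.stay_last_step[OF ind D G]
    by (rule walk_expectation[OF M _ law F D]) (auto intro: M.indep_vars_subset[OF ind])
qed

lemma steps_le_combination:
  assumes F: "unit_fun F" and g: "unit_fun g" and D: "D \<in> sets borel"
    and le: "\<And>w. F w \<le> A + B * g w"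
  shows "(step \<mu> D ^^ n) F x \<le> A * (step \<mu> D ^^ n) (\<lambda>_. 1) x + B * (step \<mu> D ^^ n) g x"
proof (induction n arbitrary: x)
  case (Suc n)
  note u = unit_fun_steps[OF F D, of n] unit_fun_steps[OF g D, of n] unit_fun_steps[OF unit_fun_one D, of n]
  have i: "integrable \<mu> (\<lambda>y. indicator D (x + y) * (step \<mu> D ^^ n) F (x + y))"
    "integrable \<mu> (\<lambda>y. indicator D (x + y) * (step \<mu> D ^^ n) g (x + y))"
    "integrable \<mu> (\<lambda>y. indicator D (x + y) * (step \<mu> D ^^ n) (\<lambda>_. 1) (x + y))"
    by (rule step_integrable[OF u(1) D], rule step_integrable[OF u(2) D], rule step_integrable[OF u(3) D])
  have "(step \<mu> D ^^ Suc n) F x \<le> (\<integral>y. A * (indicator D (x + y) * (step \<mu> D ^^ n) (\<lambda>_. 1) (x + y)) +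
      B * (indicator D (x + y) * (step \<mu> D ^^ n) g (x + y)) \<partial>\<mu>)"
    unfolding steps_Suc
  proof (rule integral_mono[OF i(1)])
    show "integrable \<mu> (\<lambda>y. A * (indicator D (x + y) * (step \<mu> D ^^ n) (\<lambda>_. 1) (x + y)) +
      B * (indicator D (x + y) * (step \<mu> D ^^ n) g (x + y)))"
      using i(2,3) by (intro Bochner_Integration.integrable_add integrable_mult_right)
    show "indicator D (x + y) * (step \<mu> D ^^ n) F (x + y) \<le> A * (indicator D (x + y) * (step \<mu> D ^^ n) (\<lambda>_. 1) (x + y)) +
      B * (indicator D (x + y) * (step \<mu> D ^^ n) g (x + y))" for y
      using Suc.IH[of "x + y"] by (cases "x + y \<in> D") auto
  qed
  also have "\<dots> = A * (step \<mu> D ^^ Suc n) (\<lambda>_. 1) x + B * (step \<mu> D ^^ Suc n) g x"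
    unfolding steps_Suc using i(2,3)
    by (subst Bochner_Integration.integral_add) (auto intro: integrable_mult_right)
  finally show ?case .
qed (use le in simp)

lemma walk_survival:
  assumes M: "prob_space M" and ind: "prob_space.indep_vars M (\<lambda>_. borel) \<eta> {..<n}"
    and law: "\<And>i. i < n \<Longrightarrow> distr M borel (\<eta> i) = \<mu>" and D: "D \<in> sets borel"
  shows "(\<integral>\<omega>. stay D (\<lambda>i. \<eta> i \<omega>) x n \<partial>M) = (step \<mu> D ^^ n) (\<lambda>_. 1) x"
  using walk_expectation[OF M ind law unit_fun_one D, of x] by simp

lemma steps_UNIV_law:
  assumes M: "prob_space M" and ind: "prob_space.indep_vars M (\<lambda>_. borel) \<eta> {..<n}"
    and law: "\<And>i. i < n \<Longrightarrow> distr M borel (\<eta> i) = \<mu>" and f: "unit_fun f"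
  shows "(step \<mu> UNIV ^^ n) f x = (\<integral>\<omega>. f (x + (\<Sum>i<n. \<eta> i \<omega>)) \<partial>M)"
  using walk_expectation[OF M ind law f, of UNIV x] by (simp add: stay_def)

text \<open>The increments before k, reversed and negated, and those after k form independent
  families. By symmetry the negated ones again have law \<mu>, so each factor is a survival
  probability from 0.\<close>

lemma minimum_time_expectation:
  assumes M: "prob_space M" and ind: "prob_space.indep_vars M (\<lambda>_. borel) \<xi> {..<n}"
    and law: "\<And>i. i < n \<Longrightarrow> distr M borel (\<xi> i) = \<mu>" and D: "D \<in> sets borel" and k: "k \<le> n"
  shows "(\<integral>\<omega>. stay D (\<lambda>i. - \<xi> (k - Suc i) \<omega>) 0 k * stay D (\<lambda>i. \<xi> (k + i) \<omega>) 0 (n - k) \<partial>M) =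
    (step \<mu> D ^^ k) (\<lambda>_. 1) 0 * (step \<mu> D ^^ (n - k)) (\<lambda>_. 1) 0"
    and "integrable M (\<lambda>\<omega>. stay D (\<lambda>i. - \<xi> (k - Suc i) \<omega>) 0 k * stay D (\<lambda>i. \<xi> (k + i) \<omega>) 0 (n - k))"
proof -
  interpret M: prob_space M by fact
  have rv: "\<xi> i \<in> borel_measurable M" if "i < n" for i
    using ind that by (auto simp: M.indep_vars_def)
  define A where "A = (\<lambda>\<omega>. stay D (\<lambda>i. - \<xi> (k - Suc i) \<omega>) 0 k)"
  define B where "B = (\<lambda>\<omega>. stay D (\<lambda>i. \<xi> (k + i) \<omega>) 0 (n - k))"
  have sm: "(\<lambda>w. stay D (\<lambda>i. h (w (r i))) 0 l) \<in> borel_measurable (PiM J (\<lambda>_. borel :: real measure))"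
    if h[measurable]: "h \<in> borel_measurable borel" and r: "\<And>i. i < l \<Longrightarrow> r i \<in> J"
    for h :: "real \<Rightarrow> real" and r :: "nat \<Rightarrow> nat" and J l
    unfolding stay_def
  proof (rule borel_measurable_prod)
    fix m assume m: "m \<in> {1..l}"
    have [measurable]: "D \<in> sets borel" by fact
    have [measurable]: "(\<lambda>w. \<Sum>i<m. h (w (r i))) \<in> borel_measurable (PiM J (\<lambda>_. borel :: real measure))"
    proof (rule borel_measurable_sum)
      fix i assume "i \<in> {..<m}"
      then have [measurable]: "(\<lambda>w. w (r i)) \<in> borel_measurable (PiM J (\<lambda>_. borel :: real measure))"
        using r m by (intro measurable_component_singleton) auto
      show "(\<lambda>w. h (w (r i))) \<in> borel_measurable (PiM J (\<lambda>_. borel :: real measure))"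
        by measurable
    qed
    show "(\<lambda>w. indicat_real D (0 + (\<Sum>i<m. h (w (r i))))) \<in> borel_measurable (PiM J (\<lambda>_. borel :: real measure))"
      by measurable
  qed
  have r: "M.indep_var (PiM {..<k} (\<lambda>_. borel)) (\<lambda>\<omega>. restrict (\<lambda>i. \<xi> i \<omega>) {..<k})
      (PiM {k..<n} (\<lambda>_. borel)) (\<lambda>\<omega>. restrict (\<lambda>i. \<xi> i \<omega>) {k..<n})"
    using k by (intro M.indep_var_restrict[OF ind]) auto
  have "M.indep_var borel ((\<lambda>w. stay D (\<lambda>i. - (w (k - Suc i))) 0 k) \<circ> (\<lambda>\<omega>. restrict (\<lambda>i. \<xi> i \<omega>) {..<k}))
      borel ((\<lambda>w. stay D (\<lambda>i. w (k + i)) 0 (n - k)) \<circ> (\<lambda>\<omega>. restrict (\<lambda>i. \<xi> i \<omega>) {k..<n}))"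
    using sm[of uminus k "\<lambda>i. k - Suc i" "{..<k}"] sm[of "\<lambda>x. x" "n - k" "\<lambda>i. k + i" "{k..<n}"]
    by (intro M.indep_var_compose[OF r]) auto
  also have "(\<lambda>w. stay D (\<lambda>i. - (w (k - Suc i))) 0 k) \<circ> (\<lambda>\<omega>. restrict (\<lambda>i. \<xi> i \<omega>) {..<k}) = A"
    unfolding A_def comp_def by (intro ext stay_cong) auto
  also have "(\<lambda>w. stay D (\<lambda>i. w (k + i)) 0 (n - k)) \<circ> (\<lambda>\<omega>. restrict (\<lambda>i. \<xi> i \<omega>) {k..<n}) = B"
    unfolding B_def comp_def by (intro ext stay_cong) auto
  finally have ib: "M.indep_var borel A borel B" .
  have [measurable]: "A \<in> borel_measurable M" "B \<in> borel_measurable M"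
    using M.indep_var_rv1[OF ib] M.indep_var_rv2[OF ib] by auto
  have AB: "integrable M A" "integrable M B"
    by (auto intro!: M.integrable_const_bound[where B=1] simp: A_def[THEN fun_cong] B_def[THEN fun_cong] stay_bounds)
  have "(\<integral>\<omega>. A \<omega> * B \<omega> \<partial>M) = (\<integral>\<omega>. A \<omega> \<partial>M) * (\<integral>\<omega>. B \<omega> \<partial>M)"
    by (rule M.indep_var_lebesgue_integral[OF ib AB])
  also have "(\<integral>\<omega>. A \<omega> \<partial>M) = (step \<mu> D ^^ k) (\<lambda>_. 1) 0"
    unfolding A_def
  proof (rule walk_survival[OF M _ _ D])
    have "M.indep_vars (\<lambda>_. borel) (\<lambda>i. \<xi> (k - Suc i)) {..<k}"
      using k by (intro M.indep_vars_reindex[OF ind]) (auto simp: inj_on_def)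
    from M.indep_vars_compose2[OF this, of "\<lambda>_. uminus" "\<lambda>_. borel"]
    show "M.indep_vars (\<lambda>_. borel) (\<lambda>i \<omega>. - \<xi> (k - Suc i) \<omega>) {..<k}" by simp
    fix i assume "i < k"
    then have i: "k - Suc i < n" using k by auto
    have "distr M borel (\<lambda>\<omega>. - \<xi> (k - Suc i) \<omega>) = distr (distr M borel (\<xi> (k - Suc i))) borel uminus"
      using rv[OF i] by (subst distr_distr) (auto simp: comp_def)
    then show "distr M borel (\<lambda>\<omega>. - \<xi> (k - Suc i) \<omega>) = \<mu>" by (simp add: law[OF i] symmetric)
  qed
  also have "(\<integral>\<omega>. B \<omega> \<partial>M) = (step \<mu> D ^^ (n - k)) (\<lambda>_. 1) 0"
    unfolding B_def
  proof (rule walk_survival[OF M _ _ D])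
    show "M.indep_vars (\<lambda>_. borel) (\<lambda>i. \<xi> (k + i)) {..<n - k}"
      using k by (intro M.indep_vars_reindex[OF ind]) (auto simp: inj_on_def)
    show "distr M borel (\<xi> (k + i)) = \<mu>" if "i < n - k" for i
      using that by (intro law) auto
  qed
  finally show "(\<integral>\<omega>. stay D (\<lambda>i. - \<xi> (k - Suc i) \<omega>) 0 k * stay D (\<lambda>i. \<xi> (k + i) \<omega>) 0 (n - k) \<partial>M) =
    (step \<mu> D ^^ k) (\<lambda>_. 1) 0 * (step \<mu> D ^^ (n - k)) (\<lambda>_. 1) 0"
    by (simp only: A_def B_def)
  have "integrable M (\<lambda>\<omega>. A \<omega> * B \<omega>)"
    by (rule M.indep_var_integrable[OF ib AB])
  then show "integrable M (\<lambda>\<omega>. stay D (\<lambda>i. - \<xi> (k - Suc i) \<omega>) 0 k * stay D (\<lambda>i. \<xi> (k + i) \<omega>) 0 (n - k))"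
    by (simp only: A_def B_def)
qed

text \<open>Let S be the partial sums. The reversed negated walk at step l is S(k - l) - S(k), the
  forward one is S(k + l) - S(k). With D a half-line, the product is the indicator that S is minimal
  at k.\<close>

lemma stay_minimum_eq:
  fixes w :: "nat \<Rightarrow> real"
  assumes "k \<le> n"
  shows "stay D (\<lambda>i. - w (k - Suc i)) 0 k * stay D (\<lambda>i. w (k + i)) 0 (n - k) =
    of_bool (\<forall>j\<le>n. j \<noteq> k \<longrightarrow> (\<Sum>i<j. w i) - (\<Sum>i<k. w i) \<in> D)"
proof -
  have a: "(\<Sum>i<l. - w (k - Suc i)) = (\<Sum>i<k - l. w i) - (\<Sum>i<k. w i)" if "l \<le> k" for l
    using that
  proof (induction l)
    case (Suc l)
    then have "k - l = Suc (k - Suc l)" by simp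
    then have "(\<Sum>i<k - l. w i) = (\<Sum>i<k - Suc l. w i) + w (k - Suc l)" by simp
    then show ?case using Suc by simp
  qed simp
  have b: "(\<Sum>i<l. w (k + i)) = (\<Sum>i<k + l. w i) - (\<Sum>i<k. w i)" for l
    by (induction l) auto
  have "(\<forall>l\<in>{1..k}. 0 + (\<Sum>i<l. - w (k - Suc i)) \<in> D) \<longleftrightarrow> (\<forall>j<k. (\<Sum>i<j. w i) - (\<Sum>i<k. w i) \<in> D)"
  proof safe
    fix j assume H: "\<forall>l\<in>{1..k}. 0 + (\<Sum>i<l. - w (k - Suc i)) \<in> D" and j: "j < k"
    show "(\<Sum>i<j. w i) - (\<Sum>i<k. w i) \<in> D"
      using bspec[OF H, of "k - j"] j a[of "k - j"] by simp
  next
    fix l assume H: "\<forall>j<k. (\<Sum>i<j. w i) - (\<Sum>i<k. w i) \<in> D" and l: "l \<in> {1..k}"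
    then show "0 + (\<Sum>i<l. - w (k - Suc i)) \<in> D"
      using a[of l] by simp
  qed
  moreover have "(\<forall>l\<in>{1..n - k}. 0 + (\<Sum>i<l. w (k + i)) \<in> D) \<longleftrightarrow> (\<forall>j\<in>{k<..n}. (\<Sum>i<j. w i) - (\<Sum>i<k. w i) \<in> D)"
  proof safe
    fix j assume H: "\<forall>l\<in>{1..n - k}. 0 + (\<Sum>i<l. w (k + i)) \<in> D" and j: "j \<in> {k<..n}"
    show "(\<Sum>i<j. w i) - (\<Sum>i<k. w i) \<in> D"
    proof -
      have "j - k \<in> {1..n - k}" using j by auto
      from bspec[OF H this] show ?thesis using j b[of "j - k"] by simp
    qed
  next
    fix l assume H: "\<forall>j\<in>{k<..n}. (\<Sum>i<j. w i) - (\<Sum>i<k. w i) \<in> D" and l: "l \<in> {1..n - k}"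
    then show "0 + (\<Sum>i<l. w (k + i)) \<in> D"
      using b[of l] assms by auto
  qed
  moreover have "(\<forall>j\<le>n. j \<noteq> k \<longrightarrow> P j) \<longleftrightarrow> (\<forall>j<k. P j) \<and> (\<forall>j\<in>{k<..n}. P j)" for P
  proof (intro iffI conjI allI ballI impI)
    fix j assume H: "\<forall>j\<le>n. j \<noteq> k \<longrightarrow> P j" and "j < k"
    then have "j \<le> n" "j \<noteq> k" using assms by auto
    then show "P j" using H by blast
  next
    fix j assume H: "(\<forall>j<k. P j) \<and> (\<forall>j\<in>{k<..n}. P j)" and j: "j \<le> n" "j \<noteq> k"
    then have "j < k \<or> j \<in> {k<..n}" by auto
    then show "P j" using H by blast
  qed auto
  ultimately show ?thesis by (simp only: stay_eq of_bool_conj)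
qed

lemma step_closed_halfline:
  assumes atomless: "\<And>c. measure \<mu> {c} = 0" and [measurable]: "g \<in> borel_measurable borel"
  shows "step \<mu> {0..} g z = step \<mu> {0<..} g z"
proof -
  have "{- z} \<in> null_sets \<mu>" using atomless[of "- z"] by (simp add: null_sets_def emeasure_eq_measure)
  then have "AE y in \<mu>. y \<notin> {- z}" by (rule AE_not_in)
  then have ae: "AE y in \<mu>. indicator {0..} (z + y) * g (z + y) = indicator {0<..} (z + y) * g (z + y)"
    by eventually_elim (auto simp: indicator_def)
  show ?thesis unfolding step_def by (rule integral_cong_AE[OF _ _ ae]) auto
qed

text \<open>Without atoms ties are negligible, so strict and weak minima have the same
  probabilities; \<open>survival_convolution\<close> needs both versions.\<close>

lemma survival_closed_halfline:
  assumes atomless: "\<And>c. measure \<mu> {c} = 0"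
  shows "(step \<mu> {0..} ^^ n) (\<lambda>_. 1) = survival n"
proof (induction n)
  case (Suc n)
  show ?case
    using step_closed_halfline[OF atomless unit_funD(1)[OF unit_fun_survival]]
    by (auto simp: Suc survival_Suc fun_eq_iff)
qed (simp add: survival_def)

text \<open>Decomposing a path at the time of its minimum.\<close>
lemma survival_convolution:
  assumes M: "prob_space M" and ind: "prob_space.indep_vars M (\<lambda>_. borel) \<xi> {..<n}"
    and law: "\<And>i. i < n \<Longrightarrow> distr M borel (\<xi> i) = \<mu>"
    and atomless: "\<And>c. measure \<mu> {c} = 0"
  shows "(\<Sum>k\<le>n. survival k 0 * survival (n - k) 0) = 1"
proof (rule antisym)
  interpret M: prob_space M by fact
  define F where "F D k \<omega> = stay D (\<lambda>i. - \<xi> (k - Suc i) \<omega>) 0 k * stay D (\<lambda>i. \<xi> (k + i) \<omega>) 0 (n - k)" for D k \<omega>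
  have F_eq: "F D k \<omega> = of_bool (\<forall>j\<le>n. j \<noteq> k \<longrightarrow> (\<Sum>i<j. \<xi> i \<omega>) - (\<Sum>i<k. \<xi> i \<omega>) \<in> D)" if "k \<le> n" for D k \<omega>
    unfolding F_def by (rule stay_minimum_eq[OF that])
  have E: "(\<integral>\<omega>. (\<Sum>k\<le>n. F D k \<omega>) \<partial>M) = (\<Sum>k\<le>n. (step \<mu> D ^^ k) (\<lambda>_. 1) 0 * (step \<mu> D ^^ (n - k)) (\<lambda>_. 1) 0)"
    and I: "integrable M (\<lambda>\<omega>. \<Sum>k\<le>n. F D k \<omega>)" if D: "D \<in> sets borel" for D
  proof -
    note m = minimum_time_expectation[OF M ind law D, folded F_def]
    show "integrable M (\<lambda>\<omega>. \<Sum>k\<le>n. F D k \<omega>)"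
      by (intro Bochner_Integration.integrable_sum m) auto
    show "(\<integral>\<omega>. (\<Sum>k\<le>n. F D k \<omega>) \<partial>M) = (\<Sum>k\<le>n. (step \<mu> D ^^ k) (\<lambda>_. 1) 0 * (step \<mu> D ^^ (n - k)) (\<lambda>_. 1) 0)"
      by (subst Bochner_Integration.integral_sum) (auto intro!: m sum.cong)
  qed
  \<comment> \<open>A strict minimum is attained at no more than one time, which gives the upper
    bound 1.\<close>
  have "(\<integral>\<omega>. (\<Sum>k\<le>n. F {0<..} k \<omega>) \<partial>M) \<le> (\<integral>\<omega>. 1 \<partial>M)"
  proof (rule integral_mono[OF I])
    fix \<omega>
    define S where "S j = (\<Sum>i<j. \<xi> i \<omega>)" for j
    define K where "K = {k. k \<le> n \<and> (\<forall>j\<le>n. j \<noteq> k \<longrightarrow> S k < S j)}"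
    have "(\<Sum>k\<le>n. F {0<..} k \<omega>) = (\<Sum>k\<le>n. of_bool (k \<in> K))"
      by (intro sum.cong) (auto simp: F_eq K_def S_def)
    also have "\<dots> = real (card ({..n} \<inter> K))" by (subst sum_of_bool_eq) (auto simp: Int_def)
    also have "card ({..n} \<inter> K) \<le> 1"
    proof (rule ccontr)
      assume "\<not> card ({..n} \<inter> K) \<le> 1"
      then obtain a b where "a \<in> K" "b \<in> K" "a \<noteq> b"
        by (metis Int_iff card_le_Suc0_iff_eq finite_Int finite_atMost One_nat_def)
      then have "S a < S b" "S b < S a" by (auto simp: K_def)
      then show False by simp
    qed
    finally show "(\<Sum>k\<le>n. F {0<..} k \<omega>) \<le> 1" by simp
  qed auto
  then show "(\<Sum>k\<le>n. survival k 0 * survival (n - k) 0) \<le> 1"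
    using E[of "{0<..}"] by (simp add: survival_def M.prob_space)
  \<comment> \<open>A weak minimum is attained at some time, which gives the lower bound 1 for the
    closed half-line.\<close>
  have "(\<integral>\<omega>. 1 \<partial>M) \<le> (\<integral>\<omega>. (\<Sum>k\<le>n. F {0..} k \<omega>) \<partial>M)"
  proof (rule integral_mono[OF _ I])
    fix \<omega>
    define S where "S j = (\<Sum>i<j. \<xi> i \<omega>)" for j
    define k where "k = arg_min_on S {..n}"
    have k: "k \<le> n" "\<And>j. j \<le> n \<Longrightarrow> S k \<le> S j"
      using arg_min_if_finite[of "{..n}" S] by (auto simp: k_def not_less)
    then have "1 = F {0..} k \<omega>" by (simp add: F_eq S_def)
    also have "\<dots> \<le> (\<Sum>k\<le>n. F {0..} k \<omega>)"
      using k by (intro member_le_sum) (auto simp: F_eq)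
    finally show "1 \<le> (\<Sum>k\<le>n. F {0..} k \<omega>)" .
  qed auto
  then show "1 \<le> (\<Sum>k\<le>n. survival k 0 * survival (n - k) 0)"
    using E[of "{0..}"] by (simp add: survival_closed_halfline[OF atomless] M.prob_space)
qed

text \<open>Survival decreases in time, so each of the n + 1 terms of the convolution is at least
  the square of \<open>survival n 0\<close>.\<close>

lemma survival_zero_upper:
  assumes conv: "(\<Sum>k\<le>n. survival k 0 * survival (n - k) 0) = 1"
  shows "survival n 0 \<le> 1 / sqrt (real n + 1)"
proof -
  have s0: "0 \<le> survival k x" for k x using unit_funD[OF unit_fun_survival] by simp
  have "(\<Sum>k\<le>n. survival n 0 * survival n 0) \<le> 1"
    unfolding conv[symmetric] by (intro sum_mono mult_mono survival_antimono s0) auto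
  then have "(survival n 0)\<^sup>2 * (real n + 1) \<le> 1" by (simp add: power2_eq_square algebra_simps)
  then have "(survival n 0 * sqrt (real n + 1))\<^sup>2 \<le> 1\<^sup>2" by (simp add: power_mult_distrib)
  then have "survival n 0 * sqrt (real n + 1) \<le> 1" by (rule power2_le_imp_le) simp
  then show ?thesis by (simp add: pos_le_divide_eq)
qed

lemma sum_inverse_sqrt: "(\<Sum>k\<le>n. 1 / sqrt (real k + 1)) \<le> 2 * sqrt (real n + 1)"
proof (induction n)
  case (Suc n)
  define a where "a = sqrt (real n + 1)"
  define b where "b = sqrt (real n + 2)"
  have ab: "0 < a" "a \<le> b" "0 < b" "b\<^sup>2 = a\<^sup>2 + 1" by (auto simp: a_def b_def)
  have "2 * a * b \<le> a\<^sup>2 + b\<^sup>2" using zero_le_power2[of "a - b"] by (simp add: power2_eq_square algebra_simps)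
  then have "2 * a * b + 1 \<le> 2 * b\<^sup>2" using ab by simp
  then have "2 * a + 1 / b \<le> 2 * b" using ab by (simp add: field_simps power2_eq_square)
  then show ?case using Suc by (simp add: a_def b_def add.commute)
qed simp

text \<open>In the convolution of length 2 n one index of each product is at least n. Hence 1 is at
  most \<open>survival n 0\<close> times twice the sum of \<open>survival k 0\<close> over k \<le>
  n, and the upper bound makes that sum at most 2 sqrt (n + 1).\<close>

lemma survival_zero_lower:
  assumes conv: "\<And>n. (\<Sum>k\<le>n. survival k 0 * survival (n - k) 0) = 1"
  shows "1 / (4 * sqrt (real n + 1)) \<le> survival n 0"
proof -
  have s0: "0 \<le> survival k x" for k x using unit_funD[OF unit_fun_survival] by simp
  define A where "A = (\<Sum>k\<le>n. survival k 0)"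
  have "1 = (\<Sum>k\<le>2 * n. survival k 0 * survival (2 * n - k) 0)" using conv by simp
  also have "\<dots> \<le> (\<Sum>k\<le>2 * n. survival n 0 * (of_bool (k \<le> n) * survival k 0 + of_bool (n \<le> k) * survival (2 * n - k) 0))"
  proof (rule sum_mono)
    fix k assume "k \<in> {..2 * n}"
    show "survival k 0 * survival (2 * n - k) 0 \<le>
        survival n 0 * (of_bool (k \<le> n) * survival k 0 + of_bool (n \<le> k) * survival (2 * n - k) 0)"
    proof (cases "k \<le> n")
      case True
      then have "survival (2 * n - k) 0 \<le> survival n 0" by (intro survival_antimono) auto
      then have "survival k 0 * survival (2 * n - k) 0 \<le> survival n 0 * survival k 0"
        using s0 by (metis mult.commute mult_left_mono)
      also have "\<dots> \<le> survival n 0 * (of_bool (k \<le> n) * survival k 0 + of_bool (n \<le> k) * survival (2 * n - k) 0)"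
        using True s0 by (intro mult_left_mono) auto
      finally show ?thesis .
    next
      case False
      then have "survival k 0 \<le> survival n 0" by (intro survival_antimono) auto
      then show ?thesis using False s0 by (auto intro!: mult_right_mono)
    qed
  qed
  also have "\<dots> = survival n 0 * ((\<Sum>k\<le>2 * n. of_bool (k \<le> n) * survival k 0) + (\<Sum>k\<le>2 * n. of_bool (n \<le> k) * survival (2 * n - k) 0))"
    by (simp only: sum_distrib_left sum.distrib distrib_left)
  also have "(\<Sum>k\<le>2 * n. of_bool (k \<le> n) * survival k 0) = A"
    unfolding A_def by (rule sum.mono_neutral_cong_right) auto
  also have "(\<Sum>k\<le>2 * n. of_bool (n \<le> k) * survival (2 * n - k) 0) = A"
  proof -
    have "(\<Sum>k\<le>2 * n. of_bool (n \<le> k) * survival (2 * n - k) 0) = (\<Sum>k\<in>{n..2 * n}. survival (2 * n - k) 0)"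
      by (rule sum.mono_neutral_cong_right) auto
    also have "\<dots> = A" unfolding A_def
      by (rule sum.reindex_bij_witness[where i="\<lambda>k. 2 * n - k" and j="\<lambda>k. 2 * n - k"]) auto
    finally show ?thesis .
  qed
  finally have "1 \<le> survival n 0 * (2 * A)" by simp
  also have "\<dots> \<le> survival n 0 * (2 * (2 * sqrt (real n + 1)))"
  proof (intro mult_left_mono s0)
    have "A \<le> (\<Sum>k\<le>n. 1 / sqrt (real k + 1))"
      unfolding A_def by (intro sum_mono survival_zero_upper conv)
    then show "A \<le> 2 * sqrt (real n + 1)" using sum_inverse_sqrt[of n] by linarith
  qed simp
  finally show ?thesis by (simp add: divide_le_eq mult_ac)
qed

end

section \<open>The relativistic process at integer times\<close>

locale rel_process =
  fixes M :: "'a measure" and X :: "real \<Rightarrow> 'a \<Rightarrow> real" and \<alpha> :: real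
  assumes \<alpha>: "0 < \<alpha>" "\<alpha> < 2" and process: "rel_stable_process M \<alpha> X"
begin

sublocale prob_space M
  using process by (simp add: rel_stable_process_def)

abbreviation law :: "real \<Rightarrow> real measure" where "law s \<equiv> distr M borel (X s)"

lemma X_measurable: "0 \<le> s \<Longrightarrow> X s \<in> borel_measurable M"
  using process by (simp add: rel_stable_process_def)

lemma X_zero: "\<omega> \<in> space M \<Longrightarrow> X 0 \<omega> = 0"
  using process by (simp add: rel_stable_process_def)

lemma indep_increments:
  fixes ts :: "nat \<Rightarrow> real"
  assumes "0 \<le> ts 0" "\<And>i. i < n \<Longrightarrow> ts i \<le> ts (Suc i)"
  shows "indep_vars (\<lambda>_. borel) (\<lambda>i \<omega>. X (ts (Suc i)) \<omega> - X (ts i) \<omega>) {..<n}"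
  using process assms by (simp add: rel_stable_process_def)

lemma increment_law: "0 \<le> s \<Longrightarrow> s \<le> t \<Longrightarrow> distr M borel (\<lambda>\<omega>. X t \<omega> - X s \<omega>) = law (t - s)"
  using process by (simp add: rel_stable_process_def)

lemma law_char: "0 \<le> s \<Longrightarrow> char (law s) \<xi> = complex_of_real (exp s * exp (- s * (\<xi>\<^sup>2 + 1) powr (\<alpha> / 2)))"
  using process by (simp add: rel_stable_process_def)

lemma law_real_distribution: "0 \<le> s \<Longrightarrow> real_distribution (law s)"
  by (rule real_distribution_distr[OF X_measurable])

lemma relativistic_law: "0 < s \<Longrightarrow> relativistic_law (law s) (\<alpha> / 2) s"
proof -
  assume s: "0 < s"
  interpret L: real_distribution "law s" by (rule law_real_distribution) (use s in simp)
  show ?thesis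
    using s \<alpha> law_char[of s] by unfold_locales auto
qed

lemma law_symmetric: "0 \<le> s \<Longrightarrow> distr (law s) borel uminus = law s"
proof -
  assume s: "0 \<le> s"
  interpret L: real_distribution "law s" by (rule law_real_distribution[OF s])
  show ?thesis
  proof (rule Levy_uniqueness)
    show "real_distribution (distr (law s) borel uminus)"
      by (rule L.real_distribution_distr) simp
    show "char (distr (law s) borel uminus) = char (law s)"
    proof
      fix \<xi>
      have "char (distr (law s) borel uminus) \<xi> = char (law s) (- \<xi>)"
        unfolding char_def by (subst integral_distr) auto
      then show "char (distr (law s) borel uminus) \<xi> = char (law s) \<xi>"
        by (simp add: law_char[OF s])
    qed
  qed (rule law_real_distribution[OF s])
qed

sublocale walk: symmetric_walk "law 1"
proof -
  interpret L: real_distribution "law 1" by (rule law_real_distribution) simp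
  show "symmetric_walk (law 1)"
    by unfold_locales (rule law_symmetric, simp)
qed

definition D :: real where "D = dens_const (\<alpha> / 2)"

lemma D_nonneg: "0 \<le> D" unfolding D_def by (rule dens_const_nonneg)

lemma law_interval_bound:
  assumes "1/2 \<le> s" "0 \<le> l" "l\<^sup>2 \<le> 1/2" "0 < \<delta>"
  shows "measure (law s) {z - \<delta><..<z + \<delta>} \<le> \<delta> * (D / sqrt s * exp (l\<^sup>2 * (\<delta>\<^sup>2 + s) - l * z))"
proof -
  interpret R: relativistic_law "law s" "\<alpha> / 2" s using assms by (intro relativistic_law) simp
  show ?thesis unfolding D_def by (rule R.interval_bound[OF assms])
qed

text \<open>Time 0 is included because a climb may have no steps left; there \<rho> > 0 makes the
  tail empty.\<close>

lemma law_tail_bound: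
  assumes s: "0 \<le> s" and l: "0 \<le> l" "l < 1" and \<rho>: "0 < \<rho>"
  shows "measure (law s) {\<rho>..} \<le> exp (s * l\<^sup>2 - l * \<rho>)"
proof (cases "s = 0")
  case False
  then interpret R: relativistic_law "law s" "\<alpha> / 2" s using s by (intro relativistic_law) simp
  show ?thesis by (rule R.tail_bound[OF l])
next
  case True
  have "measure (law 0) {\<rho>..} = measure M (X 0 -` {\<rho>..} \<inter> space M)"
    using X_measurable[of 0] by (intro measure_distr) auto
  also have "X 0 -` {\<rho>..} \<inter> space M = {}" using \<rho> X_zero by auto
  finally show ?thesis using True by simp
qed

lemma law_atomless: "measure (law 1) {c} = 0"
proof -
  have "measure (law 1) {c} \<le> \<delta> * D" if "0 < \<delta>" for \<delta>
  proof -
    have "measure (law 1) {c} \<le> measure (law 1) {c - \<delta><..<c + \<delta>}"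
      using that by (intro walk.finite_measure_mono) auto
    also have "\<dots> \<le> \<delta> * D" using law_interval_bound[of 1 0 \<delta> c] that by simp
    finally show ?thesis .
  qed
  then have "measure (law 1) {c} \<le> 0 * D"
  proof (intro tendsto_lowerbound[where F="at_right 0" and f="\<lambda>\<delta>. \<delta> * D"])
    show "((\<lambda>\<delta>. \<delta> * D) \<longlongrightarrow> 0 * D) (at_right 0)" by (intro tendsto_intros)
  qed (auto simp: eventually_at_right_less intro: eventually_at_rightI[of 0 1])
  then show ?thesis by (simp add: measure_le_0_iff)
qed

definition \<xi> :: "nat \<Rightarrow> 'a \<Rightarrow> real" where "\<xi> i \<omega> = X (real (Suc i)) \<omega> - X (real i) \<omega>"

lemma \<xi>_indep: "indep_vars (\<lambda>_. borel) \<xi> {..<n}"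
  using indep_increments[of real n] by (simp add: \<xi>_def[abs_def])

lemma \<xi>_law: "distr M borel (\<xi> i) = law 1"
  using increment_law[of "real i" "real (Suc i)"] by (simp add: \<xi>_def[abs_def])

lemma \<xi>_sum: "(\<Sum>i<n. \<xi> i \<omega>) = X (real n) \<omega> - X 0 \<omega>"
  by (induction n) (auto simp: \<xi>_def)

lemma steps_eq_law:
  assumes "unit_fun f"
  shows "(step (law 1) UNIV ^^ n) f x = (\<integral>y. f (x + y) \<partial>law (real n))"
proof -
  have [measurable]: "f \<in> borel_measurable borel" using unit_funD[OF assms] by simp
  have "(step (law 1) UNIV ^^ n) f x = (\<integral>\<omega>. f (x + (\<Sum>i<n. \<xi> i \<omega>)) \<partial>M)"
    by (rule walk.steps_UNIV_law[OF prob_space_axioms \<xi>_indep \<xi>_law assms])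
  also have "\<dots> = (\<integral>\<omega>. f (x + X (real n) \<omega>) \<partial>M)"
    by (intro Bochner_Integration.integral_cong) (auto simp: \<xi>_sum X_zero)
  also have "\<dots> = (\<integral>y. f (x + y) \<partial>law (real n))"
    using X_measurable[of "real n"] by (subst integral_distr) auto
  finally show ?thesis .
qed

lemma steps_indicator_eq_law:
  assumes "A \<in> sets borel"
  shows "(step (law 1) UNIV ^^ n) (indicator A) x = measure (law (real n)) {y. x + y \<in> A}"
proof -
  have [measurable]: "A \<in> sets borel" by fact
  have "(\<lambda>y::real. indicat_real A (x + y)) = indicator {y. x + y \<in> A}" by (auto simp: indicator_def)
  moreover have "{y. x + y \<in> A} \<in> sets (law (real n))" by simp
  ultimately show ?thesis
    unfolding steps_eq_law[OF unit_fun_indicator[OF assms]] by simp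
qed

lemma survival_conv: "(\<Sum>k\<le>n. walk.survival k 0 * walk.survival (n - k) 0) = 1"
  by (rule walk.survival_convolution[OF prob_space_axioms \<xi>_indep \<xi>_law law_atomless])

text \<open>Anti-concentration: the untilted interval bound gives (-2x, 2x) mass at most 1/2, and
  symmetry shares the remaining mass between the two sides.\<close>

lemma law_halfline_ge:
  assumes x: "0 < x" and m: "4 * D * x \<le> sqrt (real m)" "1 \<le> m"
  shows "1/4 \<le> measure (law (real m)) {x<..}"
proof -
  interpret L: real_distribution "law (real m)" by (rule law_real_distribution) simp
  have refl: "measure (law (real m)) {..<- x} = measure (law (real m)) {x<..}"
  proof -
    have "measure (law (real m)) {..<- x} = measure (distr (law (real m)) borel uminus) {..<- x}"
      by (simp add: law_symmetric)
    also have "\<dots> = measure (law (real m)) (uminus -` {..<- x} \<inter> space (law (real m)))"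
      by (intro measure_distr) auto
    also have "uminus -` {..<- x} \<inter> space (law (real m)) = {x<..}" by auto
    finally show ?thesis .
  qed
  have "measure (law (real m)) {0 - 2 * x<..<0 + 2 * x} \<le> (2 * x) * (D / sqrt (real m))"
    using law_interval_bound[of "real m" 0 "2 * x" 0] x m(2) by simp
  also have "\<dots> = (2 * D * x) / sqrt (real m)" by simp
  also have "\<dots> \<le> 1/2" using m by (simp add: divide_le_eq)
  finally have c: "measure (law (real m)) {- (2 * x)<..<2 * x} \<le> 1/2" by simp
  have "1 = measure (law (real m)) UNIV" using L.prob_space by simp
  also have "\<dots> \<le> measure (law (real m)) ({- (2 * x)<..<2 * x} \<union> ({x<..} \<union> {..<- x}))"
    using x by (intro L.finite_measure_mono) auto
  also have "\<dots> \<le> measure (law (real m)) {- (2 * x)<..<2 * x} + measure (law (real m)) ({x<..} \<union> {..<- x})"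
    by (rule measure_Un_le) auto
  also have "measure (law (real m)) ({x<..} \<union> {..<- x}) \<le> measure (law (real m)) {x<..} + measure (law (real m)) {..<- x}"
    by (rule measure_Un_le) auto
  finally show ?thesis using c refl by simp
qed

text \<open>The 16 collects the 1/4 of \<open>survival_zero_lower\<close> and the 1/4 of
  \<open>law_halfline_ge\<close>; the root bounds sqrt (m + 1) / x for the number m of restart steps
  in \<open>survival_decay\<close>.\<close>

definition C\<^sub>s :: real where "C\<^sub>s = 16 * sqrt (16 * D\<^sup>2 + 3)"

lemma C\<^sub>s_ge: "1 \<le> C\<^sub>s"
proof -
  have "1 \<le> sqrt (16 * D\<^sup>2 + 3)" by simp
  then show ?thesis unfolding C\<^sub>s_def by linarith
qed

lemma survival_decay:
  assumes x: "1 \<le> x" and n: "1 \<le> n"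
  shows "walk.survival n x \<le> C\<^sub>s * x / sqrt (real n)"
proof -
  \<comment> \<open>Of order x^2, large enough for \<open>4 * D * x \<le> sqrt (real m)\<close>; the
    added 1 secures m \<ge> 1.\<close>
  define m where "m = nat \<lceil>16 * D\<^sup>2 * x\<^sup>2\<rceil> + 1"
  have D2: "0 \<le> 16 * D\<^sup>2 * x\<^sup>2" by simp
  have m1: "16 * D\<^sup>2 * x\<^sup>2 \<le> real m" "real m \<le> 16 * D\<^sup>2 * x\<^sup>2 + 2"
    unfolding m_def using D2 by (auto, linarith+)
  have "4 * D * x = sqrt (16 * D\<^sup>2 * x\<^sup>2)"
    using D_nonneg x by (simp add: real_sqrt_mult)
  also have "\<dots> \<le> sqrt (real m)" using m1 by simp
  finally have "1/4 \<le> measure (law (real m)) {x<..}"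
    using x by (intro law_halfline_ge) (auto simp: m_def)
  then have p: "1/4 \<le> (step (law 1) UNIV ^^ m) (indicator {x<..}) 0"
    by (simp add: steps_indicator_eq_law greaterThan_def)
  have "walk.survival n x * (1 / (4 * sqrt (real m + 1)) * (1/4)) \<le>
      walk.survival n x * (walk.survival m 0 * (step (law 1) UNIV ^^ m) (indicator {x<..}) 0)"
    using p walk.survival_zero_lower[OF survival_conv, of m] unit_funD[OF walk.unit_fun_survival]
    by (intro mult_left_mono mult_mono) auto
  also have "\<dots> \<le> walk.survival (m + n) 0" by (rule walk.survival_restart)
  also have "\<dots> \<le> 1 / sqrt (real (m + n) + 1)" by (rule walk.survival_zero_upper[OF survival_conv])
  also have "\<dots> \<le> 1 / sqrt (real n)" using n by (intro divide_left_mono) auto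
  finally have "walk.survival n x / (16 * sqrt (real m + 1)) \<le> 1 / sqrt (real n)" by simp
  then have "walk.survival n x \<le> 1 / sqrt (real n) * (16 * sqrt (real m + 1))"
    by (subst (asm) pos_divide_le_eq) auto
  also have "sqrt (real m + 1) \<le> sqrt (16 * D\<^sup>2 + 3) * x"
  proof -
    have "1 \<le> x\<^sup>2" using x by simp
    then have "real m + 1 \<le> (16 * D\<^sup>2 + 3) * x\<^sup>2" using m1(2) by (simp add: distrib_right)
    then have "sqrt (real m + 1) \<le> sqrt ((16 * D\<^sup>2 + 3) * x\<^sup>2)" by simp
    then show ?thesis using x by (simp add: real_sqrt_mult)
  qed
  finally show ?thesis by (simp add: C\<^sub>s_def mult_left_mono divide_right_mono)
qed

text \<open>80 = 5 * 16, where 5 inverts the survival probability 1/5 and 16 comes from sqrt m \<ge>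
  r / 16. The summand 16 makes the bound trivial for r < 16.\<close>

definition C\<^sub>h :: real where "C\<^sub>h = 80 * C\<^sub>s + 16"

lemma C\<^sub>h_ge: "1 \<le> C\<^sub>h" using C\<^sub>s_ge by (simp add: C\<^sub>h_def)

text \<open>With m close to r^2 / 64, Levy's inequality lets a walk started at r / 4 survive m steps
  with probability at least 1/5. Reaching x + r / 4 is therefore at most five times as likely as
  surviving m steps from x, and \<open>survival_decay\<close> applies.\<close>

lemma hit_bound:
  assumes x: "1 \<le> x" and r: "1 \<le> r"
  shows "walk.hit (x + r / 4) n x \<le> C\<^sub>h * x / r"
proof (cases "16 \<le> r")
  case False
  have "walk.hit (x + r / 4) n x \<le> 1" using unit_funD[OF walk.unit_fun_hit] by simp
  also have "1 \<le> 16 * x / r" using False x r by simp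
  also have "\<dots> \<le> C\<^sub>h * x / r"
    using x r C\<^sub>s_ge by (intro divide_right_mono mult_right_mono) (auto simp: C\<^sub>h_def)
  finally show ?thesis .
next
  case True
  define L where "L = x + r / 4"
  define m where "m = nat \<lfloor>r\<^sup>2 / 64\<rfloor>"
  have r2: "256 \<le> r\<^sup>2" using power_mono[of 16 r 2] True by simp
  have m: "real m \<le> r\<^sup>2 / 64" "r\<^sup>2 / 256 \<le> real m"
    unfolding m_def using r2 by linarith+
  have m1: "1 \<le> m" using m(2) r2 by linarith
  define q where "q = measure (law (real m)) {r / 4..}"
  have q: "q \<le> 2/5"
  proof -
    \<comment> \<open>The Chernoff rate 8 / r makes the exponent at most 1 - 2 = -1, and exp (-1)
      \<le> 2/5 leaves 1 - 2 q \<ge> 1/5.\<close>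
    have "q \<le> exp (real m * (8 / r)\<^sup>2 - 8 / r * (r / 4))"
      unfolding q_def using True by (intro law_tail_bound) auto
    also have "real m * (8 / r)\<^sup>2 - 8 / r * (r / 4) \<le> -1"
    proof -
      have "real m * (8 / r)\<^sup>2 \<le> (r\<^sup>2 / 64) * (8 / r)\<^sup>2" using m(1) by (intro mult_right_mono) auto
      also have "\<dots> = 1" using True by (simp add: power_divide)
      finally show ?thesis using True by simp
    qed
    also have "exp (-1 :: real) \<le> 2/5"
      using exp_lower_Taylor_quadratic[of 1] by (simp add: exp_minus divide_simps)
    finally show ?thesis by simp
  qed
  have "1 - walk.survival m (r / 4) \<le> 2 * (step (law 1) UNIV ^^ m) (indicator {..0}) (r / 4)"
    using True by (intro walk.survival_levy_bound) simp
  also have "(step (law 1) UNIV ^^ m) (indicator {..0}) (r / 4) = q"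
  proof -
    have "(step (law 1) UNIV ^^ m) (indicator {..0}) (r / 4) = measure (law (real m)) {y. r / 4 + y \<le> 0}"
      by (simp add: steps_indicator_eq_law)
    also have "\<dots> = measure (distr (law (real m)) borel uminus) {y. r / 4 + y \<le> 0}"
      by (simp add: law_symmetric)
    also have "\<dots> = measure (law (real m)) (uminus -` {y. r / 4 + y \<le> 0} \<inter> space (law (real m)))"
      by (intro measure_distr) auto
    also have "uminus -` {y. r / 4 + y \<le> 0} \<inter> space (law (real m)) = {r / 4..}" by auto
    finally show ?thesis by (simp add: q_def)
  qed
  finally have "1/5 \<le> walk.survival m (r / 4)" using q by simp
  also have "\<dots> \<le> walk.survival m L" using x by (intro walk.survival_incr) (simp add: L_def)
  finally have "1/5 * walk.hit L n x \<le> walk.survival m L * walk.hit L n x"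
    using unit_funD[OF walk.unit_fun_hit] by (intro mult_right_mono) auto
  also have "\<dots> \<le> walk.survival m x" by (rule walk.hit_le_survival) simp
  also have "\<dots> \<le> C\<^sub>s * x / sqrt (real m)" by (rule survival_decay[OF x m1])
  also have "\<dots> \<le> C\<^sub>s * x / (r / 16)"
  proof (rule divide_left_mono)
    have "sqrt (r\<^sup>2 / 256) \<le> sqrt (real m)" using m(2) by simp
    then show "r / 16 \<le> sqrt (real m)" using True by (simp add: real_sqrt_divide)
  qed (use x C\<^sub>s_ge True m1 in auto)
  finally have "walk.hit L n x \<le> 80 * C\<^sub>s * x / r" by simp
  also have "\<dots> \<le> C\<^sub>h * x / r"
    using x r by (intro divide_right_mono mult_right_mono) (auto simp: C\<^sub>h_def)
  finally show ?thesis by (simp add: L_def)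
qed

end

lemma stay_process_measurable:
  assumes [measurable]: "\<And>i. \<eta> i \<in> borel_measurable M" "D \<in> sets borel"
  shows "(\<lambda>\<omega>. stay D (\<lambda>i. \<eta> i \<omega>) x n) \<in> borel_measurable M"
  unfolding stay_def by measurable

lemma min_one_le_scale:
  fixes u C :: real
  assumes "v \<le> 1" "v \<le> C * u" "1 \<le> C" "0 \<le> u"
  shows "v \<le> C * min 1 u"
  using assms by (auto simp: min_def)

section \<open>Walks with one irregular increment\<close>

context rel_process
begin

lemma law_interval_eq:
  "(\<integral>z. indicat_real {b - \<delta><..<b + \<delta>} (w + z) \<partial>law s) = measure (law s) {(b - w) - \<delta><..<(b - w) + \<delta>}"
proof -
  have "(\<lambda>z. indicat_real {b - \<delta><..<b + \<delta>} (w + z)) = indicat_real {(b - w) - \<delta><..<(b - w) + \<delta>}"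
    by (auto simp: indicator_def fun_eq_iff)
  then show ?thesis by simp
qed

text \<open>The distance r is cut into quarters: reach L = a + r / 4 (\<open>hit\<close>), allow an
  entrance strip of width r / 4, climb another r / 4 to a + 3 r / 4, and cover the last quarter by
  the final increment. Either the final step covers at least r / 4 and pays the Chernoff factor E,
  or the walk was already above a + 3 r / 4, where \<open>steps_climb_bound\<close> pays E times the
  hitting probability, plus a term for one unit step exceeding r / 4.\<close>

lemma one_sided_bound:
  assumes ind: "indep_vars (\<lambda>_. borel) \<eta> {..<Suc N}"
    and unit: "\<And>i. i < N \<Longrightarrow> distr M borel (\<eta> i) = law 1" and last: "distr M borel (\<eta> N) = law s"
    and a: "1 \<le> a" and r: "1 \<le> r" and N: "1 \<le> N" "t \<le> 4 * real N" "real N \<le> t"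
    and s: "1/2 \<le> s" "s \<le> t" and t: "t \<le> r\<^sup>2" and d: "0 < \<delta>" "\<delta> \<le> 1" and l: "0 \<le> l" "l \<le> 5/8"
  shows "(\<integral>\<omega>. stay {0<..} (\<lambda>i. \<eta> i \<omega>) a N * indicat_real {a + r - \<delta><..<a + r + \<delta>} (a + (\<Sum>i<N. \<eta> i \<omega>) + \<eta> N \<omega>) \<partial>M)
    \<le> \<delta> * (D * exp 1 / sqrt s) * ((2 * C\<^sub>s + C\<^sub>h) * min 1 (a / sqrt t) * exp (l\<^sup>2 * t - l * r / 4) + t * exp (25/64 - 5 * r / 32))"
proof -
  define K where "K = \<delta> * (D * exp 1 / sqrt s)"
  define E where "E = exp (l\<^sup>2 * t - l * r / 4)"
  define e where "e = exp (25/64 - 5 * r / 32)"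
  define F where "F w = (\<integral>z. indicat_real {a + r - \<delta><..<a + r + \<delta>} (w + z) \<partial>law s)" for w
  define L where "L = a + r / 4"
  have t_pos: "0 < t" using s by simp
  have K: "0 \<le> K" using D_nonneg d s by (simp add: K_def)
  have l2: "l\<^sup>2 \<le> 25/64" using power_mono[OF l(2,1), of 2] by (simp add: power_divide)
  have "unit_fun (indicat_real {a + r - \<delta><..<a + r + \<delta>})" by (intro unit_fun_indicator) simp
  note W = walk.walk_last_step_expectation[OF prob_space_axioms ind unit this, of "{0<..}", unfolded last, folded F_def]
  have F: "unit_fun F" using W(2) by simp
  have F_le: "F w \<le> K * E + K * indicat_real {a + 3 * r / 4..} w" for w
  proof -
    have I: "F w \<le> \<delta> * (D / sqrt s * exp (k\<^sup>2 * (\<delta>\<^sup>2 + s) - k * (a + r - w)))" if "0 \<le> k" "k\<^sup>2 \<le> 1/2" for k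
      unfolding F_def law_interval_eq using that s d by (intro law_interval_bound) auto
    show ?thesis
    proof (cases "a + 3 * r / 4 \<le> w")
      case True
      have "F w \<le> \<delta> * (D / sqrt s * 1)" using I[of 0] by simp
      also have "\<dots> \<le> \<delta> * (D / sqrt s * exp 1)" using d D_nonneg s by (intro mult_left_mono) auto
      also have "\<dots> = K" by (simp add: K_def)
      finally show ?thesis using True K by (simp add: E_def add_increasing)
    next
      case False
      have "F w \<le> \<delta> * (D / sqrt s * exp (l\<^sup>2 * (\<delta>\<^sup>2 + s) - l * (a + r - w)))"
        using l l2 by (intro I) auto
      also have "\<dots> \<le> \<delta> * (D / sqrt s * (exp 1 * E))"
      proof -
        have "l\<^sup>2 * \<delta>\<^sup>2 \<le> 1 * 1" using l2 d by (intro mult_mono) (auto simp: power_le_one)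
        moreover have "l\<^sup>2 * s \<le> l\<^sup>2 * t" using s by (intro mult_left_mono) auto
        moreover have "l * (r / 4) \<le> l * (a + r - w)" using False l by (intro mult_left_mono) auto
        ultimately have "l\<^sup>2 * (\<delta>\<^sup>2 + s) - l * (a + r - w) \<le> 1 + (l\<^sup>2 * t - l * r / 4)"
          by (simp add: distrib_left)
        then show ?thesis
          unfolding E_def exp_add[symmetric] using d D_nonneg s by (intro mult_left_mono) auto
      qed
      also have "\<dots> = K * E" by (simp add: K_def)
      finally show ?thesis using False by simp
    qed
  qed
  define S where "S = walk.survival N a"
  define H where "H = walk.hit L N a"
  have SH: "0 \<le> S" "S \<le> 1" "0 \<le> H" "H \<le> 1"
    using unit_funD[OF walk.unit_fun_survival] unit_funD[OF walk.unit_fun_hit] by (auto simp: S_def H_def)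
  have climb: "(step (law 1) {0<..} ^^ N) (indicat_real {a + 3 * r / 4..}) a \<le> E * H + real N * e"
  proof -
    have "(step (law 1) UNIV ^^ k) (indicat_real {r / 4..}) 0 \<le> E" if "k \<le> N" for k
    proof -
      have "(step (law 1) UNIV ^^ k) (indicat_real {r / 4..}) 0 = measure (law (real k)) {r / 4..}"
        by (simp add: steps_indicator_eq_law atLeast_def)
      also have "\<dots> \<le> exp (real k * l\<^sup>2 - l * (r / 4))"
        using l r by (intro law_tail_bound) auto
      also have "\<dots> \<le> E"
      proof -
        have "real k \<le> t" using that N by linarith
        then have "real k * l\<^sup>2 \<le> t * l\<^sup>2" by (intro mult_right_mono) auto
        then show ?thesis by (simp add: E_def mult.commute)
      qed
      finally show ?thesis .
    qed
    then have "(step (law 1) {0<..} ^^ N) (indicat_real {L + r / 4 + r / 4..}) a \<le> E * H + real N * measure (law 1) {r / 4..}"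
      unfolding H_def using r by (intro walk.steps_climb_bound) (auto simp: L_def)
    \<comment> \<open>The rate 5/8 is the cap imposed on l; its square stays below the 1/2 allowed
      by the interval bound.\<close>
    also have "measure (law 1) {r / 4..} \<le> exp (1 * (5/8)\<^sup>2 - 5/8 * (r / 4))"
      using r by (intro law_tail_bound) auto
    also have "1 * (5/8)\<^sup>2 - 5/8 * (r / 4) = 25/64 - 5 * r / 32" by (simp add: power_divide)
    also have "L + r / 4 + r / 4 = a + 3 * r / 4" by (simp add: L_def)
    finally show ?thesis by (simp add: e_def mult_left_mono)
  qed
  have "(\<integral>\<omega>. stay {0<..} (\<lambda>i. \<eta> i \<omega>) a N * indicat_real {a + r - \<delta><..<a + r + \<delta>} (a + (\<Sum>i<N. \<eta> i \<omega>) + \<eta> N \<omega>) \<partial>M)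
      = (step (law 1) {0<..} ^^ N) F a"
    using W(1) by simp
  also have "\<dots> \<le> (K * E) * (step (law 1) {0<..} ^^ N) (\<lambda>_. 1) a + K * (step (law 1) {0<..} ^^ N) (indicat_real {a + 3 * r / 4..}) a"
    by (rule walk.steps_le_combination[OF F unit_fun_indicator _ F_le]) auto
  also have "\<dots> \<le> (K * E) * S + K * (E * H + real N * e)"
    using climb K by (intro add_mono mult_left_mono) (auto simp: S_def walk.survival_def E_def)
  also have "\<dots> = K * ((S + H) * E + real N * e)" by (simp add: algebra_simps)
  also have "\<dots> \<le> K * ((2 * C\<^sub>s + C\<^sub>h) * min 1 (a / sqrt t) * E + t * e)"
  proof (intro mult_left_mono add_mono mult_right_mono K)
    have "S \<le> C\<^sub>s * a / sqrt (real N)" unfolding S_def by (rule survival_decay[OF a N(1)])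
    also have "\<dots> \<le> C\<^sub>s * a / (sqrt t / 2)"
    proof (rule divide_left_mono)
      have "sqrt t \<le> sqrt (4 * real N)" using N by simp
      then show "sqrt t / 2 \<le> sqrt (real N)" by (simp add: real_sqrt_mult)
    qed (use a C\<^sub>s_ge t_pos N in auto)
    also have "\<dots> = 2 * C\<^sub>s * (a / sqrt t)" by simp
    finally have "S \<le> 2 * C\<^sub>s * min 1 (a / sqrt t)"
      using SH a C\<^sub>s_ge t_pos by (intro min_one_le_scale) auto
    moreover have "H \<le> C\<^sub>h * min 1 (a / sqrt t)"
    proof (rule min_one_le_scale)
      have "H \<le> C\<^sub>h * a / r" unfolding H_def L_def by (rule hit_bound[OF a r])
      also have "\<dots> \<le> C\<^sub>h * a / sqrt t"
      proof (rule divide_left_mono)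
        have "sqrt t \<le> sqrt (r\<^sup>2)" using t by (rule real_sqrt_le_mono)
        then show "sqrt t \<le> r" using r by simp
      qed (use a C\<^sub>h_ge t_pos r in auto)
      finally show "H \<le> C\<^sub>h * (a / sqrt t)" by simp
    qed (use SH C\<^sub>h_ge a t_pos in auto)
    ultimately show "S + H \<le> (2 * C\<^sub>s + C\<^sub>h) * min 1 (a / sqrt t)" by (simp add: distrib_right)
  qed (use N in \<open>auto simp: E_def e_def\<close>)
  finally show ?thesis by (simp add: K_def E_def e_def)
qed

text \<open>The first N increments, the last N (reversed and negated, started near the other end)
  and the middle one are independent. Given all the others, the middle increment hits the required
  interval with probability at most B; the two survival events then factorise.\<close>

lemma two_sided_bound:
  assumes ind: "indep_vars (\<lambda>_. borel) \<eta> {..<Suc (2 * N)}"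
    and unit: "\<And>i. i < Suc (2 * N) \<Longrightarrow> i \<noteq> N \<Longrightarrow> distr M borel (\<eta> i) = law 1" and mid: "distr M borel (\<eta> N) = law s"
    and B: "\<And>w. measure (law s) {w - \<delta><..<w + \<delta>} \<le> B"
  shows "(\<integral>\<omega>. stay {0<..} (\<lambda>i. \<eta> i \<omega>) x N * stay {0<..} (\<lambda>i. - \<eta> (2 * N - i) \<omega>) y N *
      indicat_real {c - \<delta><..<c + \<delta>} (x + (\<Sum>i<Suc (2 * N). \<eta> i \<omega>)) \<partial>M)
    \<le> walk.survival N x * walk.survival N y * B"
proof -
  define I where "I = {..<N} \<union> {N<..<Suc (2 * N)}"
  have I: "I \<subseteq> {..<Suc (2 * N)}" "{..<Suc (2 * N)} = insert N I" "N \<notin> I" "finite I" by (auto simp: I_def)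
  define P where "P J = PiM J (\<lambda>_. borel :: real measure)" for J :: "nat set"
  define A where "A w = stay {0<..} w x N" for w :: "nat \<Rightarrow> real"
  define A' where "A' w = stay {0<..} (\<lambda>i. - w (2 * N - i)) y N" for w :: "nat \<Rightarrow> real"
  have rv: "\<eta> i \<in> borel_measurable M" if "i < Suc (2 * N)" for i
    using ind that by (auto simp: indep_vars_def)
  have Am: "A \<in> borel_measurable (P J)" if "{..<N} \<subseteq> J" for J
    unfolding A_def P_def using that by (intro stay_measurable) auto
  have A'm: "A' \<in> borel_measurable (P J)" if "{N<..<Suc (2 * N)} \<subseteq> J" for J
    unfolding A'_def P_def stay_def
  proof (rule borel_measurable_prod)
    fix k assume k: "k \<in> {1..N}"
    have [measurable]: "(\<lambda>w. \<Sum>i<k. - w (2 * N - i)) \<in> borel_measurable (PiM J (\<lambda>_. borel :: real measure))"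
    proof (intro borel_measurable_sum borel_measurable_uminus measurable_component_singleton)
      fix i assume "i \<in> {..<k}"
      then have "2 * N - i \<in> {N<..<Suc (2 * N)}" using k by auto
      then show "2 * N - i \<in> J" using that by auto
    qed
    show "(\<lambda>w. indicat_real {0<..} (y + (\<Sum>i<k. - w (2 * N - i)))) \<in> borel_measurable (PiM J (\<lambda>_. borel :: real measure))"
      by measurable
  qed
  define \<Theta> where "\<Theta> J \<omega> = restrict (\<lambda>i. \<eta> i \<omega>) J" for J \<omega>
  have Ar: "A (\<Theta> J \<omega>) = A (\<lambda>i. \<eta> i \<omega>)" if "{..<N} \<subseteq> J" for J \<omega>
    unfolding A_def \<Theta>_def using that by (intro stay_cong) auto
  have A'r: "A' (\<Theta> J \<omega>) = A' (\<lambda>i. \<eta> i \<omega>)" if "{N<..<Suc (2 * N)} \<subseteq> J" for J \<omega>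
    unfolding A'_def \<Theta>_def
  proof (rule stay_cong)
    fix i assume "i < N"
    then have "2 * N - i \<in> {N<..<Suc (2 * N)}" by auto
    then show "- restrict (\<lambda>i. \<eta> i \<omega>) J (2 * N - i) = - \<eta> (2 * N - i) \<omega>" using that by auto
  qed
  have AA: "0 \<le> A w" "A w \<le> 1" "0 \<le> A' w" "A' w \<le> 1" for w
    by (auto simp: A_def A'_def stay_bounds)
  define g where "g = (\<lambda>(w, z). A w * A' w * indicat_real {c - \<delta><..<c + \<delta>} (x + ((\<Sum>i\<in>I. w i) + z N)))"
  have iv: "indep_var (P I) (\<Theta> I) (P {N}) (\<Theta> {N})"
    unfolding P_def \<Theta>_def[abs_def] using I by (intro indep_var_restrict[OF ind]) auto
  have [measurable]: "A \<in> borel_measurable (P I)" "A' \<in> borel_measurable (P I)"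
    by (auto intro!: Am A'm simp: I_def)
  have [measurable]: "(\<lambda>w. \<Sum>i\<in>I. w i) \<in> borel_measurable (P I)" "(\<lambda>z. z N) \<in> borel_measurable (P {N})"
    unfolding P_def by (auto intro!: borel_measurable_sum measurable_component_singleton)
  have gm: "g \<in> borel_measurable (P I \<Otimes>\<^sub>M P {N})" unfolding g_def by measurable
  have gb: "0 \<le> g p \<and> g p \<le> 1" for p
    using AA by (cases p) (auto simp: g_def indicator_def intro!: mult_le_one)
  have B0: "0 \<le> B" using B[of 0] measure_nonneg order_trans by blast
  define h where "h \<omega> = A (\<lambda>i. \<eta> i \<omega>) * A' (\<lambda>i. \<eta> i \<omega>)" for \<omega>
  have Am': "(\<lambda>\<omega>. A (\<lambda>i. \<eta> i \<omega>)) \<in> borel_measurable M"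
    using measurable_compose[OF indep_var_rv1[OF iv] \<open>A \<in> borel_measurable (P I)\<close>] by (simp add: Ar I_def)
  have A'm': "(\<lambda>\<omega>. A' (\<lambda>i. \<eta> i \<omega>)) \<in> borel_measurable M"
    using measurable_compose[OF indep_var_rv1[OF iv] \<open>A' \<in> borel_measurable (P I)\<close>] by (simp add: A'r I_def)
  have hm[measurable]: "h \<in> borel_measurable M" unfolding h_def using Am' A'm' by measurable
  have h01: "0 \<le> h \<omega>" "h \<omega> \<le> 1" for \<omega> using AA by (auto simp: h_def intro: mult_le_one)
  have g\<Theta>: "g (\<Theta> I \<omega>, \<Theta> {N} \<omega>') = h \<omega> * indicat_real {c - \<delta><..<c + \<delta>} (x + (\<Sum>i\<in>I. \<eta> i \<omega>) + \<eta> N \<omega>')" for \<omega> \<omega>'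
    by (simp add: g_def h_def Ar A'r I_def) (simp add: \<Theta>_def add.assoc I_def)
  have "(\<integral>\<omega>. stay {0<..} (\<lambda>i. \<eta> i \<omega>) x N * stay {0<..} (\<lambda>i. - \<eta> (2 * N - i) \<omega>) y N *
      indicat_real {c - \<delta><..<c + \<delta>} (x + (\<Sum>i<Suc (2 * N). \<eta> i \<omega>)) \<partial>M) = (\<integral>\<omega>. g (\<Theta> I \<omega>, \<Theta> {N} \<omega>) \<partial>M)"
  proof (rule Bochner_Integration.integral_cong[OF refl])
    fix \<omega>
    have "(\<Sum>i<Suc (2 * N). \<eta> i \<omega>) = (\<Sum>i\<in>I. \<eta> i \<omega>) + \<eta> N \<omega>"
      unfolding I(2) using I(3,4) by simp
    then show "stay {0<..} (\<lambda>i. \<eta> i \<omega>) x N * stay {0<..} (\<lambda>i. - \<eta> (2 * N - i) \<omega>) y N *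
      indicat_real {c - \<delta><..<c + \<delta>} (x + (\<Sum>i<Suc (2 * N). \<eta> i \<omega>)) = g (\<Theta> I \<omega>, \<Theta> {N} \<omega>)"
      unfolding g\<Theta> by (simp only: h_def A_def A'_def add.assoc)
  qed
  also have "\<dots> = (\<integral>\<omega>. (\<integral>\<omega>'. g (\<Theta> I \<omega>, \<Theta> {N} \<omega>') \<partial>M) \<partial>M)"
    by (rule indep_var_decoupling[OF iv gm gb])
  also have "\<dots> \<le> (\<integral>\<omega>. h \<omega> * B \<partial>M)"
  proof (rule integral_mono')
    show "integrable M (\<lambda>\<omega>. h \<omega> * B)"
      using h01 by (intro integrable_mult_left integrable_const_bound[where B=1]) auto
    show "0 \<le> h \<omega> * B" for \<omega> using h01 B0 by simp
    fix \<omega>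
    define w where "w = x + (\<Sum>i\<in>I. \<eta> i \<omega>)"
    have [measurable]: "\<eta> N \<in> borel_measurable M" by (rule rv) simp
    have "(\<integral>\<omega>'. g (\<Theta> I \<omega>, \<Theta> {N} \<omega>') \<partial>M) = h \<omega> * (\<integral>\<omega>'. indicat_real {c - \<delta><..<c + \<delta>} (w + \<eta> N \<omega>') \<partial>M)"
      unfolding g\<Theta> w_def by simp
    also have "(\<integral>\<omega>'. indicat_real {c - \<delta><..<c + \<delta>} (w + \<eta> N \<omega>') \<partial>M) = (\<integral>z. indicat_real {c - \<delta><..<c + \<delta>} (w + z) \<partial>distr M borel (\<eta> N))"
      by (subst integral_distr) auto
    also have "\<dots> \<le> B" unfolding mid law_interval_eq by (rule B)
    finally show "(\<integral>\<omega>'. g (\<Theta> I \<omega>, \<Theta> {N} \<omega>') \<partial>M) \<le> h \<omega> * B"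
      using h01 by (simp add: mult_left_mono)
  qed
  also have "\<dots> = (\<integral>\<omega>. h \<omega> \<partial>M) * B" by simp
  also have "(\<integral>\<omega>. h \<omega> \<partial>M) = walk.survival N x * walk.survival N y"
  proof -
    have iv2: "indep_var (P {..<N}) (\<Theta> {..<N}) (P {N<..<Suc (2 * N)}) (\<Theta> {N<..<Suc (2 * N)})"
      unfolding P_def \<Theta>_def[abs_def] by (intro indep_var_restrict[OF ind]) auto
    have "indep_var borel (A \<circ> \<Theta> {..<N}) borel (A' \<circ> \<Theta> {N<..<Suc (2 * N)})"
      by (intro indep_var_compose[OF iv2] Am A'm) auto
    then have iv3: "indep_var borel (\<lambda>\<omega>. A (\<lambda>i. \<eta> i \<omega>)) borel (\<lambda>\<omega>. A' (\<lambda>i. \<eta> i \<omega>))"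
      by (simp add: comp_def Ar A'r)
    have "(\<integral>\<omega>. h \<omega> \<partial>M) = (\<integral>\<omega>. A (\<lambda>i. \<eta> i \<omega>) \<partial>M) * (\<integral>\<omega>. A' (\<lambda>i. \<eta> i \<omega>) \<partial>M)"
      unfolding h_def using Am' A'm' AA
      by (intro indep_var_lebesgue_integral[OF iv3] integrable_const_bound[where B=1]) auto
    also have "(\<integral>\<omega>. A (\<lambda>i. \<eta> i \<omega>) \<partial>M) = walk.survival N x"
      unfolding A_def walk.survival_def
      by (rule walk.walk_survival[OF prob_space_axioms])
         (auto intro!: unit indep_vars_subset[OF ind])
    also have "(\<integral>\<omega>. A' (\<lambda>i. \<eta> i \<omega>) \<partial>M) = walk.survival N y"
      unfolding A'_def walk.survival_def
    proof (rule walk.walk_survival[OF prob_space_axioms])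
      have "indep_vars (\<lambda>_. borel) (\<lambda>i. \<eta> (2 * N - i)) {..<N}"
        by (intro indep_vars_reindex[OF ind]) (auto simp: inj_on_def)
      from indep_vars_compose2[OF this, of "\<lambda>_. uminus" "\<lambda>_. borel"]
      show "indep_vars (\<lambda>_. borel) (\<lambda>i \<omega>. - \<eta> (2 * N - i) \<omega>) {..<N}" by simp
      fix i assume "i < N"
      then have i: "2 * N - i < Suc (2 * N)" "2 * N - i \<noteq> N" by auto
      have "distr M borel (\<lambda>\<omega>. - \<eta> (2 * N - i) \<omega>) = distr (distr M borel (\<eta> (2 * N - i))) borel uminus"
        using rv[OF i(1)] by (subst distr_distr) (auto simp: comp_def)
      then show "distr M borel (\<lambda>\<omega>. - \<eta> (2 * N - i) \<omega>) = law 1" by (simp add: unit[OF i] law_symmetric)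
    qed simp
    finally show ?thesis .
  qed
  finally show ?thesis .
qed

text \<open>The times 0, 1, ..., K followed by t - L, ..., t - 1, t: K unit steps, one step of
  length t - K - L with index K, then L unit steps. L = 0 serves the forward walk, K = 0 the
  reversed one, K = L the two-sided one.\<close>

definition grid :: "real \<Rightarrow> nat \<Rightarrow> nat \<Rightarrow> nat \<Rightarrow> real" where
  "grid t K L i = (if i \<le> K then real i else t - real L + real (i - Suc K))"

definition incr :: "real \<Rightarrow> nat \<Rightarrow> nat \<Rightarrow> nat \<Rightarrow> 'a \<Rightarrow> real" where
  "incr t K L i \<omega> = X (grid t K L (Suc i)) \<omega> - X (grid t K L i) \<omega>"

lemma incr_props:
  assumes "real K + real L \<le> t"
  shows "indep_vars (\<lambda>_. borel) (incr t K L) {..<Suc (K + L)}"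
    and "\<And>i. i < Suc (K + L) \<Longrightarrow> i \<noteq> K \<Longrightarrow> distr M borel (incr t K L i) = law 1"
    and "distr M borel (incr t K L K) = law (t - real K - real L)"
    and "\<And>i. incr t K L i \<in> borel_measurable M"
    and "\<And>k \<omega>. \<omega> \<in> space M \<Longrightarrow> (\<Sum>i<k. incr t K L i \<omega>) = X (grid t K L k) \<omega>"
    and "\<And>k \<omega>. k \<le> L \<Longrightarrow> (\<Sum>i<k. - incr t K L (K + L - i) \<omega>) = X (t - real k) \<omega> - X t \<omega>"
proof -
  have pos: "0 \<le> grid t K L i" for i using assms by (auto simp: grid_def)
  have mono: "grid t K L i \<le> grid t K L (Suc i)" for i using assms by (auto simp: grid_def)
  show "indep_vars (\<lambda>_. borel) (incr t K L) {..<Suc (K + L)}"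
    using indep_increments[of "grid t K L" "Suc (K + L)"] pos mono by (simp add: incr_def[abs_def])
  have law: "distr M borel (incr t K L i) = law (grid t K L (Suc i) - grid t K L i)" for i
    using increment_law[OF pos mono] by (simp add: incr_def[abs_def])
  show "distr M borel (incr t K L i) = law 1" if "i < Suc (K + L)" "i \<noteq> K" for i
  proof -
    have "grid t K L (Suc i) - grid t K L i = 1" using that by (auto simp: grid_def of_nat_diff)
    then show ?thesis by (simp add: law)
  qed
  show "distr M borel (incr t K L K) = law (t - real K - real L)"
    by (simp add: law grid_def algebra_simps)
  show "incr t K L i \<in> borel_measurable M" for i
    unfolding incr_def[abs_def] using X_measurable[OF pos] by measurable
  show "(\<Sum>i<k. incr t K L i \<omega>) = X (grid t K L k) \<omega>" if "\<omega> \<in> space M" for k \<omega>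
    using that by (induction k) (auto simp: incr_def grid_def X_zero)
  show "(\<Sum>i<k. - incr t K L (K + L - i) \<omega>) = X (t - real k) \<omega> - X t \<omega>" if "k \<le> L" for k \<omega>
    using that
  proof (induction k)
    case (Suc k)
    have g1: "grid t K L (Suc (K + L - k)) = t - real k" using Suc.prems by (auto simp: grid_def of_nat_diff)
    have g2: "grid t K L (K + L - k) = t - real (Suc k)" using Suc.prems by (auto simp: grid_def of_nat_diff)
    have "(\<Sum>i<k. - incr t K L (K + L - i) \<omega>) = X (t - real k) \<omega> - X t \<omega>" using Suc by simp
    then show ?case by (simp only: sum.lessThan_Suc incr_def g1 g2)
  qed simp
qed

end

section \<open>The killed density\<close>

lemma nat_floor_bounds:
  fixes u :: real
  assumes "1 \<le> u"
  shows "1 \<le> nat \<lfloor>u\<rfloor>" "real (nat \<lfloor>u\<rfloor>) \<le> u" "u \<le> 2 * real (nat \<lfloor>u\<rfloor>)"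
proof -
  show 1: "1 \<le> nat \<lfloor>u\<rfloor>" using assms by linarith
  show "real (nat \<lfloor>u\<rfloor>) \<le> u" using assms by linarith
  have "u < real (nat \<lfloor>u\<rfloor>) + 1" by linarith
  moreover have "1 \<le> real (nat \<lfloor>u\<rfloor>)" using 1 by simp
  ultimately show "u \<le> 2 * real (nat \<lfloor>u\<rfloor>)" by simp
qed

locale killed_process = rel_process +
  fixes p :: "real \<Rightarrow> real \<Rightarrow> real \<Rightarrow> real"
  assumes killed: "killed_density M X p"
begin

definition target :: "real \<Rightarrow> real \<Rightarrow> real \<Rightarrow> real \<Rightarrow> 'a set" where
  "target t x y \<delta> = {\<omega>\<in>survive_event M X x t. x + X t \<omega> \<in> {y - \<delta><..<y + \<delta>}}"

lemma target_event:
  assumes "0 < t" "0 < x"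
  shows "target t x y \<delta> \<in> events"
proof -
  have S: "survive_event M X x t \<in> events"
    using killed assms by (simp add: killed_density_def)
  have [measurable]: "X t \<in> borel_measurable M" using assms by (intro X_measurable) simp
  have "target t x y \<delta> = survive_event M X x t \<inter> ((\<lambda>\<omega>. x + X t \<omega>) -` {y - \<delta><..<y + \<delta>} \<inter> space M)"
    by (auto simp: target_def survive_event_def)
  moreover have "(\<lambda>\<omega>. x + X t \<omega>) -` {y - \<delta><..<y + \<delta>} \<inter> space M \<in> events" by measurable
  ultimately show ?thesis using S by auto
qed

lemma targetD:
  assumes "\<omega> \<in> target t x y \<delta>"
  shows "\<omega> \<in> space M" "\<And>s. 0 \<le> s \<Longrightarrow> s \<le> t \<Longrightarrow> 0 < x + X s \<omega>"
    "y - \<delta> < x + X t \<omega>" "x + X t \<omega> < y + \<delta>"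
  using assms by (auto simp: target_def survive_event_def)

text \<open>If p exceeded B at y, continuity would keep it above some b > B near y, and a small
  interval of length 2 \<delta> would carry mass at least 2 \<delta> b. Since B \<ge> 0, this
  contradicts the bound \<delta> B.\<close>

lemma density_le:
  assumes t: "0 < t" and x: "0 < x" and y: "0 < y" and d0: "0 < h"
    and le: "\<And>\<delta>. 0 < \<delta> \<Longrightarrow> \<delta> < h \<Longrightarrow> prob (target t x y \<delta>) \<le> \<delta> * B"
  shows "p t x y \<le> B"
proof (rule ccontr)
  assume "\<not> p t x y \<le> B"
  define b where "b = (B + p t x y) / 2"
  have b: "B < b" "b < p t x y" using \<open>\<not> p t x y \<le> B\<close> by (auto simp: b_def field_simps)
  have "0 \<le> h / 2 * B"
    using le[of "h / 2"] d0 measure_nonneg[of M "target t x y (h / 2)"] by linarith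
  then have B: "0 \<le> B" using d0 by (simp add: zero_le_mult_iff)
  have "continuous_on {0<..} (p t x)" using killed t x by (simp add: killed_density_def)
  then have "continuous (at y) (p t x)"
    using y by (simp add: continuous_on_eq_continuous_at open_greaterThan)
  then have "\<forall>\<^sub>F z in at y. b < p t x z"
    using b(2) by (intro order_tendstoD(1)) (auto simp: continuous_at)
  then obtain e where e: "0 < e" "\<And>z. z \<noteq> y \<Longrightarrow> dist z y < e \<Longrightarrow> b < p t x z"
    unfolding eventually_at by auto
  define \<delta> where "\<delta> = min (h / 2) (min e y)"
  have d: "0 < \<delta>" "\<delta> < h" "\<delta> \<le> e" "\<delta> \<le> y" using d0 e y by (auto simp: \<delta>_def)
  let ?A = "{y - \<delta><..<y + \<delta>}"
  have "ennreal b * emeasure lborel ?A = (\<integral>\<^sup>+ z. ennreal b * indicator ?A z \<partial>lborel)"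
    by (simp add: nn_integral_cmult_indicator)
  also have "\<dots> \<le> (\<integral>\<^sup>+ z\<in>?A. ennreal (p t x z) \<partial>lborel)"
  proof (rule nn_integral_mono)
    fix z
    have "b \<le> p t x z" if "z \<in> ?A"
    proof (cases "z = y")
      case False
      have "\<bar>z - y\<bar> < \<delta>" using that by auto
      then have "dist z y < e" using d by (simp add: dist_real_def)
      then show ?thesis using e(2)[OF False] by simp
    qed (use b in simp)
    then show "ennreal b * indicator ?A z \<le> ennreal (p t x z) * indicator ?A z"
      by (auto simp: indicator_def intro!: ennreal_leI)
  qed
  also have "\<dots> = emeasure M (target t x y \<delta>)"
  proof -
    have K: "\<forall>t>0. \<forall>x>0. \<forall>A\<in>sets borel. A \<subseteq> {0<..} \<longrightarrow>
        emeasure M {\<omega>\<in>survive_event M X x t. x + X t \<omega> \<in> A} = (\<integral>\<^sup>+ y\<in>A. ennreal (p t x y) \<partial>lborel)"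
      using killed by (simp add: killed_density_def)
    have "?A \<subseteq> {0<..}" using d by auto
    then show ?thesis
      using K[rule_format, OF t x, of ?A] by (simp only: target_def) simp
  qed
  also have "\<dots> \<le> ennreal (\<delta> * B)"
    using le[OF d(1,2)] by (simp add: emeasure_eq_measure ennreal_leI)
  finally have "ennreal (b * (2 * \<delta>)) \<le> ennreal (\<delta> * B)"
    using d b B by (simp add: ennreal_mult[symmetric])
  then have "b * (2 * \<delta>) \<le> \<delta> * B" using d B by simp
  then have "2 * b \<le> B" using d by (simp add: mult.commute)
  then show False using b B by simp
qed

lemma target_prob_le:
  assumes "0 < t" "0 < x" and f[measurable]: "f \<in> borel_measurable M"
    and b: "\<And>\<omega>. 0 \<le> f \<omega>" "\<And>\<omega>. f \<omega> \<le> 1" and le: "\<And>\<omega>. \<omega> \<in> target t x y \<delta> \<Longrightarrow> f \<omega> = 1"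
  shows "prob (target t x y \<delta>) \<le> (\<integral>\<omega>. f \<omega> \<partial>M)"
proof -
  have [measurable]: "target t x y \<delta> \<in> events" using assms by (intro target_event)
  have "prob (target t x y \<delta>) = (\<integral>\<omega>. indicator (target t x y \<delta>) \<omega> \<partial>M)"
    by simp
  also have "\<dots> \<le> (\<integral>\<omega>. f \<omega> \<partial>M)"
  proof (rule integral_mono')
    show "integrable M f" by (rule integrable_const_bound[where B=1]) (use b in auto)
    show "indicator (target t x y \<delta>) \<omega> \<le> f \<omega>" for \<omega>
      using le[of \<omega>] b[of \<omega>] by (auto simp: indicator_def)
  qed (use b in auto)
  finally show ?thesis .
qed

lemma target_free_bound:
  assumes t: "0 < t" and x: "0 < x"
  shows "prob (target t x y \<delta>) \<le> measure (law t) {\<bar>x - y\<bar> - \<delta><..<\<bar>x - y\<bar> + \<delta>}"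
proof -
  have [measurable]: "X t \<in> borel_measurable M" using t by (intro X_measurable) simp
  have "prob (target t x y \<delta>) \<le> prob (X t -` {(y - x) - \<delta><..<(y - x) + \<delta>} \<inter> space M)"
  proof (rule finite_measure_mono)
    show "target t x y \<delta> \<subseteq> X t -` {(y - x) - \<delta><..<(y - x) + \<delta>} \<inter> space M"
    proof
      fix \<omega> assume "\<omega> \<in> target t x y \<delta>"
      from targetD(1,3,4)[OF this] show "\<omega> \<in> X t -` {(y - x) - \<delta><..<(y - x) + \<delta>} \<inter> space M" by auto
    qed
  qed measurable
  also have "\<dots> = measure (law t) {(y - x) - \<delta><..<(y - x) + \<delta>}"
    by (subst measure_distr) auto
  also have "\<dots> = measure (law t) {\<bar>x - y\<bar> - \<delta><..<\<bar>x - y\<bar> + \<delta>}"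
  proof (cases "x \<le> y")
    case False
    have "measure (law t) {(y - x) - \<delta><..<(y - x) + \<delta>} = measure (distr (law t) borel uminus) {(y - x) - \<delta><..<(y - x) + \<delta>}"
      using t by (simp add: law_symmetric)
    also have "\<dots> = measure (law t) (uminus -` {(y - x) - \<delta><..<(y - x) + \<delta>} \<inter> space (law t))"
      by (intro measure_distr) auto
    also have "uminus -` {(y - x) - \<delta><..<(y - x) + \<delta>} \<inter> space (law t) = {(x - y) - \<delta><..<(x - y) + \<delta>}"
      by auto
    finally show ?thesis using False by simp
  qed (simp add: abs_if)
  finally show ?thesis .
qed

text \<open>Survival in continuous time implies survival at the integer times. The end point is
  written as x + (y - x) to match the form a + r of \<open>one_sided_bound\<close>.\<close>

lemma target_forward_bound:
  assumes t: "0 < t" and x: "0 < x" and N: "real N \<le> t"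
  shows "prob (target t x y \<delta>) \<le>
    (\<integral>\<omega>. stay {0<..} (\<lambda>i. incr t N 0 i \<omega>) x N *
      indicat_real {x + (y - x) - \<delta><..<x + (y - x) + \<delta>} (x + (\<Sum>i<N. incr t N 0 i \<omega>) + incr t N 0 N \<omega>) \<partial>M)"
    (is "_ \<le> (\<integral>\<omega>. ?f \<omega> \<partial>M)")
proof (rule target_prob_le[OF t x])
  have NL: "real N + real 0 \<le> t" using N by simp
  note P = incr_props[OF NL]
  have [measurable]: "incr t N 0 i \<in> borel_measurable M" for i by (rule P(4))
  have [measurable]: "(\<lambda>\<omega>. stay {0<..} (\<lambda>i. incr t N 0 i \<omega>) x N) \<in> borel_measurable M"
    by (rule stay_process_measurable) (rule P(4), simp)
  show "?f \<in> borel_measurable M"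
    by measurable
  fix \<omega> assume w: "\<omega> \<in> target t x y \<delta>"
  have "x + (\<Sum>i<k. incr t N 0 i \<omega>) \<in> {0<..}" if "k \<in> {1..N}" for k
  proof -
    have "grid t N 0 k = real k" "real k \<le> t" using that N by (auto simp: grid_def)
    then show ?thesis using targetD(2)[OF w, of "real k"] P(5)[OF targetD(1)[OF w]] by simp
  qed
  then have s: "stay {0<..} (\<lambda>i. incr t N 0 i \<omega>) x N = 1" by (simp add: stay_eq)
  have "(\<Sum>i<N. incr t N 0 i \<omega>) + incr t N 0 N \<omega> = X t \<omega>"
    using P(5)[OF targetD(1)[OF w], of "Suc N"] by (simp add: grid_def)
  then show "?f \<omega> = 1"
    using targetD(3,4)[OF w] s by (simp add: add.assoc)
qed (auto simp: stay_bounds indicator_def)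

text \<open>Time reversal: the walk is started near the end point and run backwards.\<close>
lemma target_backward_bound:
  assumes t: "0 < t" and x: "0 < x" and N: "real N \<le> t"
  defines "\<eta> \<equiv> \<lambda>i \<omega>. - incr t 0 N (N - i) \<omega>"
  shows "prob (target t x y \<delta>) \<le>
    (\<integral>\<omega>. stay {0<..} (\<lambda>i. \<eta> i \<omega>) (y + \<delta>) N *
      indicat_real {(y + \<delta>) + (x - y) - \<delta><..<(y + \<delta>) + (x - y) + \<delta>} ((y + \<delta>) + (\<Sum>i<N. \<eta> i \<omega>) + \<eta> N \<omega>) \<partial>M)"
    (is "_ \<le> (\<integral>\<omega>. ?f \<omega> \<partial>M)")
proof (rule target_prob_le[OF t x])
  have NL: "real 0 + real N \<le> t" using N by simp
  note P = incr_props[OF NL]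
  have \<eta>m: "\<eta> i \<in> borel_measurable M" for i unfolding \<eta>_def using P(4) by measurable
  have [measurable]: "(\<lambda>\<omega>. stay {0<..} (\<lambda>i. \<eta> i \<omega>) (y + \<delta>) N) \<in> borel_measurable M"
    by (rule stay_process_measurable) (rule \<eta>m, simp)
  note [measurable] = \<eta>m
  show "?f \<in> borel_measurable M"
    by measurable
  fix \<omega> assume w: "\<omega> \<in> target t x y \<delta>"
  have S: "(\<Sum>i<k. \<eta> i \<omega>) = X (t - real k) \<omega> - X t \<omega>" if "k \<le> N" for k
    unfolding \<eta>_def using P(6)[OF that, of \<omega>] by simp
  \<comment> \<open>Starting at y + \<delta> instead of y absorbs the uncertainty of the end point:
    x + X t < y + \<delta> puts the reversed walk above x + X (t - k), which is positive.\<close>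
  have "(y + \<delta>) + (\<Sum>i<k. \<eta> i \<omega>) \<in> {0<..}" if "k \<in> {1..N}" for k
  proof -
    have "0 \<le> t - real k" using that N by auto
    then show ?thesis using targetD(2)[OF w, of "t - real k"] targetD(4)[OF w] S[of k] that by simp
  qed
  then have s: "stay {0<..} (\<lambda>i. \<eta> i \<omega>) (y + \<delta>) N = 1" by (simp add: stay_eq)
  have "\<eta> N \<omega> = - X (t - real N) \<omega>"
    unfolding \<eta>_def using P(5)[OF targetD(1)[OF w], of 1] by (simp add: grid_def)
  then have "(y + \<delta>) + (\<Sum>i<N. \<eta> i \<omega>) + \<eta> N \<omega> = y + \<delta> - X t \<omega>" using S[of N] by simp
  then show "?f \<omega> = 1"
    using targetD(3,4)[OF w] s by simp
qed (auto simp: stay_bounds indicator_def)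

lemma target_two_sided_bound:
  assumes t: "0 < t" and x: "0 < x" and N: "2 * real N \<le> t"
  shows "prob (target t x y \<delta>) \<le>
    (\<integral>\<omega>. stay {0<..} (\<lambda>i. incr t N N i \<omega>) x N * stay {0<..} (\<lambda>i. - incr t N N (2 * N - i) \<omega>) (y + \<delta>) N *
      indicat_real {y - \<delta><..<y + \<delta>} (x + (\<Sum>i<Suc (2 * N). incr t N N i \<omega>)) \<partial>M)"
    (is "_ \<le> (\<integral>\<omega>. ?f \<omega> \<partial>M)")
proof (rule target_prob_le[OF t x])
  have NL: "real N + real N \<le> t" using N by simp
  note P = incr_props[OF NL]
  have m1[measurable]: "incr t N N i \<in> borel_measurable M" for i by (rule P(4))
  have [measurable]: "(\<lambda>\<omega>. stay {0<..} (\<lambda>i. incr t N N i \<omega>) x N) \<in> borel_measurable M"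
    by (rule stay_process_measurable) (rule m1, simp)
  have [measurable]: "(\<lambda>\<omega>. stay {0<..} (\<lambda>i. - incr t N N (2 * N - i) \<omega>) (y + \<delta>) N) \<in> borel_measurable M"
    by (rule stay_process_measurable) (rule borel_measurable_uminus[OF m1], simp)
  show "?f \<in> borel_measurable M"
    by measurable
  fix \<omega> assume w: "\<omega> \<in> target t x y \<delta>"
  have "x + (\<Sum>i<k. incr t N N i \<omega>) \<in> {0<..}" if "k \<in> {1..N}" for k
  proof -
    have "grid t N N k = real k" "real k \<le> t" using that N by (auto simp: grid_def)
    then show ?thesis using targetD(2)[OF w, of "real k"] P(5)[OF targetD(1)[OF w]] by simp
  qed
  then have s1: "stay {0<..} (\<lambda>i. incr t N N i \<omega>) x N = 1" by (simp add: stay_eq)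
  have "(y + \<delta>) + (\<Sum>i<k. - incr t N N (2 * N - i) \<omega>) \<in> {0<..}" if "k \<in> {1..N}" for k
  proof -
    have "0 \<le> t - real k" using that N by auto
    then show ?thesis
      using targetD(2)[OF w, of "t - real k"] targetD(4)[OF w] P(6)[of k \<omega>] that by (simp add: mult_2)
  qed
  then have s2: "stay {0<..} (\<lambda>i. - incr t N N (2 * N - i) \<omega>) (y + \<delta>) N = 1" by (simp add: stay_eq)
  have "(\<Sum>i<Suc (2 * N). incr t N N i \<omega>) = X (grid t N N (Suc (2 * N))) \<omega>"
    by (rule P(5)[OF targetD(1)[OF w]])
  also have "grid t N N (Suc (2 * N)) = t" by (simp add: grid_def)
  finally have "(\<Sum>i<Suc (2 * N). incr t N N i \<omega>) = X t \<omega>" .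
  then show "?f \<omega> = 1"
    using targetD(3,4)[OF w] s1 s2 by (simp only: mult_1 indicator_simps greaterThanLessThan_iff)
next
  show "0 \<le> ?f \<omega>" for \<omega>
    by (intro mult_nonneg_nonneg stay_bounds) auto
  show "?f \<omega> \<le> 1" for \<omega>
    by (intro mult_le_one mult_nonneg_nonneg stay_bounds) (auto simp: indicator_def)
qed

lemma reversed_incr:
  assumes N: "real N \<le> t"
  shows "indep_vars (\<lambda>_. borel) (\<lambda>i \<omega>. - incr t 0 N (N - i) \<omega>) {..<Suc N}"
    and "\<And>i. i < N \<Longrightarrow> distr M borel (\<lambda>\<omega>. - incr t 0 N (N - i) \<omega>) = law 1"
    and "distr M borel (\<lambda>\<omega>. - incr t 0 N (N - N) \<omega>) = law (t - real N)"
proof -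
  have NL: "real 0 + real N \<le> t" using N by simp
  note P = incr_props[OF NL]
  have neg: "distr M borel (\<lambda>\<omega>. - incr t 0 N i \<omega>) = distr (distr M borel (incr t 0 N i)) borel uminus" for i
    using P(4) by (subst distr_distr) (auto simp: comp_def)
  have "indep_vars (\<lambda>_. borel) (\<lambda>i. incr t 0 N (N - i)) {..<Suc N}"
    by (intro indep_vars_reindex[OF P(1)]) (auto simp: inj_on_def)
  from indep_vars_compose2[OF this, of "\<lambda>_. uminus" "\<lambda>_. borel"]
  show "indep_vars (\<lambda>_. borel) (\<lambda>i \<omega>. - incr t 0 N (N - i) \<omega>) {..<Suc N}" by simp
  show "distr M borel (\<lambda>\<omega>. - incr t 0 N (N - i) \<omega>) = law 1" if "i < N" for i
    using that P(2)[of "N - i"] by (simp add: neg law_symmetric)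
  show "distr M borel (\<lambda>\<omega>. - incr t 0 N (N - N) \<omega>) = law (t - real N)"
    using P(3) N by (simp add: neg law_symmetric)
qed

text \<open>The first 2 comes from sqrt s \<ge> sqrt t / 2, the second from replacing the start a by
  2 min x y, and the last exp 1 covers exp (25/64).\<close>

definition C\<^sub>1 :: real where "C\<^sub>1 = D * exp 1 * 2 * (2 * (2 * C\<^sub>s + C\<^sub>h) + exp 1)"

lemma C\<^sub>1_nonneg: "0 \<le> C\<^sub>1"
  unfolding C\<^sub>1_def using D_nonneg C\<^sub>s_ge C\<^sub>h_ge by (intro mult_nonneg_nonneg) auto

text \<open>The walk is run from the end point nearer to the boundary, forwards if x \<le> y and
  backwards otherwise, so min x y appears. In the backward case the start y + \<delta> is at most 2
  y.\<close>

lemma density_one_sided: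
  assumes x: "1 \<le> x" and y: "1 \<le> y" and r: "1 \<le> \<bar>x - y\<bar>" and t: "2 \<le> t" "t \<le> \<bar>x - y\<bar>\<^sup>2"
    and l: "0 \<le> l" "l \<le> 5/8"
  shows "p t x y \<le> C\<^sub>1 / sqrt t * (min 1 (min x y / sqrt t) * exp (l\<^sup>2 * t - l * \<bar>x - y\<bar> / 4) + t * exp (- (5 * \<bar>x - y\<bar> / 32)))"
proof -
  \<comment> \<open>At most half of the time is spent on unit steps, so the last increment has
    length s \<ge> t / 2 and 1 / sqrt s is comparable to 1 / sqrt t.\<close>
  define N where "N = nat \<lfloor>t / 2\<rfloor>"
  define s where "s = t - real N"
  define R where "R = \<bar>x - y\<bar>"
  define E where "E = exp (l\<^sup>2 * t - l * R / 4)"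
  define e where "e = exp (- (5 * R / 32))"
  define m where "m = min x y"
  have N: "1 \<le> N" "t \<le> 4 * real N" "real N \<le> t" "real N \<le> t / 2"
    using nat_floor_bounds[of "t / 2"] t(1) by (auto simp: N_def[symmetric])
  have s: "1/2 \<le> s" "s \<le> t" "t / 2 \<le> s" using N t by (auto simp: s_def)
  have C: "0 \<le> 2 * C\<^sub>s + C\<^sub>h" using C\<^sub>s_ge C\<^sub>h_ge by simp
  have final: "\<delta> * (D * exp 1 / sqrt s) * ((2 * C\<^sub>s + C\<^sub>h) * min 1 (a / sqrt t) * E + t * exp (25/64 - 5 * R / 32))
      \<le> \<delta> * (C\<^sub>1 / sqrt t * (min 1 (m / sqrt t) * E + t * e))"
    if a: "a \<le> 2 * m" "1 \<le> a" and d: "0 < \<delta>" for a \<delta>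
  proof -
    have m1: "1 \<le> m" using x y by (simp add: m_def)
    have "a / sqrt t \<le> 2 * (m / sqrt t)" using a t by (simp add: divide_right_mono)
    then have "min 1 (a / sqrt t) \<le> 2 * min 1 (m / sqrt t)" by (auto simp: min_def)
    then have 1: "(2 * C\<^sub>s + C\<^sub>h) * min 1 (a / sqrt t) * E \<le> (2 * (2 * C\<^sub>s + C\<^sub>h) + exp 1) * (min 1 (m / sqrt t) * E)"
    proof -
      assume "min 1 (a / sqrt t) \<le> 2 * min 1 (m / sqrt t)"
      then have "(2 * C\<^sub>s + C\<^sub>h) * min 1 (a / sqrt t) \<le> (2 * C\<^sub>s + C\<^sub>h) * (2 * min 1 (m / sqrt t))"
        using C by (intro mult_left_mono) auto
      also have "\<dots> = 2 * (2 * C\<^sub>s + C\<^sub>h) * min 1 (m / sqrt t)" by simp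
      also have "\<dots> \<le> (2 * (2 * C\<^sub>s + C\<^sub>h) + exp 1) * min 1 (m / sqrt t)"
        using m1 t by (intro mult_right_mono) auto
      finally have "(2 * C\<^sub>s + C\<^sub>h) * min 1 (a / sqrt t) * E \<le> (2 * (2 * C\<^sub>s + C\<^sub>h) + exp 1) * min 1 (m / sqrt t) * E"
        by (intro mult_right_mono) (auto simp: E_def)
      then show ?thesis by (simp only: mult.assoc)
    qed
    have "exp (25/64 - 5 * R / 32) \<le> exp 1 * e"
      unfolding e_def exp_add[symmetric] by simp
    also have "\<dots> \<le> (2 * (2 * C\<^sub>s + C\<^sub>h) + exp 1) * e"
      using C by (intro mult_right_mono) (auto simp: e_def)
    finally have "t * exp (25/64 - 5 * R / 32) \<le> t * ((2 * (2 * C\<^sub>s + C\<^sub>h) + exp 1) * e)"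
      using t by (intro mult_left_mono) auto
    with 1 have 2: "(2 * C\<^sub>s + C\<^sub>h) * min 1 (a / sqrt t) * E + t * exp (25/64 - 5 * R / 32)
        \<le> (2 * (2 * C\<^sub>s + C\<^sub>h) + exp 1) * (min 1 (m / sqrt t) * E + t * e)"
      by (simp add: distrib_left mult.left_commute)
    have "sqrt t / 2 \<le> sqrt s"
    proof -
      have "sqrt t \<le> sqrt (4 * s)" using s t by simp
      then show ?thesis by (simp add: real_sqrt_mult)
    qed
    then have "D * exp 1 / sqrt s \<le> D * exp 1 / (sqrt t / 2)"
      using D_nonneg s t by (intro divide_left_mono) auto
    then have 3: "\<delta> * (D * exp 1 / sqrt s) \<le> \<delta> * (D * exp 1 * 2 / sqrt t)"
      using d by (intro mult_left_mono) auto
    have "\<delta> * (D * exp 1 / sqrt s) * ((2 * C\<^sub>s + C\<^sub>h) * min 1 (a / sqrt t) * E + t * exp (25/64 - 5 * R / 32))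
      \<le> \<delta> * (D * exp 1 * 2 / sqrt t) * ((2 * (2 * C\<^sub>s + C\<^sub>h) + exp 1) * (min 1 (m / sqrt t) * E + t * e))"
      by (rule mult_mono[OF 3 2])
         (use d D_nonneg t C a s in \<open>auto simp: E_def intro!: add_nonneg_nonneg mult_nonneg_nonneg divide_nonneg_nonneg\<close>)
    also have "\<dots> = \<delta> * (C\<^sub>1 / sqrt t * (min 1 (m / sqrt t) * E + t * e))"
      by (simp add: C\<^sub>1_def)
    finally show ?thesis .
  qed
  have "p t x y \<le> C\<^sub>1 / sqrt t * (min 1 (m / sqrt t) * E + t * e)"
  proof (rule density_le[where h=1])
    fix \<delta> :: real assume d: "0 < \<delta>" "\<delta> < 1"
    have t0: "0 < t" and x0: "0 < x" using t x by auto
    show "prob (target t x y \<delta>) \<le> \<delta> * (C\<^sub>1 / sqrt t * (min 1 (m / sqrt t) * E + t * e))"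
    proof (cases "x \<le> y")
      case True
      then have R: "y - x = R" by (simp add: R_def)
      have NL: "real N + real 0 \<le> t" using N by simp
      note P = incr_props[OF NL]
      have P3: "distr M borel (incr t N 0 N) = law s" using P(3) by (simp add: s_def)
      have "prob (target t x y \<delta>) \<le> \<delta> * (D * exp 1 / sqrt s) * ((2 * C\<^sub>s + C\<^sub>h) * min 1 (x / sqrt t) * E + t * exp (25/64 - 5 * R / 32))"
        unfolding E_def
        by (rule order_trans[OF target_forward_bound[OF t0 x0 N(3)]], unfold R)
           (rule one_sided_bound; use P(1,2) P3 x r N s t d l in \<open>auto simp: R_def\<close>)
      also have "\<dots> \<le> \<delta> * (C\<^sub>1 / sqrt t * (min 1 (m / sqrt t) * E + t * e))"
        using True x d by (intro final) (auto simp: m_def)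
      finally show ?thesis .
    next
      case False
      then have R: "x - y = R" by (simp add: R_def)
      note P = reversed_incr[OF N(3)]
      have "prob (target t x y \<delta>) \<le> \<delta> * (D * exp 1 / sqrt s) * ((2 * C\<^sub>s + C\<^sub>h) * min 1 ((y + \<delta>) / sqrt t) * E + t * exp (25/64 - 5 * R / 32))"
        unfolding E_def
        by (rule order_trans[OF target_backward_bound[OF t0 x0 N(3)]], unfold R)
           (rule one_sided_bound; use P y r N s t d l in \<open>auto simp: R_def s_def\<close>)
      also have "\<dots> \<le> \<delta> * (C\<^sub>1 / sqrt t * (min 1 (m / sqrt t) * E + t * e))"
        using False y d by (intro final) (auto simp: m_def)
      finally show ?thesis .
    qed
  qed (use t x y in auto)
  then show ?thesis by (simp add: m_def E_def e_def R_def)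
qed

text \<open>24 = 6 * 2 * 2: two factors sqrt 6 from N \<ge> t / 6, one 2 from y + \<delta> \<le> 2 y
  and one from the middle increment. The second summand serves t \<le> 3.\<close>

definition C\<^sub>2 :: real where "C\<^sub>2 = 24 * C\<^sub>s\<^sup>2 * D + 3 * exp 1 * D"

lemma density_free:
  assumes x: "0 < x" and y: "0 < y" and t: "1/2 \<le> t" and l: "0 \<le> l" "l\<^sup>2 \<le> 1/2"
  shows "p t x y \<le> D / sqrt t * exp (l\<^sup>2 * (1 + t) - l * \<bar>x - y\<bar>)"
proof (rule density_le[where h=1])
  fix \<delta> :: real assume d: "0 < \<delta>" "\<delta> < 1"
  have "prob (target t x y \<delta>) \<le> \<delta> * (D / sqrt t * exp (l\<^sup>2 * (\<delta>\<^sup>2 + t) - l * \<bar>x - y\<bar>))"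
    using x t l d by (intro order_trans[OF target_free_bound law_interval_bound]) auto
  also have "\<dots> \<le> \<delta> * (D / sqrt t * exp (l\<^sup>2 * (1 + t) - l * \<bar>x - y\<bar>))"
    using d t D_nonneg by (intro mult_left_mono) (auto intro!: mult_left_mono simp: power_le_one)
  finally show "prob (target t x y \<delta>) \<le> \<delta> * (D / sqrt t * exp (l\<^sup>2 * (1 + t) - l * \<bar>x - y\<bar>))" .
qed (use x y t in auto)

text \<open>The half-width is kept below sqrt t because the smoothing time \<delta>^2 must not
  exceed t.\<close>

lemma density_small_time:
  assumes x: "0 < x" and y: "0 < y" and t: "0 < t" "t \<le> 1" and r: "1 \<le> \<bar>x - y\<bar>"
  shows "p t x y \<le> exp (1/4) * sqrt (4 * pi) * 4096 * t * exp (- \<bar>x - y\<bar> / 2)"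
proof (rule density_le[where h="sqrt t"])
  fix \<delta> :: real assume d: "0 < \<delta>" "\<delta> < sqrt t"
  interpret R: relativistic_law "law t" "\<alpha> / 2" t using t by (intro relativistic_law) simp
  have "\<delta>\<^sup>2 \<le> (sqrt t)\<^sup>2" using d by (intro power_mono) auto
  then have "\<delta>\<^sup>2 \<le> t" using t by simp
  then show "prob (target t x y \<delta>) \<le> \<delta> * (exp (1/4) * sqrt (4 * pi) * 4096 * t * exp (- \<bar>x - y\<bar> / 2))"
    using x t d r by (intro order_trans[OF target_free_bound R.interval_small_time_bound]) auto
qed (use x y t in auto)

text \<open>Time is cut into thirds: floor (t / 3) unit steps at each end give x / sqrt t and y /
  sqrt t, and the middle increment gives 1 / sqrt t. For t \<le> 3 the free bound suffices because x
  y \<ge> 1.\<close>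

lemma density_two_sided:
  assumes x: "1 \<le> x" and y: "1 \<le> y" and t: "1 \<le> t"
  shows "p t x y \<le> C\<^sub>2 * (x * y) / (t * sqrt t)"
proof (cases "t \<le> 3")
  case True
  have "p t x y \<le> D / sqrt t * 1"
    using density_free[of x y t 0] x y t by simp
  also have "\<dots> \<le> D / sqrt t * (exp 1 * 3 * (x * y) / t)"
  proof (intro mult_left_mono)
    have "1 \<le> x * y" using mult_mono[OF x y] x by simp
    moreover have "1 \<le> exp (1::real)" by simp
    ultimately have "1 \<le> exp 1 * (x * y)" by (metis mult_mono mult_1 zero_le_one order_trans)
    then have "t \<le> exp 1 * 3 * (x * y)" using True by simp
    then show "1 \<le> exp 1 * 3 * (x * y) / t" using t by simp
  qed (use D_nonneg t in auto)
  also have "\<dots> = 3 * exp 1 * D * (x * y) / (t * sqrt t)" by (simp add: mult_ac)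
  also have "\<dots> \<le> C\<^sub>2 * (x * y) / (t * sqrt t)"
    unfolding C\<^sub>2_def using D_nonneg x y t by (intro divide_right_mono mult_right_mono) auto
  finally show ?thesis .
next
  case False
  define N where "N = nat \<lfloor>t / 3\<rfloor>"
  define s where "s = t - real N - real N"
  have N: "1 \<le> N" "t \<le> 6 * real N" "real N \<le> t / 3" "2 * real N \<le> t"
    using nat_floor_bounds[of "t / 3"] False by (auto simp: N_def[symmetric])
  have s: "1 \<le> s" "t / 3 \<le> s" using N False by (auto simp: s_def)
  have NL: "real N + real N \<le> t" using N by simp
  note P = incr_props[OF NL]
  have ind: "indep_vars (\<lambda>_. borel) (incr t N N) {..<Suc (2 * N)}" using P(1) by (simp add: mult_2)
  have unit: "distr M borel (incr t N N i) = law 1" if "i < Suc (2 * N)" "i \<noteq> N" for i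
    using P(2)[of i] that by (simp add: mult_2)
  have mid: "distr M borel (incr t N N N) = law s" using P(3) by (simp add: s_def)
  have surv: "walk.survival N z \<le> C\<^sub>s * z * sqrt 6 / sqrt t" if "1 \<le> z" for z
  proof -
    have "walk.survival N z \<le> C\<^sub>s * z / sqrt (real N)" by (rule survival_decay[OF that N(1)])
    also have "\<dots> \<le> C\<^sub>s * z / (sqrt t / sqrt 6)"
    proof (rule divide_left_mono)
      have "sqrt t \<le> sqrt (6 * real N)" using N by simp
      then show "sqrt t / sqrt 6 \<le> sqrt (real N)" by (simp add: real_sqrt_mult divide_le_eq mult.commute)
    qed (use that C\<^sub>s_ge N t in auto)
    finally show ?thesis by simp
  qed
  have "p t x y \<le> 24 * C\<^sub>s\<^sup>2 * D * (x * y) / (t * sqrt t)"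
  proof (rule density_le[where h=1])
    fix \<delta> :: real assume d: "0 < \<delta>" "\<delta> < 1"
    have "measure (law s) {w - \<delta><..<w + \<delta>} \<le> \<delta> * (2 * D / sqrt t)" for w
    proof -
      have "measure (law s) {w - \<delta><..<w + \<delta>} \<le> \<delta> * (D / sqrt s)"
        using law_interval_bound[of s 0 \<delta> w] s d by simp
      also have "\<dots> \<le> \<delta> * (D / (sqrt t / 2))"
      proof (intro mult_left_mono divide_left_mono)
        have "sqrt t \<le> sqrt (4 * s)" using s t by simp
        then show "sqrt t / 2 \<le> sqrt s" by (simp add: real_sqrt_mult)
      qed (use d s t D_nonneg in auto)
      finally show ?thesis by (simp add: mult.commute)
    qed
    then have "prob (target t x y \<delta>) \<le> walk.survival N x * walk.survival N (y + \<delta>) * (\<delta> * (2 * D / sqrt t))"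
      using t x by (intro order_trans[OF target_two_sided_bound[OF _ _ N(4)] two_sided_bound[OF ind unit mid]]) auto
    also have "\<dots> \<le> (C\<^sub>s * x * sqrt 6 / sqrt t) * (C\<^sub>s * (2 * y) * sqrt 6 / sqrt t) * (\<delta> * (2 * D / sqrt t))"
    proof (intro mult_right_mono mult_mono)
      have "walk.survival N (y + \<delta>) \<le> walk.survival N (2 * y)" using d y by (intro walk.survival_incr) simp
      also have "\<dots> \<le> C\<^sub>s * (2 * y) * sqrt 6 / sqrt t" using y by (intro surv) simp
      finally show "walk.survival N (y + \<delta>) \<le> C\<^sub>s * (2 * y) * sqrt 6 / sqrt t" .
    qed (use surv x y d D_nonneg t C\<^sub>s_ge unit_funD[OF walk.unit_fun_survival] in auto)
    also have "\<dots> = \<delta> * (24 * C\<^sub>s\<^sup>2 * D * (x * y) / (t * sqrt t))"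
    proof -
      have "sqrt 6 * sqrt 6 = (6::real)" "sqrt t * sqrt t = t" using t by simp_all
      then have "(C\<^sub>s * x * sqrt 6 / sqrt t) * (C\<^sub>s * (2 * y) * sqrt 6 / sqrt t) = 12 * C\<^sub>s\<^sup>2 * (x * y) / t"
        by (simp add: power2_eq_square)
      then show ?thesis by simp
    qed
    finally show "prob (target t x y \<delta>) \<le> \<delta> * (24 * C\<^sub>s\<^sup>2 * D * (x * y) / (t * sqrt t))" .
  qed (use x y t in auto)
  also have "\<dots> \<le> C\<^sub>2 * (x * y) / (t * sqrt t)"
    unfolding C\<^sub>2_def using D_nonneg x y t by (intro divide_right_mono mult_right_mono) auto
  finally show ?thesis .
qed

lemma C\<^sub>2_nonneg: "0 \<le> C\<^sub>2" unfolding C\<^sub>2_def using D_nonneg by simp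

end

section \<open>The Levy density and the final estimates\<close>

lemma power_le_exp:
  fixes x a :: real
  assumes "0 \<le> x" "0 < a"
  shows "x ^ n \<le> a ^ n * fact n * exp (x / a)"
proof -
  have "(\<Sum>k\<in>{n}. (x / a) ^ k /\<^sub>R fact k) \<le> exp (x / a)"
    unfolding exp_def by (intro sum_le_suminf summable_exp_generic) (use assms in auto)
  then have "(x / a) ^ n / fact n \<le> exp (x / a)" by (simp add: divide_inverse_commute)
  then have "(x / a) ^ n \<le> exp (x / a) * fact n" by (simp add: pos_divide_le_eq)
  then have "a ^ n * (x / a) ^ n \<le> a ^ n * (exp (x / a) * fact n)"
    using assms by (intro mult_left_mono) auto
  moreover have "a ^ n * (x / a) ^ n = x ^ n" using assms by (simp add: power_divide)
  ultimately show ?thesis by (simp add: mult_ac)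
qed

text \<open>Near u = 0 the singularity has order 3/2 + \<alpha>/2 < 3 and is beaten by the Gaussian
  factor: with y = 1 / u, y^3 exp (- z^2 y / 4) is at most 3! (4 / z^2)^3, hence 384.\<close>

lemma levy_integrand_bound:
  assumes \<alpha>: "0 < \<alpha>" "\<alpha> < 2" and z: "z \<noteq> 0" and u: "0 < u"
  shows "exp (- u) * gker u z * u powr (-1 - \<alpha> / 2) \<le> (1 + 384 / (z\<^sup>2) ^ 3) * exp (- u)"
proof -
  define y where "y = 1 / u"
  have y: "0 < y" using u by (simp add: y_def)
  have z2: "0 < z\<^sup>2" using z by simp
  have "(4 * pi * u) powr (-1/2) \<le> u powr (-1/2)"
    using u pi_gt3 by (intro powr_mono2') auto
  then have "gker u z \<le> u powr (-1/2) * exp (- (z\<^sup>2 * y / 4))"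
  proof -
    assume le: "(4 * pi * u) powr (-1/2) \<le> u powr (-1/2)"
    have e: "- (z\<^sup>2 * y / 4) = - (z\<^sup>2) / (4 * u)" by (simp add: y_def)
    show ?thesis unfolding gker_def e by (rule mult_right_mono[OF le]) simp
  qed
  then have "gker u z * u powr (-1 - \<alpha> / 2) \<le> u powr (-1/2) * exp (- (z\<^sup>2 * y / 4)) * u powr (-1 - \<alpha> / 2)"
    by (intro mult_right_mono) auto
  also have "\<dots> = (u powr (-1/2) * u powr (-1 - \<alpha> / 2)) * exp (- (z\<^sup>2 * y / 4))" by (simp only: mult_ac)
  also have "u powr (-1/2) * u powr (-1 - \<alpha> / 2) = u powr (- (3/2 + \<alpha> / 2))"
    by (simp add: powr_add[symmetric])
  also have "\<dots> = y powr (3/2 + \<alpha> / 2)"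
    unfolding powr_minus using u by (simp add: y_def powr_divide inverse_eq_divide)
  also have "\<dots> \<le> 1 + y ^ 3"
  proof (cases "y \<le> 1")
    case True
    then have "y powr (3/2 + \<alpha> / 2) \<le> 1" using y \<alpha> by (intro powr_le1) auto
    then show ?thesis using y by (simp add: add_increasing2)
  next
    case False
    then have "y powr (3/2 + \<alpha> / 2) \<le> y powr (real 3)" using \<alpha> by (intro powr_mono) auto
    also have "\<dots> = y ^ 3" using y by (simp only: powr_realpow)
    finally show ?thesis by simp
  qed
  also have "(1 + y ^ 3) * exp (- (z\<^sup>2 * y / 4)) \<le> 1 + 384 / (z\<^sup>2) ^ 3"
  proof -
    define q where "q = 4 / z\<^sup>2"
    have q: "0 < q" "z\<^sup>2 * y / 4 = y / q" using z2 by (simp_all add: q_def)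
    have "y ^ 3 \<le> q ^ 3 * fact 3 * exp (y / q)" using y q by (intro power_le_exp) auto
    then have "y ^ 3 * exp (- (y / q)) \<le> q ^ 3 * fact 3 * exp (y / q) * exp (- (y / q))"
      by (intro mult_right_mono) auto
    also have "\<dots> = q ^ 3 * fact 3 * (exp (y / q) * exp (- (y / q)))" by simp
    also have "exp (y / q) * exp (- (y / q)) = 1" by (simp add: exp_add[symmetric])
    also have "q ^ 3 * fact 3 * 1 = 384 / (z\<^sup>2) ^ 3"
      by (simp add: q_def power_divide eval_nat_numeral)
    finally have "y ^ 3 * exp (- (y / q)) \<le> 384 / (z\<^sup>2) ^ 3" .
    moreover have "exp (- (y / q)) \<le> 1" using y q by simp
    ultimately show ?thesis unfolding q(2) distrib_right mult_1 by (intro add_mono)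
  qed
  finally have "gker u z * u powr (-1 - \<alpha> / 2) \<le> 1 + 384 / (z\<^sup>2) ^ 3"
    by (simp add: mult_right_mono)
  then have "exp (- u) * (gker u z * u powr (-1 - \<alpha> / 2)) \<le> exp (- u) * (1 + 384 / (z\<^sup>2) ^ 3)"
    by (intro mult_left_mono) auto
  then show ?thesis by (simp only: mult_ac)
qed

lemma exp_set_integrable: "set_integrable lborel {0<..} (\<lambda>u::real. exp (- u))"
proof -
  interpret prob_space "density lborel (exponential_density 1)"
    by (rule prob_space_exponential_density) simp
  have "(\<integral>\<^sup>+ u. ennreal (exponential_density 1 u) \<partial>lborel) = 1"
    using emeasure_space_1 by (simp add: emeasure_density)
  then have "integrable lborel (exponential_density 1)"
    by (intro integrableI_nonneg) (auto simp: exponential_density_def)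
  then have "set_integrable lborel {0<..} (exponential_density 1)"
    unfolding set_integrable_def by (intro integrable_mult_indicator) auto
  then show ?thesis
    by (rule set_integrable_bound) (auto simp: exponential_density_def set_borel_measurable_def)
qed

text \<open>Needed for the lower bound: the integral of a non-integrable function would default to
  0.\<close>

lemma levy_integrand_integrable:
  assumes "0 < \<alpha>" "\<alpha> < 2" "z \<noteq> 0"
  shows "set_integrable lborel {0<..} (\<lambda>u. exp (- u) * gker u z * u powr (-1 - \<alpha> / 2))"
proof (rule set_integrable_bound)
  show "set_integrable lborel {0<..} (\<lambda>u. (1 + 384 / (z\<^sup>2) ^ 3) * exp (- u))"
    using exp_set_integrable by simp
  show "set_borel_measurable lborel {0<..} (\<lambda>u. exp (- u) * gker u z * u powr (-1 - \<alpha> / 2))"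
    unfolding set_borel_measurable_def gker_def by measurable
  show "AE u in lborel. u \<in> {0<..} \<longrightarrow> norm (exp (- u) * gker u z * u powr (-1 - \<alpha> / 2)) \<le> norm ((1 + 384 / (z\<^sup>2) ^ 3) * exp (- u))"
  proof (intro AE_I2 impI)
    fix u :: real assume "u \<in> {0<..}"
    then have "0 < u" by simp
    moreover have "0 \<le> exp (- u) * gker u z * u powr (-1 - \<alpha> / 2)" by (simp add: gker_nonneg)
    moreover have "0 \<le> (1 + 384 / (z\<^sup>2) ^ 3) * exp (- u)" by simp
    ultimately show "norm (exp (- u) * gker u z * u powr (-1 - \<alpha> / 2)) \<le> norm ((1 + 384 / (z\<^sup>2) ^ 3) * exp (- u))"
      using levy_integrand_bound[OF assms, of u] by simp
  qed
qed

text \<open>Only u between z / 2 and z is kept, where the exponent u + z^2 / (4 u) is at most 5 z /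
  4. The remaining power of z, of exponent -(1/2 + \<alpha>/2), is paid by a further exp (- z / 4),
  which makes the rate 3/2.\<close>

lemma levy_integral_lower:
  assumes \<alpha>: "0 < \<alpha>" "\<alpha> < 2" and z: "0 < z"
  shows "(1 / 64) * (4 * pi) powr (-1/2) * exp (- (3 * z / 2)) \<le>
    (LBINT u:{0<..}. exp (- u) * gker u z * u powr (-1 - \<alpha> / 2))"
proof -
  define f where "f u = exp (- u) * gker u z * u powr (-1 - \<alpha> / 2)" for u
  define k where "k = (4 * pi) powr (-1/2) * exp (- (5 * z / 4)) * z powr (- (3/2 + \<alpha> / 2))"
  have fk: "k \<le> f u" if u: "u \<in> {z / 2..z}" for u
  proof -
    have u0: "0 < u" using u z by auto
    \<comment> \<open>This product equals u^2 + z^2 / 4 - 5 z u / 4; its sign is the bound on the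
      exponent after division by u.\<close>
    have "(u - z) * (u - z / 4) \<le> 0" using u z by (intro mult_nonpos_nonneg) auto
    moreover have "(u - z) * (u - z / 4) = u * u + z\<^sup>2 / 4 - 5 * z / 4 * u"
      by (simp add: power2_eq_square field_simps)
    ultimately have "u * u + z\<^sup>2 / 4 \<le> 5 * z / 4 * u" by simp
    then have "(u * u + z\<^sup>2 / 4) / u \<le> 5 * z / 4" using u0 by (simp add: pos_divide_le_eq)
    moreover have "(u * u + z\<^sup>2 / 4) / u = u + z\<^sup>2 / (4 * u)" using u0 by (simp add: add_divide_distrib)
    ultimately have 1: "exp (- (5 * z / 4)) \<le> exp (- u) * exp (- (z\<^sup>2) / (4 * u))"
      unfolding exp_add[symmetric] by simp
    have 2: "z powr (- (3/2 + \<alpha> / 2)) \<le> u powr (- (3/2 + \<alpha> / 2))"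
      using u u0 \<alpha> by (intro powr_mono2') auto
    have "k \<le> (4 * pi) powr (-1/2) * (exp (- u) * exp (- (z\<^sup>2) / (4 * u))) * u powr (- (3/2 + \<alpha> / 2))"
      unfolding k_def using 1 2 by (intro mult_mono) auto
    also have "u powr (- (3/2 + \<alpha> / 2)) = u powr (-1/2) * u powr (-1 - \<alpha> / 2)"
      by (simp add: powr_add[symmetric])
    also have "(4 * pi) powr (-1/2) * (exp (- u) * exp (- (z\<^sup>2) / (4 * u))) * (u powr (-1/2) * u powr (-1 - \<alpha> / 2)) =
       exp (- u) * (((4 * pi) powr (-1/2) * u powr (-1/2)) * exp (- (z\<^sup>2) / (4 * u))) * u powr (-1 - \<alpha> / 2)"
      by (simp only: mult_ac)
    also have "(4 * pi) powr (-1/2) * u powr (-1/2) = (4 * pi * u) powr (-1/2)"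
      using u0 by (simp add: powr_mult)
    finally show ?thesis by (simp only: f_def gker_def)
  qed
  have f: "set_integrable lborel {0<..} f"
    unfolding f_def using levy_integrand_integrable[OF \<alpha>] z by simp
  have f0: "0 \<le> f u" for u by (simp add: f_def gker_nonneg)
  have "(z / 2) * k = (\<integral>u. indicator {z / 2..z} u *\<^sub>R k \<partial>lborel)" using z by simp
  also have "\<dots> \<le> (\<integral>u. indicator {0<..} u *\<^sub>R f u \<partial>lborel)"
  proof (rule integral_mono)
    show "integrable lborel (\<lambda>u. indicat_real {z / 2..z} u *\<^sub>R k)"
      using z by (intro integrable_scaleR_left integrable_real_indicator) auto
    show "integrable lborel (\<lambda>u. indicat_real {0<..} u *\<^sub>R f u)" using f by (simp add: set_integrable_def)
    show "indicat_real {z / 2..z} u *\<^sub>R k \<le> indicat_real {0<..} u *\<^sub>R f u" for u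
      using fk[of u] f0[of u] z by (auto simp: indicator_def)
  qed
  finally have lb: "(z / 2) * k \<le> (LBINT u:{0<..}. f u)" by (simp add: set_lebesgue_integral_def)
  have "(1/64) * (4 * pi) powr (-1/2) * exp (- (3 * z / 2)) \<le> (z / 2) * k"
  proof -
    define y where "y = z powr (1/2 + \<alpha> / 2)"
    have y: "0 < y" using z by (simp add: y_def)
    have "y \<le> 1 + z\<^sup>2"
    proof (cases "z \<le> 1")
      case True
      then have "y \<le> 1" unfolding y_def using z \<alpha> by (intro powr_le1) auto
      then show ?thesis using zero_le_power2[of z] by linarith
    next
      case False
      then have "y \<le> z powr 2" unfolding y_def using \<alpha> by (intro powr_mono) auto
      then show ?thesis using z by simp
    qed
    also have "1 + z\<^sup>2 \<le> 32 * exp (z / 4)"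
    proof -
      have "1 + z / 4 + (z / 4)\<^sup>2 / 2 \<le> exp (z / 4)"
        using exp_lower_Taylor_quadratic[of "z / 4"] z by simp
      then have "32 * (1 + z / 4 + (z / 4)\<^sup>2 / 2) \<le> 32 * exp (z / 4)" by simp
      moreover have "1 + z\<^sup>2 \<le> 32 * (1 + z / 4 + (z / 4)\<^sup>2 / 2)"
        using z by (simp add: power_divide distrib_left)
      ultimately show ?thesis by linarith
    qed
    finally have yb: "y \<le> 32 * exp (z / 4)" .
    have "exp (- (3 * z / 2)) * y \<le> exp (- (3 * z / 2)) * (32 * exp (z / 4))"
      using yb by (intro mult_left_mono) auto
    also have "\<dots> = 32 * exp (- (5 * z / 4))"
    proof -
      have "exp (- (3 * z / 2)) * exp (z / 4) = exp (- (5 * z / 4))" unfolding exp_add[symmetric] by simp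
      then show ?thesis by simp
    qed
    finally have "exp (- (3 * z / 2)) \<le> 32 * exp (- (5 * z / 4)) / y" using y by (simp add: pos_le_divide_eq)
    then have "(1/64) * (4 * pi) powr (-1/2) * exp (- (3 * z / 2)) \<le> (1/64) * (4 * pi) powr (-1/2) * (32 * exp (- (5 * z / 4)) / y)"
      by (intro mult_left_mono) auto
    also have "\<dots> = (1/2) * ((4 * pi) powr (-1/2) * exp (- (5 * z / 4)) * (1 / y))" by simp
    also have "1 / y = z * z powr (- (3/2 + \<alpha> / 2))"
    proof -
      have "1 / y = z powr (- (1/2 + \<alpha> / 2))" by (simp only: y_def powr_minus inverse_eq_divide)
      also have "\<dots> = z powr (1 + - (3/2 + \<alpha> / 2))" by (rule arg_cong[where f="\<lambda>e. z powr e"]) simp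
      also have "\<dots> = z powr 1 * z powr (- (3/2 + \<alpha> / 2))" by (rule powr_add)
      finally show ?thesis using z by simp
    qed
    finally show ?thesis by (simp add: k_def mult_ac)
  qed
  from order_trans[OF this lb] show ?thesis by (simp only: f_def)
qed

lemma levy_nu_minus: "levy_nu \<alpha> (- z) = levy_nu \<alpha> z"
  by (simp add: levy_nu_def gker_minus)

text \<open>Trades the rate 3 c / 2 at c = 1 / (8 sqrt 2) for the rational 2/15; the two compare
  because sqrt 2 \<ge> 45/32.\<close>

lemma levy_nu_lower:
  assumes \<alpha>: "0 < \<alpha>" "\<alpha> < 2"
  obtains k where "0 < k" "\<And>z. z \<noteq> 0 \<Longrightarrow> k * exp (- (2 * \<bar>z\<bar> / 15)) \<le> levy_nu \<alpha> ((1 / (8 * sqrt 2)) * z)"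
proof
  define A where "A = \<alpha> / (2 * Gamma (1 - \<alpha> / 2))"
  have A: "0 < A" unfolding A_def using \<alpha> by (intro divide_pos_pos mult_pos_pos Gamma_real_pos) auto
  define k where "k = A * ((1 / 64) * (4 * pi) powr (-1/2))"
  show "0 < k" using A by (simp add: k_def)
  fix z :: real assume z: "z \<noteq> 0"
  define c where "c = 1 / (8 * sqrt (2::real))"
  have c: "0 < c" by (simp add: c_def)
  have sym: "levy_nu \<alpha> (c * z) = levy_nu \<alpha> (c * \<bar>z\<bar>)"
    using levy_nu_minus[of \<alpha> "c * z"] by (auto simp: abs_if)
  have "k * exp (- (2 * \<bar>z\<bar> / 15)) \<le> k * exp (- (3 * (c * \<bar>z\<bar>) / 2))"
  proof -
    have "(45/32)\<^sup>2 \<le> (2::real)" by (simp add: power_divide)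
    then have "45/32 \<le> sqrt (2::real)" by (rule real_le_rsqrt)
    then have "3 * c / 2 \<le> 2/15" by (simp add: c_def divide_simps)
    then have "3 * c / 2 * \<bar>z\<bar> \<le> 2/15 * \<bar>z\<bar>" by (intro mult_right_mono) auto
    then show ?thesis using \<open>0 < k\<close> by simp
  qed
  also have "\<dots> \<le> levy_nu \<alpha> (c * \<bar>z\<bar>)"
    unfolding levy_nu_def A_def[symmetric] k_def mult.assoc[of A]
    using levy_integral_lower[OF \<alpha>, of "c * \<bar>z\<bar>"] A c z by (intro mult_left_mono) auto
  finally show "k * exp (- (2 * \<bar>z\<bar> / 15)) \<le> levy_nu \<alpha> ((1 / (8 * sqrt 2)) * z)"
    unfolding sym[symmetric] by (simp only: c_def)
qed

text \<open>The gap 35/256 - 2/15 = 13/3840 between the rates absorbs the factor r, and 296 exceeds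
  3840/13.\<close>

lemma mult_exp_le:
  fixes r \<kappa> :: real
  assumes "35/256 \<le> \<kappa>" "0 \<le> r"
  shows "r * exp (- (\<kappa> * r)) \<le> 296 * exp (- (2 * r / 15))"
proof -
  have "r \<le> 296 * (1 + 13 * r / 3840)" using assms by simp
  also have "\<dots> \<le> 296 * exp (13 * r / 3840)" using exp_ge_add_one_self[of "13 * r / 3840"] by (intro mult_left_mono) auto
  finally have "r * exp (- (35/256 * r)) \<le> 296 * exp (13 * r / 3840) * exp (- (35/256 * r))"
    by (intro mult_right_mono) auto
  also have "\<dots> = 296 * exp (- (2 * r / 15))"
    unfolding mult.assoc exp_add[symmetric] by simp
  finally have "r * exp (- (35/256 * r)) \<le> 296 * exp (- (2 * r / 15))" .
  moreover have "r * exp (- (\<kappa> * r)) \<le> r * exp (- (35/256 * r))"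
    using mult_right_mono[OF assms] assms by (intro mult_left_mono) auto
  ultimately show ?thesis by linarith
qed

text \<open>The thresholds are tuned to \<open>c = 1 / (8 * sqrt 2)\<close>: after losing a factor \<open>r / sqrt t\<close> the two
  exponents must still beat \<open>r\<^sup>2 / (512 * t)\<close>, the exponent of \<open>gker t (c * r)\<close>, and \<open>2 * r / 15\<close>, which
  exceeds the decay rate \<open>3 * c * r / 2\<close> of the lower bound for the Levy density at \<open>c * r\<close>.\<close>
lemma chernoff_choice:
  fixes r t :: real
  assumes r: "0 < r" and t: "0 < t"
  obtains l where "0 \<le> l" "l \<le> 5/8"
    "exp (l\<^sup>2 * t - l * r / 4) \<le> exp (- (7 * r\<^sup>2 / (1024 * t))) + exp (- (35/256 * r))"
proof (cases "r / 20 \<le> t")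
  case True
  \<comment> \<open>The minimiser of the exponent is r / (8 t); a quarter of it respects the cap 5/8
    down to t = r / 20 and still gives 8/1024 - 1/1024 = 7/1024, more than the required
    2/1024.\<close>
  show ?thesis
  proof (rule that[of "r / (32 * t)"])
    show "0 \<le> r / (32 * t)" using r t by simp
    show "r / (32 * t) \<le> 5/8" using True t by (simp add: divide_le_eq)
    have "(r / (32 * t))\<^sup>2 * t - r / (32 * t) * r / 4 = - (7 * r\<^sup>2 / (1024 * t))"
      using t by (simp add: power2_eq_square field_simps)
    then show "exp ((r / (32 * t))\<^sup>2 * t - r / (32 * t) * r / 4) \<le> exp (- (7 * r\<^sup>2 / (1024 * t))) + exp (- (35/256 * r))"
      by simp
  qed
next
  case False
  show ?thesis
  proof (rule that[of "5/8"])
    \<comment> \<open>For t below r / 20 the quadratic term is at most 5 r / 256, and 5/32 - 5/256 =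
      35/256.\<close>
    have "(5/8)\<^sup>2 * t - 5/8 * r / 4 \<le> - (35/256 * r)" using False by (simp add: power2_eq_square)
    then show "exp ((5/8)\<^sup>2 * t - 5/8 * r / 4) \<le> exp (- (7 * r\<^sup>2 / (1024 * t))) + exp (- (35/256 * r))"
      by (simp add: add_increasing)
  qed auto
qed

text \<open>Pays for the factor v = r / sqrt t: the gap 7/1024 - 2/1024 = 5/1024 gives the constant,
  as 205 exceeds 1024/5.\<close>

lemma gaussian_gain:
  fixes v :: real
  assumes "0 \<le> v"
  shows "v * exp (- (7 * v\<^sup>2 / 1024)) \<le> 205 * exp (- (v\<^sup>2 / 512))"
proof -
  have v1: "v \<le> 1 + v\<^sup>2"
  proof -
    have "0 \<le> (v - 1/2)\<^sup>2" by simp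
    then show ?thesis by (simp add: power2_eq_square algebra_simps)
  qed
  have "1 + w \<le> 205 * (1 + 5 * w / 1024)" if "0 \<le> w" for w :: real using that by simp
  then have "1 + v\<^sup>2 \<le> 205 * (1 + 5 * v\<^sup>2 / 1024)" using zero_le_power2 by blast
  with v1 have "v \<le> 205 * (1 + 5 * v\<^sup>2 / 1024)" by (rule order_trans)
  also have "\<dots> \<le> 205 * exp (5 * v\<^sup>2 / 1024)" using exp_ge_add_one_self[of "5 * v\<^sup>2 / 1024"] by (intro mult_left_mono) auto
  finally have "v * exp (- (7 * v\<^sup>2 / 1024)) \<le> 205 * exp (5 * v\<^sup>2 / 1024) * exp (- (7 * v\<^sup>2 / 1024))"
    by (intro mult_right_mono) auto
  also have "\<dots> = 205 * exp (- (v\<^sup>2 / 512))" unfolding mult.assoc exp_add[symmetric] by simp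
  finally show ?thesis .
qed

lemma gker_scaled:
  assumes t: "0 < t"
  shows "gker t ((1 / (8 * sqrt 2)) * z) = exp (- ((\<bar>z\<bar> / sqrt t)\<^sup>2 / 512)) / (sqrt (4 * pi) * sqrt t)"
proof -
  have m: "(-1/2 :: real) = - (1/2)" by simp
  have "(4 * pi * t) powr (-1/2) = 1 / (sqrt (4 * pi) * sqrt t)"
    unfolding m powr_minus using t
    by (subst powr_half_sqrt) (simp_all add: inverse_eq_divide real_sqrt_mult)
  moreover have "((1 / (8 * sqrt 2)) * z)\<^sup>2 / (4 * t) = (\<bar>z\<bar> / sqrt t)\<^sup>2 / 512"
    using t by (simp add: power_mult_distrib power_divide)
  ultimately show ?thesis by (simp add: gker_def)
qed

section \<open>Pointwise upper bound in all time regimes\<close>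

context killed_process
begin

text \<open>One summand for each regime: t \<ge> 2, t between 1/2 and 2, and t \<le> 1/2.\<close>

definition C\<^sub>0 :: real where
  "C\<^sub>0 = C\<^sub>1 * (205 * sqrt (4 * pi) + 592) + 4 * D * exp 2 * 296 + exp (1/4) * sqrt (4 * pi) * 4096 * 296"

lemma C\<^sub>0_nonneg: "0 \<le> C\<^sub>0"
  unfolding C\<^sub>0_def using C\<^sub>1_nonneg D_nonneg by (intro add_nonneg_nonneg mult_nonneg_nonneg) auto

text \<open>The Levy density is represented here by its exponential minorant, which also serves the
  time integral. Large times use \<open>density_one_sided\<close> with the l of
  \<open>chernoff_choice\<close>; the other two regimes use free bounds, whose decay in R already
  dominates W.\<close>

lemma density_upper_bound:
  assumes x: "1 \<le> x" and y: "1 \<le> y" and r: "1 \<le> \<bar>x - y\<bar>" and t: "0 < t" "t \<le> \<bar>x - y\<bar>\<^sup>2"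
  shows "p t x y \<le> C\<^sub>0 * min (x * y / \<bar>x - y\<bar>\<^sup>2) 1 *
    (gker t ((1 / (8 * sqrt 2)) * (x - y)) + t * exp (- (2 * \<bar>x - y\<bar> / 15)))"
proof -
  define R where "R = \<bar>x - y\<bar>"
  define W where "W = min (x * y / R\<^sup>2) 1"
  define G where "G = gker t ((1 / (8 * sqrt 2)) * (x - y))"
  define e where "e = exp (- (2 * R / 15))"
  define m where "m = min x y"
  have R: "1 \<le> R" "t \<le> R\<^sup>2" using r t by (auto simp: R_def)
  have m: "1 \<le> m" using x y by (simp add: m_def)
  have G0: "0 \<le> G" by (simp add: G_def gker_nonneg)
  \<comment> \<open>R is below max x y, and m times max x y is x y.\<close>
  have xy: "m * R \<le> x * y"
  proof (cases "x \<le> y")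
    case True
    then show ?thesis using x by (auto simp: m_def R_def intro!: mult_left_mono)
  next
    case False
    then have "y * R \<le> y * x" using y by (intro mult_left_mono) (auto simp: R_def)
    then show ?thesis using False by (simp add: m_def mult.commute)
  qed
  have mW: "min (m / R) 1 \<le> W"
  proof -
    have "m / R = m * R / R\<^sup>2" using R by (simp add: power2_eq_square)
    also have "\<dots> \<le> x * y / R\<^sup>2" using xy by (intro divide_right_mono) auto
    finally show ?thesis by (auto simp: W_def)
  qed
  \<comment> \<open>W is never below 1 / R, so an exponential in R can produce the prefactor W at
    the price of one factor R.\<close>
  have RW: "1 \<le> R * W"
  proof -
    have "1 / R \<le> min (m / R) 1" using m R by (simp add: divide_right_mono)
    then have "1 / R \<le> W" using mW by linarith
    then show ?thesis using R by (simp add: divide_le_eq mult.commute)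
  qed
  have W0: "0 \<le> W" using RW R by (smt (verit) mult_nonneg_nonpos)
  have expW: "exp (- (\<kappa> * R)) \<le> 296 * W * e" if "35/256 \<le> \<kappa>" for \<kappa>
  proof -
    have "1 * exp (- (\<kappa> * R)) \<le> (R * W) * exp (- (\<kappa> * R))" using RW by (intro mult_right_mono) auto
    also have "\<dots> = W * (R * exp (- (\<kappa> * R)))" by simp
    also have "\<dots> \<le> W * (296 * e)" unfolding e_def using that R W0 by (intro mult_left_mono mult_exp_le) auto
    finally show ?thesis by simp
  qed
  have e0: "0 \<le> e" by (simp add: e_def)
  have "p t x y \<le> C\<^sub>0 * (W * (G + t * e))"
  proof -
    consider "2 \<le> t" | "1/2 \<le> t" "t \<le> 2" | "t \<le> 1/2" by linarith
    then show ?thesis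
    proof cases
      case 1
      obtain l where l: "0 \<le> l" "l \<le> 5/8"
        and E: "exp (l\<^sup>2 * t - l * R / 4) \<le> exp (- (7 * R\<^sup>2 / (1024 * t))) + exp (- (35/256 * R))"
        using chernoff_choice[of R t] R t by auto
      define v where "v = R / sqrt t"
      have st: "0 < sqrt t" using t by simp
      have v: "1 \<le> v"
      proof -
        have "sqrt t \<le> sqrt (R\<^sup>2)" using R(2) by (rule real_sqrt_le_mono)
        then show ?thesis using R st by (simp add: v_def)
      qed
      \<comment> \<open>Passing from sqrt t to R in the boundary factor costs v = R / sqrt t \<ge>
        1, to be absorbed by \<open>gaussian_gain\<close> or \<open>mult_exp_le\<close>.\<close>
      have mv: "min 1 (m / sqrt t) \<le> v * W"
      proof -
        have e1: "m / sqrt t = v * (m / R)" using R by (simp add: v_def)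
        have "min 1 (v * q) \<le> v * min q 1" for q
        proof (cases "q \<le> 1")
          case False
          have "min 1 (v * q) \<le> 1" by simp
          also have "1 \<le> v * min q 1" using False v by (simp add: min_absorb2)
          finally show ?thesis .
        qed (simp add: min_absorb1)
        then have "min 1 (v * (m / R)) \<le> v * min (m / R) 1" .
        also have "\<dots> \<le> v * W" using mW v by (intro mult_left_mono) auto
        finally show ?thesis unfolding e1 .
      qed
      have part1: "1 / sqrt t * (v * W * exp (- (7 * R\<^sup>2 / (1024 * t)))) \<le> 205 * sqrt (4 * pi) * (W * G)"
      proof -
        have v2: "7 * R\<^sup>2 / (1024 * t) = 7 * v\<^sup>2 / 1024" using t by (simp add: v_def power_divide)
        have "1 / sqrt t * (v * W * exp (- (7 * R\<^sup>2 / (1024 * t)))) = W / sqrt t * (v * exp (- (7 * v\<^sup>2 / 1024)))"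
          unfolding v2 by simp
        also have "\<dots> \<le> W / sqrt t * (205 * exp (- (v\<^sup>2 / 512)))"
          using v W0 st by (intro mult_left_mono gaussian_gain) auto
        also have "\<dots> = 205 * sqrt (4 * pi) * (W * G)"
        proof -
          have "exp (- (v\<^sup>2 / 512)) / sqrt t = sqrt (4 * pi) * G"
            unfolding G_def gker_scaled[OF t(1)] R_def[symmetric] v_def[symmetric] by simp
          then have "W * (205 * (exp (- (v\<^sup>2 / 512)) / sqrt t)) = W * (205 * (sqrt (4 * pi) * G))" by (rule arg_cong)
          then show ?thesis by (simp add: mult_ac)
        qed
        finally show ?thesis .
      qed
      have part2: "1 / sqrt t * (v * W * exp (- (35/256 * R))) \<le> 296 * (W * (t * e))"
      proof -
        have "1 / sqrt t * (v * W * exp (- (35/256 * R))) = W * (R * exp (- (35/256 * R))) / t"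
          using t by (simp add: v_def)
        also have "\<dots> \<le> W * (296 * e) / t"
          unfolding e_def using R W0 t by (intro divide_right_mono mult_left_mono mult_exp_le) auto
        also have "\<dots> \<le> W * (296 * e) / 1"
          using 1 W0 e0 by (intro divide_left_mono) auto
        also have "\<dots> \<le> W * (296 * e) * t"
          using 1 W0 e0 mult_left_mono[of 1 t "W * (296 * e)"] by simp
        finally show ?thesis by (simp add: mult_ac)
      qed
      have part3: "1 / sqrt t * (t * exp (- (5 * R / 32))) \<le> 296 * (W * (t * e))"
      proof -
        have "1 / sqrt t \<le> 1" using 1 by simp
        then have "1 / sqrt t * (t * exp (- (5 * R / 32))) \<le> 1 * (t * exp (- (5 * R / 32)))"
          using t by (intro mult_right_mono) auto
        also have "exp (- (5 * R / 32)) \<le> 296 * W * e" using expW[of "5/32"] by simp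
        finally show ?thesis using t by (simp add: mult_ac mult_left_mono)
      qed
      have "p t x y \<le> C\<^sub>1 / sqrt t * (min 1 (m / sqrt t) * exp (l\<^sup>2 * t - l * R / 4) + t * exp (- (5 * R / 32)))"
        unfolding m_def R_def by (rule density_one_sided[OF x y r 1 t(2) l])
      also have "\<dots> \<le> C\<^sub>1 / sqrt t * ((v * W) * (exp (- (7 * R\<^sup>2 / (1024 * t))) + exp (- (35/256 * R))) + t * exp (- (5 * R / 32)))"
        using C\<^sub>1_nonneg mv E v W0 st by (intro mult_left_mono add_right_mono mult_mono) auto
      also have "\<dots> = C\<^sub>1 * (1 / sqrt t * (v * W * exp (- (7 * R\<^sup>2 / (1024 * t)))) + 1 / sqrt t * (v * W * exp (- (35/256 * R)))
          + 1 / sqrt t * (t * exp (- (5 * R / 32))))"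
        by (simp add: distrib_left add_divide_distrib)
      also have "\<dots> \<le> C\<^sub>1 * (205 * sqrt (4 * pi) * (W * G) + 296 * (W * (t * e)) + 296 * (W * (t * e)))"
        using part1 part2 part3 C\<^sub>1_nonneg by (intro mult_left_mono add_mono) auto
      also have "\<dots> \<le> C\<^sub>1 * ((205 * sqrt (4 * pi) + 592) * (W * (G + t * e)))"
      proof (rule mult_left_mono[OF _ C\<^sub>1_nonneg])
        have "0 \<le> W * G" "0 \<le> W * (t * e)" using W0 G0 e0 t by auto
        then have "0 \<le> sqrt (4 * pi) * (W * (t * e))" by simp
        with \<open>0 \<le> W * G\<close> show "205 * sqrt (4 * pi) * (W * G) + 296 * (W * (t * e)) + 296 * (W * (t * e))
            \<le> (205 * sqrt (4 * pi) + 592) * (W * (G + t * e))"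
          unfolding distrib_left[of W] by (simp add: distrib_left distrib_right)
      qed
      also have "\<dots> = (C\<^sub>1 * (205 * sqrt (4 * pi) + 592)) * (W * (G + t * e))" by (simp only: mult.assoc)
      also have "\<dots> \<le> C\<^sub>0 * (W * (G + t * e))"
        unfolding C\<^sub>0_def using D_nonneg W0 G0 e0 t by (intro mult_right_mono) auto
      finally show ?thesis .
    next
      case 2
      have "p t x y \<le> D / sqrt t * exp ((5/8)\<^sup>2 * (1 + t) - 5/8 * R)"
        unfolding R_def using x y 2 by (intro density_free) (auto simp: power2_eq_square)
      also have "\<dots> \<le> (2 * D) * (exp 2 * exp (- (5/8 * R)))"
      proof (rule mult_mono)
        have "sqrt ((1/2)\<^sup>2) \<le> sqrt t" using 2 by (intro real_sqrt_le_mono) (simp add: power2_eq_square)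
        then have "1/2 \<le> sqrt t" by simp
        then have "D / sqrt t \<le> D / (1/2)" using D_nonneg t by (intro divide_left_mono) auto
        then show "D / sqrt t \<le> 2 * D" by simp
        have "(5/8)\<^sup>2 * (1 + t) \<le> (5/8)\<^sup>2 * 3" using 2 by (intro mult_left_mono) auto
        also have "\<dots> \<le> (2::real)" by (simp add: power2_eq_square)
        finally show "exp ((5/8)\<^sup>2 * (1 + t) - 5/8 * R) \<le> exp 2 * exp (- (5/8 * R))"
          unfolding exp_add[symmetric] by simp
      qed (use D_nonneg in auto)
      also have "\<dots> \<le> (2 * D) * (exp 2 * (296 * W * e))"
        using D_nonneg expW[of "5/8"] by (intro mult_left_mono) auto
      also have "\<dots> = 2 * D * exp 2 * 296 * (W * e)" by simp
      also have "\<dots> \<le> 2 * D * exp 2 * 296 * (W * (2 * (G + t * e)))"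
      proof (intro mult_left_mono W0)
        have "1/2 * e \<le> t * e" using 2 e0 by (intro mult_right_mono) auto
        then show "e \<le> 2 * (G + t * e)" using G0 by simp
      qed (use D_nonneg in simp)
      also have "\<dots> = (4 * D * exp 2 * 296) * (W * (G + t * e))"
        by (simp add: algebra_simps)
      also have "\<dots> \<le> C\<^sub>0 * (W * (G + t * e))"
        unfolding C\<^sub>0_def using C\<^sub>1_nonneg W0 G0 e0 t by (intro mult_right_mono) auto
      finally show ?thesis .
    next
      case 3
      have "p t x y \<le> exp (1/4) * sqrt (4 * pi) * 4096 * t * exp (- R / 2)"
        unfolding R_def using x y 3 t r by (intro density_small_time) auto
      also have "\<dots> \<le> exp (1/4) * sqrt (4 * pi) * 4096 * t * (296 * W * e)"
        using expW[of "1/2"] t by (intro mult_left_mono) auto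
      also have "\<dots> = (exp (1/4) * sqrt (4 * pi) * 4096 * 296) * (W * (t * e))" by simp
      also have "\<dots> \<le> (exp (1/4) * sqrt (4 * pi) * 4096 * 296) * (W * (G + t * e))"
        using W0 G0 by (intro mult_left_mono) auto
      also have "\<dots> \<le> C\<^sub>0 * (W * (G + t * e))"
        unfolding C\<^sub>0_def using C\<^sub>1_nonneg D_nonneg W0 G0 e0 t by (intro mult_right_mono) auto
      finally show ?thesis .
    qed
  qed
  then show ?thesis by (simp add: W_def G_def e_def R_def mult.assoc)
qed

end

section \<open>Integration over time\<close>

lemma nn_integral_powr_tail:
  fixes k a :: real
  assumes k: "0 < k" and a: "0 < a"
  shows "(\<integral>\<^sup>+ t. ennreal (t powr (- k - 1)) * indicator {a..} t \<partial>lborel) = ennreal (a powr (- k) / k)"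
proof -
  have "(\<integral>\<^sup>+ t. ennreal (t powr (- k - 1)) * indicator {a..} t \<partial>lborel) = ennreal (0 - (- (a powr (- k) / k)))"
  proof (rule nn_integral_FTC_atLeast)
    show "((\<lambda>t. - (t powr (- k) / k)) has_real_derivative t powr (- k - 1)) (at t)" if "a \<le> t" for t
    proof -
      have "((\<lambda>t. - (t powr (- k) / k)) has_real_derivative - ((- k * t powr (- k - 1)) / k)) (at t)"
        using that a by (intro DERIV_minus DERIV_cdivide has_real_derivative_powr) simp
      then show ?thesis using k by simp
    qed
    have "((\<lambda>t. t powr (- k)) \<longlongrightarrow> 0) at_top"
      using k by (intro tendsto_neg_powr filterlim_ident) auto
    then have "((\<lambda>t. - (t powr (- k) / k)) \<longlongrightarrow> - (0 / k)) at_top"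
      using k by (intro tendsto_minus tendsto_divide tendsto_const) auto
    then show "((\<lambda>t. - (t powr (- k) / k)) \<longlongrightarrow> 0) at_top" by simp
  qed auto
  then show ?thesis by simp
qed

lemma powr_exp_decay:
  fixes v :: real and d :: nat
  assumes "1 \<le> v"
  shows "v powr (real d / 2) * exp (- (v / 512)) \<le> 512 ^ d * fact d"
proof -
  have "v powr (real d / 2) \<le> v powr real d" using assms by (intro powr_mono) auto
  also have "\<dots> = v ^ d" using assms by (simp add: powr_realpow)
  also have "\<dots> \<le> 512 ^ d * fact d * exp (v / 512)" using assms by (intro power_le_exp) auto
  finally have "v powr (real d / 2) * exp (- (v / 512)) \<le> 512 ^ d * fact d * exp (v / 512) * exp (- (v / 512))"
    by (intro mult_right_mono) auto
  also have "\<dots> = 512 ^ d * fact d" unfolding mult.assoc exp_add[symmetric] by simp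
  finally show ?thesis .
qed

text \<open>With v = r^2 / t \<ge> 1 the Gaussian term is at most v^(d/2) exp (- v / 512) r^(-d),
  bounded in v apart from r^(-d). In the other term the power of t is at most 1 because d \<ge> 1,
  and t \<le> r^2 leaves r^(d + 2) exp (- 2 r / 15), again over r^d.\<close>

lemma weighted_kernel_bound:
  fixes d :: nat
  assumes d: "0 < d" and z: "1 \<le> \<bar>z\<bar>" and t: "1 \<le> t" "t \<le> \<bar>z\<bar>\<^sup>2"
  shows "t powr (- real d / 2 + 1 / 2) * (gker t ((1 / (8 * sqrt 2)) * z) + t * exp (- (2 * \<bar>z\<bar> / 15)))
    \<le> (512 ^ d * fact d + (15/2) ^ (d + 2) * fact (d + 2)) / \<bar>z\<bar> ^ d"
proof -
  define r where "r = \<bar>z\<bar>"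
  define v where "v = (r / sqrt t)\<^sup>2"
  have r: "1 \<le> r" using z by (simp add: r_def)
  have vt: "v = r\<^sup>2 / t" using t by (simp add: v_def power_divide)
  have v: "1 \<le> v" using t r unfolding vt by (simp add: r_def)
  have rd: "0 < r ^ d" using r by simp
  have 1: "t powr (- real d / 2 + 1 / 2) * gker t ((1 / (8 * sqrt 2)) * z) \<le> 512 ^ d * fact d / r ^ d"
  proof -
    have "gker t ((1 / (8 * sqrt 2)) * z) = exp (- (v / 512)) / (sqrt (4 * pi) * sqrt t)"
      using gker_scaled[of t z] t by (simp add: v_def r_def)
    also have "\<dots> \<le> exp (- (v / 512)) / (1 * sqrt t)"
      using t pi_gt3 by (intro divide_left_mono mult_right_mono mult_pos_pos) auto
    also have "\<dots> = exp (- (v / 512)) * t powr (- (1/2))"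
    proof -
      have "t powr (- (1/2)) = 1 / sqrt t"
        using t by (simp add: powr_minus powr_half_sqrt inverse_eq_divide)
      then show ?thesis by simp
    qed
    finally have "t powr (- real d / 2 + 1 / 2) * gker t ((1 / (8 * sqrt 2)) * z) \<le>
        t powr (- real d / 2 + 1 / 2) * (exp (- (v / 512)) * t powr (- (1/2)))"
      by (intro mult_left_mono) auto
    also have "\<dots> = (t powr (- real d / 2 + 1 / 2) * t powr (- (1/2))) * exp (- (v / 512))" by simp
    also have "t powr (- real d / 2 + 1 / 2) * t powr (- (1/2)) = t powr (- (real d / 2))"
      unfolding powr_add[symmetric] by simp
    also have "t powr (- (real d / 2)) = v powr (real d / 2) / r ^ d"
    proof -
      have "v powr (real d / 2) = (r\<^sup>2) powr (real d / 2) / t powr (real d / 2)"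
        unfolding vt using t by (simp add: powr_divide)
      also have "(r\<^sup>2) powr (real d / 2) = r ^ d"
      proof -
        have "(r\<^sup>2) powr (real d / 2) = (r powr 2) powr (real d / 2)" using r by simp
        also have "\<dots> = r powr (real d)" by (simp add: powr_powr)
        finally show ?thesis using r by (simp add: powr_realpow)
      qed
      finally have "v powr (real d / 2) = r ^ d * t powr (- (real d / 2))"
        by (simp only: powr_minus divide_inverse)
      then show ?thesis using r by simp
    qed
    also have "v powr (real d / 2) / r ^ d * exp (- (v / 512)) = (v powr (real d / 2) * exp (- (v / 512))) / r ^ d" by simp
    also have "\<dots> \<le> 512 ^ d * fact d / r ^ d"
      using rd by (intro divide_right_mono powr_exp_decay v) auto
    finally show ?thesis .
  qed
  have 2: "t powr (- real d / 2 + 1 / 2) * (t * exp (- (2 * r / 15))) \<le> (15/2) ^ (d + 2) * fact (d + 2) / r ^ d"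
  proof -
    have "- real d / 2 + 1 / 2 \<le> 0" using d by simp
    then have "t powr (- real d / 2 + 1 / 2) \<le> t powr 0" using t by (intro powr_mono) auto
    then have "t powr (- real d / 2 + 1 / 2) \<le> 1" using t by simp
    then have "t powr (- real d / 2 + 1 / 2) * (t * exp (- (2 * r / 15))) \<le> 1 * (r\<^sup>2 * exp (- (2 * r / 15)))"
      using t by (intro mult_mono mult_right_mono) (auto simp: r_def)
    also have "r\<^sup>2 * exp (- (2 * r / 15)) = r ^ (d + 2) * exp (- (2 * r / 15)) / r ^ d"
      using r by (simp add: power_add power2_eq_square)
    also have "\<dots> \<le> (15/2) ^ (d + 2) * fact (d + 2) / r ^ d"
    proof (rule divide_right_mono)
      have "r ^ (d + 2) \<le> (15/2) ^ (d + 2) * fact (d + 2) * exp (r / (15/2))"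
        using r by (intro power_le_exp) auto
      then have "r ^ (d + 2) * exp (- (2 * r / 15)) \<le> (15/2) ^ (d + 2) * fact (d + 2) * exp (r / (15/2)) * exp (- (2 * r / 15))"
        by (intro mult_right_mono) auto
      also have "\<dots> = (15/2) ^ (d + 2) * fact (d + 2) * (exp (r / (15/2)) * exp (- (2 * r / 15)))"
        by (simp only: mult.assoc)
      also have "exp (r / (15/2)) * exp (- (2 * r / 15)) = 1"
      proof -
        have "r / (15/2) + - (2 * r / 15) = 0" by simp
        then show ?thesis by (simp only: exp_add[symmetric] exp_zero)
      qed
      also have "(15/2) ^ (d + 2) * fact (d + 2) * 1 = (15/2) ^ (d + 2) * (fact (d + 2) :: real)"
        by (simp only: mult_1_right)
      finally show "r ^ (d + 2) * exp (- (2 * r / 15)) \<le> (15/2) ^ (d + 2) * fact (d + 2)" .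
    qed (use rd in simp)
    finally show ?thesis by simp
  qed
  from add_mono[OF 1 2] show ?thesis
    by (simp add: distrib_left add_divide_distrib r_def)
qed

context killed_process
begin

lemma density_levy_bound:
  "\<exists>C. \<forall>x y t. 1 \<le> x \<and> 1 \<le> y \<and> 1 \<le> \<bar>x - y\<bar> \<and> 0 < t \<and> t \<le> \<bar>x - y\<bar>\<^sup>2 \<longrightarrow>
      p t x y \<le> C * min (x * y / \<bar>x - y\<bar>\<^sup>2) 1 *
        (gker t ((1 / (8 * sqrt 2)) * (x - y)) + t * levy_nu \<alpha> ((1 / (8 * sqrt 2)) * (x - y)))"
proof -
  obtain k where k: "0 < k" "\<And>z. z \<noteq> 0 \<Longrightarrow> k * exp (- (2 * \<bar>z\<bar> / 15)) \<le> levy_nu \<alpha> ((1 / (8 * sqrt 2)) * z)"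
    using levy_nu_lower[OF \<alpha>] by blast
  show ?thesis
  proof (intro exI[of _ "C\<^sub>0 * (1 + 1 / k)"] allI impI, elim conjE)
    fix x y t :: real assume a: "1 \<le> x" "1 \<le> y" "1 \<le> \<bar>x - y\<bar>" "0 < t" "t \<le> \<bar>x - y\<bar>\<^sup>2"
    define W where "W = min (x * y / \<bar>x - y\<bar>\<^sup>2) 1"
    define G where "G = gker t ((1 / (8 * sqrt 2)) * (x - y))"
    define \<nu> where "\<nu> = levy_nu \<alpha> ((1 / (8 * sqrt 2)) * (x - y))"
    define e where "e = exp (- (2 * \<bar>x - y\<bar> / 15))"
    have W: "0 \<le> W" using a by (simp add: W_def)
    have G: "0 \<le> G" by (simp add: G_def gker_nonneg)
    have ke: "k * e \<le> \<nu>" unfolding e_def \<nu>_def using a by (intro k) auto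
    then have e: "e \<le> (1 / k) * \<nu>" using k by (simp add: pos_le_divide_eq mult.commute)
    have \<nu>: "0 \<le> \<nu>" using ke k by (smt (verit) e_def exp_gt_zero mult_pos_pos)
    have "p t x y \<le> C\<^sub>0 * W * (G + t * e)"
      using density_upper_bound[OF a] by (simp only: W_def G_def e_def)
    also have "\<dots> \<le> C\<^sub>0 * W * ((1 + 1 / k) * (G + t * \<nu>))"
    proof (intro mult_left_mono mult_nonneg_nonneg C\<^sub>0_nonneg W)
      have "t * e \<le> t * ((1 / k) * \<nu>)" using e a by (intro mult_left_mono) auto
      moreover have "0 \<le> (1 / k) * G" "0 \<le> t * \<nu>" using G k \<nu> a by auto
      ultimately show "G + t * e \<le> (1 + 1 / k) * (G + t * \<nu>)"
        by (simp add: distrib_right distrib_left)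
    qed
    also have "\<dots> = C\<^sub>0 * (1 + 1 / k) * W * (G + t * \<nu>)" by simp
    finally show "p t x y \<le> C\<^sub>0 * (1 + 1 / k) * min (x * y / \<bar>x - y\<bar>\<^sup>2) 1 *
        (gker t ((1 / (8 * sqrt 2)) * (x - y)) + t * levy_nu \<alpha> ((1 / (8 * sqrt 2)) * (x - y)))"
      by (simp only: W_def G_def \<nu>_def)
  qed
qed

text \<open>Split at t = r^2. Below, the integrand is at most a constant times (x y / r^2) r^(-d),
  and the length r^2 of the interval cancels r^2. Above, \<open>density_two_sided\<close> makes it
  at most a constant times x y t^(-d/2 - 1), whose tail integral is of order r^(-d).\<close>

lemma density_integral_bound:
  fixes d :: nat
  assumes d: "0 < d"
  shows "\<exists>c. \<forall>x y. 1 \<le> x \<and> 1 \<le> y \<and> 1 \<le> \<bar>x - y\<bar> \<longrightarrow>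
    (\<integral>\<^sup>+ t\<in>{1..}. ennreal (t powr (- real d / 2 + 1 / 2) * p t x y) \<partial>lborel) \<le> ennreal (c * x * y / \<bar>x - y\<bar> ^ d)"
proof -
  define K :: real where "K = 512 ^ d * fact d + (15/2) ^ (d + 2) * fact (d + 2)"
  have K: "0 \<le> K" by (simp add: K_def)
  show ?thesis
  proof (intro exI[of _ "C\<^sub>0 * K + 2 * C\<^sub>2"] allI impI, elim conjE)
    fix x y :: real assume a: "1 \<le> x" "1 \<le> y" "1 \<le> \<bar>x - y\<bar>"
    define r where "r = \<bar>x - y\<bar>"
    have r: "1 \<le> r" using a by (simp add: r_def)
    have rd: "0 < r ^ d" using r by simp
    have xy: "0 \<le> x * y" using a by simp
    define A where "A = C\<^sub>0 * K * (x * y) / (r\<^sup>2 * r ^ d)"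
    define B where "B = C\<^sub>2 * (x * y)"
    have "0 \<le> C\<^sub>0 * K * (x * y)" using C\<^sub>0_nonneg K xy by (simp only: mult_nonneg_nonneg)
    then have A: "0 \<le> A" unfolding A_def using r by (intro divide_nonneg_nonneg) auto
    have B: "0 \<le> B" using C\<^sub>2_nonneg xy by (simp add: B_def)
    have small: "t powr (- real d / 2 + 1 / 2) * p t x y \<le> A" if t: "1 \<le> t" "t \<le> r\<^sup>2" for t
    proof -
      define w where "w = t powr (- real d / 2 + 1 / 2)"
      define H where "H = gker t ((1 / (8 * sqrt 2)) * (x - y)) + t * exp (- (2 * r / 15))"
      have H: "0 \<le> H" using t by (simp add: H_def gker_nonneg)
      have w: "0 \<le> w" by (simp add: w_def)
      have "p t x y \<le> C\<^sub>0 * min (x * y / r\<^sup>2) 1 * H"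
        using density_upper_bound[OF a, of t] t by (simp add: r_def H_def)
      also have "\<dots> \<le> C\<^sub>0 * (x * y / r\<^sup>2) * H"
        using C\<^sub>0_nonneg H by (intro mult_right_mono mult_left_mono) auto
      finally have "w * p t x y \<le> w * (C\<^sub>0 * (x * y / r\<^sup>2) * H)" using w by (intro mult_left_mono)
      also have "\<dots> = C\<^sub>0 * (x * y / r\<^sup>2) * (w * H)" by simp
      also have "\<dots> \<le> C\<^sub>0 * (x * y / r\<^sup>2) * (K / r ^ d)"
      proof (rule mult_left_mono)
        show "w * H \<le> K / r ^ d"
          using weighted_kernel_bound[OF d a(3) t(1)] t(2) by (simp add: w_def H_def K_def r_def)
        show "0 \<le> C\<^sub>0 * (x * y / r\<^sup>2)" using C\<^sub>0_nonneg xy by simp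
      qed
      also have "\<dots> = A" by (simp add: A_def)
      finally show ?thesis by (simp only: w_def)
    qed
    have large: "t powr (- real d / 2 + 1 / 2) * p t x y \<le> B * t powr (- (real d / 2) - 1)" if t: "1 \<le> t" for t
    proof -
      have "p t x y \<le> B / (t * sqrt t)" unfolding B_def by (rule density_two_sided[OF a(1,2) t])
      also have "t * sqrt t = t powr (3/2)"
        using t powr_add[of t 1 "1/2"] by (simp add: powr_half_sqrt)
      also have "B / t powr (3/2) = B * t powr (- (3/2))" by (simp only: powr_minus divide_inverse)
      finally have "t powr (- real d / 2 + 1 / 2) * p t x y \<le> t powr (- real d / 2 + 1 / 2) * (B * t powr (- (3/2)))"
        by (intro mult_left_mono) auto
      also have "\<dots> = B * (t powr (- real d / 2 + 1 / 2) * t powr (- (3/2)))" by simp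
      also have "t powr (- real d / 2 + 1 / 2) * t powr (- (3/2)) = t powr (- (real d / 2) - 1)"
        unfolding powr_add[symmetric] by (rule arg_cong[where f="\<lambda>e. t powr e"]) simp
      finally show ?thesis .
    qed
    have "(\<integral>\<^sup>+ t\<in>{1..}. ennreal (t powr (- real d / 2 + 1 / 2) * p t x y) \<partial>lborel) \<le>
      (\<integral>\<^sup>+ t. ennreal A * indicator {1..r\<^sup>2} t + ennreal B * (ennreal (t powr (- (real d / 2) - 1)) * indicator {r\<^sup>2..} t) \<partial>lborel)"
    proof (rule nn_integral_mono)
      fix t :: real
      show "ennreal (t powr (- real d / 2 + 1 / 2) * p t x y) * indicator {1..} t \<le>
        ennreal A * indicator {1..r\<^sup>2} t + ennreal B * (ennreal (t powr (- (real d / 2) - 1)) * indicator {r\<^sup>2..} t)"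
      proof (cases "1 \<le> t")
        case True
        show ?thesis
        proof (cases "t \<le> r\<^sup>2")
          case 2: True
          then have "ennreal (t powr (- real d / 2 + 1 / 2) * p t x y) \<le> ennreal A"
            using small[OF True] by (intro ennreal_leI) auto
          then show ?thesis using True 2 by (simp add: add_increasing2)
        next
          case 2: False
          have "ennreal (t powr (- real d / 2 + 1 / 2) * p t x y) \<le> ennreal (B * t powr (- (real d / 2) - 1))"
            using large[OF True] by (intro ennreal_leI)
          also have "\<dots> = ennreal B * ennreal (t powr (- (real d / 2) - 1))" using B by (simp add: ennreal_mult)
          finally show ?thesis using True 2 by simp
        qed
      qed simp
    qed
    also have "\<dots> = (\<integral>\<^sup>+ t. ennreal A * indicator {1..r\<^sup>2} t \<partial>lborel) +
        (\<integral>\<^sup>+ t. ennreal B * (ennreal (t powr (- (real d / 2) - 1)) * indicator {r\<^sup>2..} t) \<partial>lborel)"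
      by (rule nn_integral_add) auto
    also have "(\<integral>\<^sup>+ t. ennreal A * indicator {1..r\<^sup>2} t \<partial>lborel) = ennreal A * ennreal (r\<^sup>2 - 1)"
      using r by (subst nn_integral_cmult_indicator) (auto simp: one_le_power)
    also have "(\<integral>\<^sup>+ t. ennreal B * (ennreal (t powr (- (real d / 2) - 1)) * indicator {r\<^sup>2..} t) \<partial>lborel) =
        ennreal B * ennreal ((r\<^sup>2) powr (- (real d / 2)) / (real d / 2))"
      using d r by (subst nn_integral_cmult) (auto simp: nn_integral_powr_tail)
    finally have split: "(\<integral>\<^sup>+ t\<in>{1..}. ennreal (t powr (- real d / 2 + 1 / 2) * p t x y) \<partial>lborel) \<le>
      ennreal A * ennreal (r\<^sup>2 - 1) + ennreal B * ennreal ((r\<^sup>2) powr (- (real d / 2)) / (real d / 2))" .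
    have "(r\<^sup>2) powr (- (real d / 2)) / (real d / 2) \<le> 2 / r ^ d"
    proof -
      have "(r\<^sup>2) powr (- (real d / 2)) = (r powr 2) powr (- (real d / 2))" using r by simp
      also have "\<dots> = r powr (- real d)" by (simp add: powr_powr)
      also have "\<dots> = 1 / r ^ d" using r by (simp add: powr_minus powr_realpow inverse_eq_divide)
      finally have "(r\<^sup>2) powr (- (real d / 2)) / (real d / 2) = (2 / r ^ d) / real d" by simp
      also have "\<dots> \<le> (2 / r ^ d) / 1" using d rd by (intro divide_left_mono) auto
      finally show ?thesis by simp
    qed
    then have "ennreal A * ennreal (r\<^sup>2 - 1) + ennreal B * ennreal ((r\<^sup>2) powr (- (real d / 2)) / (real d / 2)) \<le>
      ennreal A * ennreal (r\<^sup>2 - 1) + ennreal B * ennreal (2 / r ^ d)"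
      by (intro add_left_mono mult_left_mono ennreal_leI) auto
    with split have "(\<integral>\<^sup>+ t\<in>{1..}. ennreal (t powr (- real d / 2 + 1 / 2) * p t x y) \<partial>lborel) \<le>
        ennreal A * ennreal (r\<^sup>2 - 1) + ennreal B * ennreal (2 / r ^ d)"
      by (rule order_trans)
    also have "\<dots> = ennreal (A * (r\<^sup>2 - 1) + B * (2 / r ^ d))"
      using A B r rd by (simp add: ennreal_mult[symmetric] ennreal_plus[symmetric] one_le_power del: ennreal_plus)
    also have "\<dots> \<le> ennreal ((C\<^sub>0 * K + 2 * C\<^sub>2) * x * y / r ^ d)"
    proof (rule ennreal_leI)
      have "A * (r\<^sup>2 - 1) \<le> A * r\<^sup>2" using A by (intro mult_left_mono) auto
      also have "\<dots> = C\<^sub>0 * K * (x * y) / r ^ d" using r by (simp add: A_def)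
      finally have "A * (r\<^sup>2 - 1) + B * (2 / r ^ d) \<le> C\<^sub>0 * K * (x * y) / r ^ d + B * (2 / r ^ d)" by simp
      also have "\<dots> = (C\<^sub>0 * K + 2 * C\<^sub>2) * x * y / r ^ d"
      proof -
        have "B * (2 / r ^ d) = 2 * C\<^sub>2 * (x * y) / r ^ d" by (simp add: B_def)
        then show ?thesis
          by (simp only: add_divide_distrib[symmetric] distrib_right mult.assoc)
      qed
      finally show "A * (r\<^sup>2 - 1) + B * (2 / r ^ d) \<le> (C\<^sub>0 * K + 2 * C\<^sub>2) * x * y / r ^ d" .
    qed
    finally show "(\<integral>\<^sup>+ t\<in>{1..}. ennreal (t powr (- real d / 2 + 1 / 2) * p t x y) \<partial>lborel)
        \<le> ennreal ((C\<^sub>0 * K + 2 * C\<^sub>2) * x * y / \<bar>x - y\<bar> ^ d)"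
      by (simp only: r_def)
  qed
qed

end

theorem theorem4p7:
  fixes M :: "'a measure" and X :: "real \<Rightarrow> 'a \<Rightarrow> real"
    and p :: "real \<Rightarrow> real \<Rightarrow> real \<Rightarrow> real" and \<alpha> :: real
  assumes "0 < \<alpha>" and "\<alpha> < 2"
    and "rel_stable_process M \<alpha> X"
    and "killed_density M X p"
  shows "(\<exists>C. \<forall>x y t. 1 \<le> x \<and> 1 \<le> y \<and> 1 \<le> \<bar>x - y\<bar> \<and> 0 < t \<and> t \<le> \<bar>x - y\<bar>^2 \<longrightarrow>
            p t x y \<le> C * min (x * y / \<bar>x - y\<bar>^2) 1 *
              (gker t ((1 / (8 * sqrt 2)) * (x - y)) + t * levy_nu \<alpha> ((1 / (8 * sqrt 2)) * (x - y))))
       \<and> (\<forall>d::nat. 0 < d \<longrightarrow> (\<exists>c. \<forall>x y. 1 \<le> x \<and> 1 \<le> y \<and> 1 \<le> \<bar>x - y\<bar> \<longrightarrow>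
            (\<integral>\<^sup>+ t\<in>{1..}. ennreal (t powr (- real d / 2 + 1 / 2) * p t x y) \<partial>lborel)
              \<le> ennreal (c * x * y / \<bar>x - y\<bar> ^ d)))"
proof -
  interpret killed_process M X \<alpha> p
    using assms by unfold_locales
  show ?thesis
    by (intro conjI allI impI density_levy_bound density_integral_bound)
qed

end
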